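(* Let $\Omega\subset\mathbb{R}^n$ be a domain and let $E$ be a bounded domain with $\overline{E}\subseteq\Omega$. Let $p(\cdot)\in\mathcal{P}(E)$ with $1<p_-\le p_+<\infty$. Suppose $v$ is a weight in $\Omega$ (with $v(E)=\int_E v\,dx>0$) and $Q:\Omega\to\mathcal{S}_n$ is a measurable matrix function such that $v,\ \gamma^{1/2}\in L^{p(\cdot)}(E)$, where $\gamma(x)=|Q(x)|_{\mathrm{op}}$. Then the pair $(v,Q)$ has the Poincaré property of order $p(\cdot)$ on $E$ if and only if $(v,Q)$ has the $p(\cdot)$-Neumann property on $E$.
   Context: Exponents and variable Lebesgue spaces. $\mathcal{P}(E)$ is the set of Lebesgue measurable functions $p(\cdot):E\to[1,\infty]$; $p_-=\operatorname{ess\,inf}_E p$, $p_+=\operatorname{ess\,sup}_E p$. When $p_+<\infty$, the modular is $\rho(f)=\int_E|f(x)|^{p(x)}dx$, and $L^{p(\cdot)}(E)$ is the space of measurable $f:E\to\mathbb{R}$ with $\|f\|_{L^{p(\cdot)}(E)}=\inf\{\mu>0:\rho(f/\mu)\le 1\}<\infty$. A weight is a non-negative function $v\in L^1_{\mathrm{loc}}(\Omega)$; $L^{p(\cdot)}(v;E)$ is the space of measurable $f$ with $\|f\|_{L^{p(\cdot)}(v;E)}=\|fv\|_{L^{p(\cdot)}(E)}<\infty$. Functions at distance zero in the norm are identified. The weighted average is $f_{E,v}=\frac{1}{v(E)}\int_E f v\,dx$, $v(E)=\int_E v\,dx$. Matrix weights. $\mathcal{S}_n$ is the set of real symmetric positive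 semi-definite $n\times n$ matrices; $Q$ has Lebesgue measurable entries; $\sqrt{Q(x)}$ is the positive semi-definite square root; $|Q(x)|_{\mathrm{op}}=\sup_{|\xi|=1}|Q(x)\xi|$. $\mathcal{L}^{p(\cdot)}_Q(E)$ is the space of measurable $\mathbf{f}:E\to\mathbb{R}^n$ with $\|\mathbf{f}\|_{\mathcal{L}^{p(\cdot)}_Q(E)}=\|\,|\sqrt{Q}\,\mathbf{f}|\,\|_{L^{p(\cdot)}(E)}<\infty$ (again with identification of elements at distance zero). Sobolev spaces. $C^1(\overline{E})$ denotes functions that are continuously differentiable up to the closure of $E$. $H^{1,p(\cdot)}_Q(v;E)$ is the completion of $C^1(\overline{E})$ with respect to $\|f\|_{H^{1,p(\cdot)}_Q(v;E)}=\|f\|_{L^{p(\cdot)}(v;E)}+\|\nabla f\|_{\mathcal{L}^{p(\cdot)}_Q(E)}$; it is identified with the set of pairs $(u,\mathbf{g})\in L^{p(\cdot)}(v;E)\times\mathcal{L}^{p(\cdot)}_Q(E)$ that are limits in the product norm of sequences $(u_k,\nabla u_k)$ with $u_k\in C^1(\overline{E})$. $\tilde H^{1,p(\cdot)}_Q(v;E)$ is the subspace of pairs $(u,\mathbf{g})$ with $\int_E u v\,dx=0$. A function $\varphi\in C^1(\overline{E})$ is identified with $(\varphi,\nabla\varphi)$. Poincaré property of order $p(\cdot)$ on $E$: there is a constant $C_0=C_0(E,p(\cdot))>0$ such that for all $f\in C^1(\overline{E})$, $\|f-f_{E,v}\|_{L^{p(\cdot)}(v;E)}\le C_0\|\nabla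 f\|_{\mathcal{L}^{p(\cdot)}_Q(E)}$. Weak solution: given $f\in L^{p(\cdot)}(v;E)$, a pair $(u,\mathbf{g})_f=(u,\mathbf g)\in\tilde H^{1,p(\cdot)}_Q(v;E)$ is a weak solution of the degenerate Neumann problem $$\operatorname{div}\big(|\sqrt{Q}\nabla u|^{p(x)-2}Q\nabla u\big)=|f|^{p(x)-2}f\,v^{p(x)}\ \text{in }E,\qquad \mathbf{n}^T\cdot Q\nabla u=0\ \text{on }\partial E,$$ if for all $\varphi\in C^1(\overline{E})\cap\tilde H^{1,p(\cdot)}_Q(v;E)$, $$\int_E|\sqrt{Q}\,\mathbf{g}|^{p(x)-2}(\nabla\varphi)^TQ\,\mathbf{g}\,dx=-\int_E|f|^{p(x)-2}f\,\varphi\, v^{p(x)}dx .$$ (No regularity of $\partial E$ is assumed; expressions $|\xi|^{p-2}\xi$ are $0$ when $\xi=0$.) $p(\cdot)$-Neumann property on $E$: (1) for every $f\in L^{p(\cdot)}(v;E)$ there exists a weak solution $(u,\mathbf{g})_f\in\tilde H^{1,p(\cdot)}_Q(v;E)$; and (2) there is a constant $C_1=C_1(p(\cdot),v,E)>0$ such that for every $f\in L^{p(\cdot)}(v;E)$ and any weak solution $(u,\mathbf{g})_f$ with data $f$, $\|u\|_{L^{p(\cdot)}(v;E)}\le C_1\|f\|_{L^{p(\cdot)}(v;E)}^{\frac{r_*-1}{p_*-1}}$, where $p_*=p_+$ if $\|\mathbf{g}\|_{\mathcal{L}^{p(\cdot)}_Q(E)}<1$ and $p_*=p_-$ if $\|\mathbf{g}\|_{\mathcal{L}^{p(\cdot)}_Q(E)}\ge1$;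 $r_*=p_+$ if $\|f\|_{L^{p(\cdot)}(v;E)}\ge1$ and $r_*=p_-$ if $\|f\|_{L^{p(\cdot)}(v;E)}<1$. *)

theory Defs
  imports "HOL-Analysis.Analysis" "HOL-Probability.Essential_Supremum"
begin

text \<open>Functions on \<open>E\<close> are total functions of which only the values on \<open>E\<close> are used;
  elements of the function spaces are representatives, not equivalence classes.\<close>

definition exponents :: "'a::euclidean_space set \<Rightarrow> ('a \<Rightarrow> ereal) set" where
  "exponents E = {p \<in> borel_measurable (lebesgue_on E). \<forall>x\<in>E. 1 \<le> p x}"

definition p_plus :: "'a::euclidean_space set \<Rightarrow> ('a \<Rightarrow> ereal) \<Rightarrow> ereal" where
  "p_plus E p = esssup (lebesgue_on E) p"

definition p_minus :: "'a::euclidean_space set \<Rightarrow> ('a \<Rightarrow> ereal) \<Rightarrow> ereal" where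
  "p_minus E p = Sup {z. AE x in lebesgue_on E. z \<le> p x}"

text \<open>Only meant for \<open>p_plus E p < \<infinity>\<close>: \<^const>\<open>real_of_ereal\<close> sends \<open>\<infinity>\<close> to \<open>0\<close>, but then \<open>p\<close> is
  infinite at most on a null set.\<close>

definition modular :: "'a::euclidean_space set \<Rightarrow> ('a \<Rightarrow> ereal) \<Rightarrow> ('a \<Rightarrow> real) \<Rightarrow> ennreal" where
  "modular E p f = (\<integral>\<^sup>+ x. ennreal (\<bar>f x\<bar> powr real_of_ereal (p x)) \<partial>lebesgue_on E)"

text \<open>The norm takes the value \<open>\<infinity>\<close> when no admissible \<open>\<mu>\<close> exists.\<close>

definition Lp_norm :: "'a::euclidean_space set \<Rightarrow> ('a \<Rightarrow> ereal) \<Rightarrow> ('a \<Rightarrow> real) \<Rightarrow> ennreal" where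
  "Lp_norm E p f = (INF \<mu> \<in> {\<mu>::real. 0 < \<mu> \<and> modular E p (\<lambda>x. f x / \<mu>) \<le> 1}. ennreal \<mu>)"

definition Lp :: "'a::euclidean_space set \<Rightarrow> ('a \<Rightarrow> ereal) \<Rightarrow> ('a \<Rightarrow> real) set" where
  "Lp E p = {f \<in> borel_measurable (lebesgue_on E). Lp_norm E p f < \<infinity>}"

definition weight :: "'a::euclidean_space set \<Rightarrow> ('a \<Rightarrow> real) \<Rightarrow> bool" where
  "weight \<Omega> v \<longleftrightarrow> (\<forall>x\<in>\<Omega>. 0 \<le> v x) \<and>
     (\<forall>K. compact K \<and> K \<subseteq> \<Omega> \<longrightarrow> integrable (lebesgue_on K) v)"

definition Lpv_norm ::
    "'a::euclidean_space set \<Rightarrow> ('a \<Rightarrow> ereal) \<Rightarrow> ('a \<Rightarrow> real) \<Rightarrow> ('a \<Rightarrow> real) \<Rightarrow> ennreal" where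
  "Lpv_norm E p v f = Lp_norm E p (\<lambda>x. f x * v x)"

definition Lpv ::
    "'a::euclidean_space set \<Rightarrow> ('a \<Rightarrow> ereal) \<Rightarrow> ('a \<Rightarrow> real) \<Rightarrow> ('a \<Rightarrow> real) set" where
  "Lpv E p v = {f \<in> borel_measurable (lebesgue_on E). Lpv_norm E p v f < \<infinity>}"

definition weighted_avg :: "'a::euclidean_space set \<Rightarrow> ('a \<Rightarrow> real) \<Rightarrow> ('a \<Rightarrow> real) \<Rightarrow> real" where
  "weighted_avg E v f =
     (\<integral>x. f x * v x \<partial>lebesgue_on E) / (\<integral>x. v x \<partial>lebesgue_on E)"

definition psd :: "real^'n^'n \<Rightarrow> bool" where
  "psd A \<longleftrightarrow> transpose A = A \<and> (\<forall>\<xi>. 0 \<le> \<xi> \<bullet> (A *v \<xi>))"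

definition mat_sqrt :: "real^'n^'n \<Rightarrow> real^'n^'n" where
  "mat_sqrt A = (THE S. psd S \<and> S ** S = A)"

definition matrix_weight :: "(real^'n) set \<Rightarrow> (real^'n \<Rightarrow> real^'n^'n) \<Rightarrow> bool" where
  "matrix_weight \<Omega> Q \<longleftrightarrow> (\<forall>x\<in>\<Omega>. psd (Q x)) \<and>
     (\<forall>i j. (\<lambda>x. Q x $ i $ j) \<in> borel_measurable (lebesgue_on \<Omega>))"

definition LQ_norm ::
    "(real^'n) set \<Rightarrow> (real^'n \<Rightarrow> ereal) \<Rightarrow> (real^'n \<Rightarrow> real^'n^'n) \<Rightarrow> (real^'n \<Rightarrow> real^'n) \<Rightarrow> ennreal"
  where "LQ_norm E p Q g = Lp_norm E p (\<lambda>x. norm (mat_sqrt (Q x) *v g x))"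

definition LQ ::
    "(real^'n) set \<Rightarrow> (real^'n \<Rightarrow> ereal) \<Rightarrow> (real^'n \<Rightarrow> real^'n^'n) \<Rightarrow> (real^'n \<Rightarrow> real^'n) set" where
  "LQ E p Q = {g \<in> borel_measurable (lebesgue_on E). LQ_norm E p Q g < \<infinity>}"

definition gradient :: "(real^'n \<Rightarrow> real) \<Rightarrow> real^'n \<Rightarrow> real^'n" where
  "gradient f x = (\<chi> i. frechet_derivative f (at x) (axis i 1))"

text \<open>\<open>C\<^sup>1\<close> up to the closure of an open set \<open>E\<close>: \<open>f\<close> is continuous on the closure, differentiable
  in \<open>E\<close>, and its gradient extends continuously from \<open>E\<close> to the closure. Nothing is required
  of \<open>f\<close> outside the closure.\<close>

definition C1_closure :: "(real^'n) set \<Rightarrow> (real^'n \<Rightarrow> real) set" where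
  "C1_closure E = {f. continuous_on (closure E) f \<and> (\<forall>x\<in>E. f differentiable (at x)) \<and>
     (\<exists>G. continuous_on (closure E) G \<and> (\<forall>x\<in>E. G x = gradient f x))}"

text \<open>The completion of \<open>C1_closure E\<close>, realised as the set of limits of the pairs
  \<open>(u\<^sub>k, \<nabla>u\<^sub>k)\<close> in the product norm.\<close>

definition H1 ::
    "(real^'n) set \<Rightarrow> (real^'n \<Rightarrow> ereal) \<Rightarrow> (real^'n \<Rightarrow> real) \<Rightarrow> (real^'n \<Rightarrow> real^'n^'n) \<Rightarrow>
     ((real^'n \<Rightarrow> real) \<times> (real^'n \<Rightarrow> real^'n)) set" where
  "H1 E p v Q = {(u, g). u \<in> Lpv E p v \<and> g \<in> LQ E p Q \<and>
     (\<exists>w :: nat \<Rightarrow> real^'n \<Rightarrow> real. (\<forall>k. w k \<in> C1_closure E) \<and>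
        (\<lambda>k. Lpv_norm E p v (\<lambda>x. w k x - u x) + LQ_norm E p Q (\<lambda>x. gradient (w k) x - g x))
          \<longlonglongrightarrow> 0)}"

definition H1_mean_zero ::
    "(real^'n) set \<Rightarrow> (real^'n \<Rightarrow> ereal) \<Rightarrow> (real^'n \<Rightarrow> real) \<Rightarrow> (real^'n \<Rightarrow> real^'n^'n) \<Rightarrow>
     ((real^'n \<Rightarrow> real) \<times> (real^'n \<Rightarrow> real^'n)) set" where
  "H1_mean_zero E p v Q =
     {(u, g). (u, g) \<in> H1 E p v Q \<and> (\<integral>x. u x * v x \<partial>lebesgue_on E) = 0}"

definition poincare_property ::
    "(real^'n) set \<Rightarrow> (real^'n \<Rightarrow> ereal) \<Rightarrow> (real^'n \<Rightarrow> real) \<Rightarrow> (real^'n \<Rightarrow> real^'n^'n) \<Rightarrow> bool" where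
  "poincare_property E p v Q \<longleftrightarrow>
     (\<exists>C0::real. 0 < C0 \<and> (\<forall>f \<in> C1_closure E.
        Lpv_norm E p v (\<lambda>x. f x - weighted_avg E v f) \<le> ennreal C0 * LQ_norm E p Q (gradient f)))"

text \<open>Since \<open>0 powr a = 0\<close>, the terms \<open>|\<xi>|\<^bsup>p-2\<^esup>\<xi>\<close> vanish at \<open>\<xi> = 0\<close>, also for \<open>p < 2\<close>.\<close>

definition weak_solution ::
    "(real^'n) set \<Rightarrow> (real^'n \<Rightarrow> ereal) \<Rightarrow> (real^'n \<Rightarrow> real) \<Rightarrow> (real^'n \<Rightarrow> real^'n^'n) \<Rightarrow>
     (real^'n \<Rightarrow> real) \<Rightarrow> (real^'n \<Rightarrow> real) \<Rightarrow> (real^'n \<Rightarrow> real^'n) \<Rightarrow> bool" where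
  "weak_solution E p v Q f u g \<longleftrightarrow> (u, g) \<in> H1_mean_zero E p v Q \<and>
     (\<forall>\<phi> \<in> C1_closure E. (\<phi>, gradient \<phi>) \<in> H1_mean_zero E p v Q \<longrightarrow>
        (\<integral>x. norm (mat_sqrt (Q x) *v g x) powr (real_of_ereal (p x) - 2)
               * (gradient \<phi> x \<bullet> (Q x *v g x)) \<partial>lebesgue_on E)
        = - (\<integral>x. \<bar>f x\<bar> powr (real_of_ereal (p x) - 2) * f x * \<phi> x
                  * v x powr real_of_ereal (p x) \<partial>lebesgue_on E))"

definition p_star ::
    "(real^'n) set \<Rightarrow> (real^'n \<Rightarrow> ereal) \<Rightarrow> (real^'n \<Rightarrow> real^'n^'n) \<Rightarrow> (real^'n \<Rightarrow> real^'n) \<Rightarrow> real" where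
  "p_star E p Q g = real_of_ereal (if LQ_norm E p Q g < 1 then p_plus E p else p_minus E p)"

definition r_star ::
    "(real^'n) set \<Rightarrow> (real^'n \<Rightarrow> ereal) \<Rightarrow> (real^'n \<Rightarrow> real) \<Rightarrow> (real^'n \<Rightarrow> real) \<Rightarrow> real" where
  "r_star E p v f = real_of_ereal (if 1 \<le> Lpv_norm E p v f then p_plus E p else p_minus E p)"

definition neumann_property ::
    "(real^'n) set \<Rightarrow> (real^'n \<Rightarrow> ereal) \<Rightarrow> (real^'n \<Rightarrow> real) \<Rightarrow> (real^'n \<Rightarrow> real^'n^'n) \<Rightarrow> bool" where
  "neumann_property E p v Q \<longleftrightarrow>
     (\<forall>f \<in> Lpv E p v. \<exists>u g. weak_solution E p v Q f u g) \<and>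
     (\<exists>C1::real. 0 < C1 \<and> (\<forall>f \<in> Lpv E p v. \<forall>u g. weak_solution E p v Q f u g \<longrightarrow>
        enn2real (Lpv_norm E p v u)
        \<le> C1 * enn2real (Lpv_norm E p v f) powr ((r_star E p v f - 1) / (p_star E p Q g - 1))))"

end

theory Submission
  imports Defs
begin

text \<open>Everything is phrased for the pairs \<open>(w v, sqrt Q \<nabla>w)\<close> with \<open>w\<close> continuously differentiable
  of mean zero, which form a linear space.

  Given the Poincare inequality, the functional
  \<open>\<integral> |sqrt Q \<nabla>w|^p / p + \<integral> |f v|^(p-2) f v (w v)\<close> is bounded below and coercive on this space. Uniform
  convexity makes every minimising sequence Cauchy, so weak compactness is not needed, and the limit
  satisfies the Euler-Lagrange equation, which is the weak form of the Neumann problem. Testing a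
  solution with itself gives the norm estimate. Conversely, if the Neumann property holds, normalise
  \<open>w\<close> to norm \<open>1\<close> and solve the problem with data \<open>w\<close>; testing with \<open>w\<close> itself and bounding the
  gradient of the solution through the Neumann estimate yields the Poincare inequality.

  The Hoelder inequality is only needed in the crude form \<open>s^(p-1) t \<le> s^p + t^p\<close>. A limit of the
  fields \<open>sqrt Q \<nabla>w_k\<close> is of the form \<open>sqrt Q g\<close> pointwise; a measurable \<open>g\<close> is produced by an
  iteration converging to the minimal-norm preimage.\<close>

subsection \<open>Luxemburg norms for bounded variable exponents\<close>

text \<open>The modular is not homogeneous: scaling a function by \<open>c\<close> changes it by a
  factor between \<open>c powr a\<close> and \<open>c powr b\<close>, so norm and modular are
  comparable only through two different exponents, switching at norm 1. This is the origin of
  \<open>p_star\<close> and \<open>r_star\<close>. It also explains the normalisation in the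
  converse direction: at norm 1 norm and modular agree, and the power of the data norm is 1 whatever
  its exponent.

  Multiplication by \<open>v\<close> and by the root of \<open>Q\<close> moves all degeneracy into
  the functions, so the analysis takes place in unweighted spaces over a finite measure. The price
  is paid when the minimiser \<open>(U, A)\<close> has to be written as \<open>u v\<close> and
  \<open>sqrt Q g\<close> with measurable \<open>u\<close> and \<open>g\<close>, although
  \<open>v\<close> may vanish and \<open>Q\<close> may be singular. Being of that form is preserved
  by pointwise limits, which is why the abstract existence theorem also returns almost everywhere
  convergence of its approximating sequence.\<close>

lemma powr_convex_nonneg:
  fixes s t p :: real
  assumes "0 \<le> s" "0 \<le> t" "0 \<le> l" "l \<le> 1" "1 \<le> p"
  shows "(l * s + (1 - l) * t) powr p \<le> l * s powr p + (1 - l) * t powr p"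
proof -
  have *: "l powr p \<le> l" if "0 \<le> l" "l \<le> 1" for l :: real
    using that assms(5) powr_mono'[of 1 p l] by (cases "l = 0") auto
  consider "s = 0" | "t = 0" | "0 < s" "0 < t" using assms by linarith
  then show ?thesis
  proof cases
    case 1
    then show ?thesis using *[of "1 - l"] assms by (simp add: powr_mult mult_right_mono)
  next
    case 2
    then show ?thesis using *[of l] assms by (simp add: powr_mult mult_right_mono)
  next
    case 3
    then show ?thesis
      using convex_onD[OF powr_convex[OF assms(5)], of "1 - l" s t] assms by simp
  qed
qed

text \<open>Young's inequality with the weights \<open>1 / p\<close> and \<open>1 - 1 / p\<close>
  kept sharp: integrated, it becomes the subgradient inequality of the energy, where a crude
  constant would not do.\<close>

lemma young_powr:
  fixes s t p :: real
  assumes "0 \<le> s" "0 \<le> t" "1 < p"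
  shows "s powr (p - 1) * t \<le> t powr p / p + (1 - 1 / p) * s powr p"
proof -
  have "t * s powr (p - 1) \<le> t powr p / p + (s powr (p - 1)) powr (p / (p - 1)) / (p / (p - 1))"
    using assms by (intro Youngs_inequality) (auto simp: field_simps)
  also have "(s powr (p - 1)) powr (p / (p - 1)) / (p / (p - 1)) = (1 - 1 / p) * s powr p"
  proof -
    have "(p - 1) * (p / (p - 1)) = p" using assms by simp
    then show ?thesis using assms by (simp only: powr_powr) (simp add: field_simps)
  qed
  finally show ?thesis by (simp add: mult.commute)
qed

text \<open>Replace both factors by \<open>max s t\<close>; the resulting power is one of the two
  terms on the right.\<close>

lemma powr_minus_one_mult_le:
  fixes s t p :: real
  assumes "0 \<le> s" "0 \<le> t" "1 \<le> p"
  shows "s powr (p - 1) * t \<le> s powr p + t powr p"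
proof -
  have eq: "max s t powr (p - 1) * max s t = max s t powr p"
    using assms powr_mult_base[of "max s t" "p - 1"] by (simp add: mult.commute)
  have "s powr (p - 1) * t \<le> max s t powr (p - 1) * max s t"
    using assms by (intro mult_mono powr_mono2) auto
  also have "\<dots> \<le> s powr p + t powr p" unfolding eq by (simp add: max_def)
  finally show ?thesis .
qed

text \<open>The exponent is real and bounded at every point, not just almost everywhere. The given
  \<open>p\<close> is later clipped to its essential range, so the estimates here need no
  exceptional sets for the exponent.\<close>

locale variable_exponent = finite_measure M for M :: "'a measure" +
  fixes q :: "'a \<Rightarrow> real" and a b :: real
  assumes q_measurable [measurable]: "q \<in> borel_measurable M"
    and a_gt_1: "1 < a" and a_le_b: "a \<le> b"
    and a_le_q: "\<And>x. x \<in> space M \<Longrightarrow> a \<le> q x"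
    and q_le_b: "\<And>x. x \<in> space M \<Longrightarrow> q x \<le> b"
begin

definition rho :: "('a \<Rightarrow> real) \<Rightarrow> ennreal" where
  "rho f = (\<integral>\<^sup>+ x. ennreal (\<bar>f x\<bar> powr q x) \<partial>M)"

definition luxnorm :: "('a \<Rightarrow> real) \<Rightarrow> ennreal" where
  "luxnorm f = (INF \<mu> \<in> {\<mu>::real. 0 < \<mu> \<and> rho (\<lambda>x. f x / \<mu>) \<le> 1}. ennreal \<mu>)"

lemma q_gt_1: "x \<in> space M \<Longrightarrow> 1 < q x"
  using a_le_q a_gt_1 by force

lemma rho_mono: "(\<And>x. x \<in> space M \<Longrightarrow> \<bar>f x\<bar> \<le> \<bar>g x\<bar>) \<Longrightarrow> rho f \<le> rho g"
  unfolding rho_def using q_gt_1 by (intro nn_integral_mono ennreal_leI powr_mono2) force+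

text \<open>This bound and the next one replace homogeneity. For \<open>c \<ge> 1\<close> the worst
  exponent is \<open>b\<close>, for \<open>c \<le> 1\<close> it is \<open>a\<close>.\<close>

lemma rho_scale_ge1:
  assumes [measurable]: "f \<in> borel_measurable M" and c: "1 \<le> c"
  shows "rho (\<lambda>x. c * f x) \<le> ennreal (c powr b) * rho f"
proof -
  have "rho (\<lambda>x. c * f x) \<le> (\<integral>\<^sup>+ x. ennreal (c powr b) * ennreal (\<bar>f x\<bar> powr q x) \<partial>M)"
    unfolding rho_def
  proof (intro nn_integral_mono)
    fix x assume "x \<in> space M"
    then have "c powr q x \<le> c powr b" using c q_le_b by (intro powr_mono) auto
    then show "ennreal (\<bar>c * f x\<bar> powr q x) \<le> ennreal (c powr b) * ennreal (\<bar>f x\<bar> powr q x)"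
      using c by (simp add: abs_mult powr_mult ennreal_mult'[symmetric] mult_right_mono)
  qed
  also have "\<dots> = ennreal (c powr b) * rho f"
    unfolding rho_def by (rule nn_integral_cmult) measurable
  finally show ?thesis .
qed

lemma rho_scale_le1:
  assumes [measurable]: "f \<in> borel_measurable M" and c: "0 < c" "c \<le> 1"
  shows "rho (\<lambda>x. c * f x) \<le> ennreal (c powr a) * rho f"
proof -
  have "rho (\<lambda>x. c * f x) \<le> (\<integral>\<^sup>+ x. ennreal (c powr a) * ennreal (\<bar>f x\<bar> powr q x) \<partial>M)"
    unfolding rho_def
  proof (intro nn_integral_mono)
    fix x assume "x \<in> space M"
    then have "c powr q x \<le> c powr a" using c a_le_q by (intro powr_mono') auto
    then show "ennreal (\<bar>c * f x\<bar> powr q x) \<le> ennreal (c powr a) * ennreal (\<bar>f x\<bar> powr q x)"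
      using c by (simp add: abs_mult powr_mult ennreal_mult'[symmetric] mult_right_mono)
  qed
  also have "\<dots> = ennreal (c powr a) * rho f"
    unfolding rho_def by (rule nn_integral_cmult) measurable
  finally show ?thesis .
qed

text \<open>The infimum is attained. Above \<open>\<mu>\<close> every \<open>c * \<mu>\<close> with
  \<open>c > 1\<close> exceeds some admissible value; scaling back costs at most
  \<open>c powr b\<close>, which tends to 1 as \<open>c\<close> decreases to 1.\<close>

lemma luxnorm_le_iff:
  assumes [measurable]: "f \<in> borel_measurable M" and \<mu>: "0 < \<mu>"
  shows "luxnorm f \<le> ennreal \<mu> \<longleftrightarrow> rho (\<lambda>x. f x / \<mu>) \<le> 1"
proof
  assume "rho (\<lambda>x. f x / \<mu>) \<le> 1"
  then show "luxnorm f \<le> ennreal \<mu>" unfolding luxnorm_def using \<mu> by (intro INF_lower) auto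
next
  assume n: "luxnorm f \<le> ennreal \<mu>"
  have *: "rho (\<lambda>x. f x / \<mu>) \<le> ennreal (c powr b)" if c: "1 < c" for c
  proof -
    have "luxnorm f < ennreal (c * \<mu>)"
      using n \<mu> c by (intro order.strict_trans1[OF n]) (auto simp: ennreal_less_iff)
    then obtain \<nu> where \<nu>: "0 < \<nu>" "rho (\<lambda>x. f x / \<nu>) \<le> 1" "\<nu> < c * \<mu>"
      unfolding luxnorm_def INF_less_iff by (auto simp: ennreal_less_iff)
    have "rho (\<lambda>x. f x / (c * \<mu>)) \<le> rho (\<lambda>x. f x / \<nu>)"
      using \<nu> by (intro rho_mono) (auto simp: abs_div intro!: divide_left_mono)
    then have 1: "rho (\<lambda>x. f x / (c * \<mu>)) \<le> 1" using \<nu> by simp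
    have "rho (\<lambda>x. f x / \<mu>) = rho (\<lambda>x. c * (f x / (c * \<mu>)))"
      using c by simp
    also have "\<dots> \<le> ennreal (c powr b) * rho (\<lambda>x. f x / (c * \<mu>))"
      using c by (intro rho_scale_ge1) auto
    also have "\<dots> \<le> ennreal (c powr b) * 1" using 1 by (intro mult_left_mono) auto
    finally show ?thesis by simp
  qed
  have "((\<lambda>c. ennreal (c powr b)) \<longlongrightarrow> ennreal (1 powr b)) (at_right 1)"
    by (intro tendsto_intros) auto
  moreover have "\<forall>\<^sub>F c in at_right 1. rho (\<lambda>x. f x / \<mu>) \<le> ennreal (c powr b)"
    by (intro eventually_at_rightI[of 1 2] *) auto
  ultimately have "rho (\<lambda>x. f x / \<mu>) \<le> ennreal (1 powr b)"
    by (rule tendsto_lowerbound) simp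
  then show "rho (\<lambda>x. f x / \<mu>) \<le> 1" by simp
qed

lemma luxnorm_mono:
  assumes "\<And>x. x \<in> space M \<Longrightarrow> \<bar>f x\<bar> \<le> \<bar>g x\<bar>"
  shows "luxnorm f \<le> luxnorm g"
proof -
  have "rho (\<lambda>x. f x / \<mu>) \<le> rho (\<lambda>x. g x / \<mu>)" for \<mu>
    using assms by (intro rho_mono) (simp add: divide_right_mono)
  then have "{\<mu>. 0 < \<mu> \<and> rho (\<lambda>x. g x / \<mu>) \<le> 1} \<subseteq> {\<mu>. 0 < \<mu> \<and> rho (\<lambda>x. f x / \<mu>) \<le> 1}"
    by (auto intro: order_trans)
  then show ?thesis unfolding luxnorm_def by (rule INF_superset_mono) simp
qed

text \<open>Both directions scale by \<open>max 1 r\<close>. Dividing by it brings a modular of size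
  \<open>r\<close> below 1 because \<open>a > 1\<close>; multiplying back costs the finite factor
  \<open>c powr b\<close>.\<close>

lemma rho_less_top_iff:
  assumes [measurable]: "f \<in> borel_measurable M"
  shows "rho f < \<infinity> \<longleftrightarrow> luxnorm f < \<infinity>"
proof
  assume "rho f < \<infinity>"
  then obtain r where r: "0 \<le> r" "rho f = ennreal r" by (cases "rho f") auto
  define c where "c = max 1 r"
  have c: "1 \<le> c" "r \<le> c" by (auto simp: c_def)
  have "rho (\<lambda>x. f x / c) = rho (\<lambda>x. (1/c) * f x)" by simp
  also have "\<dots> \<le> ennreal ((1/c) powr a) * rho f" using c by (intro rho_scale_le1) auto
  also have "\<dots> \<le> ennreal ((1/c) powr 1) * ennreal c"
    using c a_gt_1 r by (intro mult_mono ennreal_leI powr_mono') auto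
  also have "\<dots> = 1" using c by (simp add: ennreal_mult'[symmetric])
  finally have "luxnorm f \<le> ennreal c" using c by (subst luxnorm_le_iff) auto
  then show "luxnorm f < \<infinity>" by (rule order.strict_trans1) auto
next
  assume "luxnorm f < \<infinity>"
  then obtain r where r: "0 \<le> r" "luxnorm f = ennreal r" by (cases "luxnorm f") auto
  define c where "c = max 1 r"
  have c: "1 \<le> c" "r \<le> c" by (auto simp: c_def)
  have "luxnorm f \<le> ennreal c" using r c by (auto intro: ennreal_leI)
  then have 1: "rho (\<lambda>x. f x / c) \<le> 1" using c by (subst (asm) luxnorm_le_iff) auto
  have "rho f = rho (\<lambda>x. c * (f x / c))" using c by simp
  also have "\<dots> \<le> ennreal (c powr b) * rho (\<lambda>x. f x / c)" using c by (intro rho_scale_ge1) auto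
  also have "\<dots> \<le> ennreal (c powr b) * 1" using 1 by (intro mult_left_mono) auto
  also have "\<dots> < \<infinity>" by simp
  finally show "rho f < \<infinity>" .
qed

definition Lq :: "('a \<Rightarrow> real) set" where
  "Lq = {f \<in> borel_measurable M. rho f < \<infinity>}"

lemma Lq_measurable: "f \<in> Lq \<Longrightarrow> f \<in> borel_measurable M"
  by (simp add: Lq_def)

lemma Lq_iff_luxnorm: "f \<in> Lq \<longleftrightarrow> f \<in> borel_measurable M \<and> luxnorm f < \<infinity>"
  using rho_less_top_iff by (auto simp: Lq_def)

text \<open>Infinite norms are sent to 0 by \<open>enn2real\<close>, and divergent integrals are 0
  by the Bochner convention; hence the recurring hypothesis \<open>f \<in> Lq\<close>.\<close>

definition rnorm :: "('a \<Rightarrow> real) \<Rightarrow> real" where "rnorm f = enn2real (luxnorm f)"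
definition rmod :: "('a \<Rightarrow> real) \<Rightarrow> real" where "rmod f = (\<integral>x. \<bar>f x\<bar> powr q x \<partial>M)"

lemma rnorm_nonneg [simp]: "0 \<le> rnorm f" by (simp add: rnorm_def)
lemma rmod_nonneg [simp]: "0 \<le> rmod f" by (simp add: rmod_def)

lemma luxnorm_eq_rnorm: "f \<in> Lq \<Longrightarrow> luxnorm f = ennreal (rnorm f)"
  by (simp add: Lq_iff_luxnorm rnorm_def)

lemma Lq_integrable: "f \<in> Lq \<Longrightarrow> integrable M (\<lambda>x. \<bar>f x\<bar> powr q x)"
  by (intro integrableI_nonneg) (auto simp: Lq_def rho_def)

lemma LqI_integrable:
  assumes "f \<in> borel_measurable M" "integrable M (\<lambda>x. \<bar>f x\<bar> powr q x)"
  shows "f \<in> Lq"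
  using nn_integral_eq_integral[OF assms(2)] assms(1) by (simp add: Lq_def rho_def)

lemma rho_eq_rmod: "f \<in> Lq \<Longrightarrow> rho f = ennreal (rmod f)"
  unfolding rho_def rmod_def by (intro nn_integral_eq_integral Lq_integrable) auto

lemma Lq_mono:
  assumes "g \<in> Lq" "f \<in> borel_measurable M" "\<And>x. x \<in> space M \<Longrightarrow> \<bar>f x\<bar> \<le> \<bar>g x\<bar>"
  shows "f \<in> Lq"
  using assms rho_mono[of f g] by (auto simp: Lq_def)

lemma Lq_cmult: "f \<in> Lq \<Longrightarrow> (\<lambda>x. c * f x) \<in> Lq"
proof -
  assume f: "f \<in> Lq"
  note [measurable] = Lq_measurable[OF f]
  have "rho (\<lambda>x. c * f x) \<le> rho (\<lambda>x. max 1 \<bar>c\<bar> * f x)"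
    by (intro rho_mono) (auto simp: abs_mult intro!: mult_right_mono)
  also have "\<dots> \<le> ennreal (max 1 \<bar>c\<bar> powr b) * rho f" by (intro rho_scale_ge1) auto
  also have "\<dots> < \<infinity>" using f by (auto simp: Lq_def ennreal_mult_less_top)
  finally show ?thesis by (simp add: Lq_def)
qed

lemma rnorm_le_iff:
  assumes "f \<in> Lq" "0 < \<mu>"
  shows "rnorm f \<le> \<mu> \<longleftrightarrow> rmod (\<lambda>x. f x / \<mu>) \<le> 1"
proof -
  have "(\<lambda>x. (1 / \<mu>) * f x) \<in> Lq" using assms by (intro Lq_cmult)
  then have "rho (\<lambda>x. f x / \<mu>) = ennreal (rmod (\<lambda>x. f x / \<mu>))" using rho_eq_rmod by simp
  then show ?thesis using luxnorm_le_iff[OF Lq_measurable[OF assms(1)] assms(2)] luxnorm_eq_rnorm[OF assms(1)] assms(2)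
    by simp
qed

lemma rnorm_mono:
  assumes "g \<in> Lq" "\<And>x. x \<in> space M \<Longrightarrow> \<bar>f x\<bar> \<le> \<bar>g x\<bar>"
  shows "rnorm f \<le> rnorm g"
proof -
  have "luxnorm f \<le> luxnorm g" using assms(2) by (rule luxnorm_mono)
  moreover have "luxnorm g < top" using assms(1) by (simp add: Lq_iff_luxnorm)
  ultimately show ?thesis unfolding rnorm_def by (rule enn2real_mono)
qed

lemma rnorm_cong: "(\<And>x. x \<in> space M \<Longrightarrow> \<bar>f x\<bar> = \<bar>g x\<bar>) \<Longrightarrow> rnorm f = rnorm g"
  unfolding rnorm_def by (intro arg_cong[of _ _ enn2real] antisym luxnorm_mono) auto

lemma rmod_scale_ge1:
  assumes "f \<in> Lq" "1 \<le> c"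
  shows "rmod (\<lambda>x. c * f x) \<le> c powr b * rmod f"
  using rho_scale_ge1[OF Lq_measurable[OF assms(1)] assms(2)]
  unfolding rho_eq_rmod[OF assms(1)] rho_eq_rmod[OF Lq_cmult[OF assms(1)]]
  by (simp add: ennreal_mult'[symmetric])

lemma rmod_scale_le1:
  assumes "f \<in> Lq" "0 < c" "c \<le> 1"
  shows "rmod (\<lambda>x. c * f x) \<le> c powr a * rmod f"
  using rho_scale_le1[OF Lq_measurable[OF assms(1)] assms(2,3)]
  unfolding rho_eq_rmod[OF assms(1)] rho_eq_rmod[OF Lq_cmult[OF assms(1)]]
  by (simp add: ennreal_mult'[symmetric])

text \<open>The norm of \<open>f\<close> may be 0, while \<open>rnorm_le_iff\<close> requires a
  positive bound, so an \<open>e\<close> is added and removed at the end. Equality follows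
  afterwards by applying this to the inverse factor.\<close>

lemma rnorm_mult_le: "f \<in> Lq \<Longrightarrow> 0 < c \<Longrightarrow> rnorm (\<lambda>x. c * f x) \<le> c * rnorm f"
proof (rule field_le_epsilon)
  fix e :: real assume f: "f \<in> Lq" and c: "0 < c" and e: "0 < e"
  have "rmod (\<lambda>x. f x / (rnorm f + e / c)) \<le> 1"
    using rnorm_le_iff[OF f, of "rnorm f + e / c"] c e by (simp add: add_nonneg_pos)
  moreover have "c * f x / (c * rnorm f + e) = f x / (rnorm f + e / c)" for x
    using c by (simp add: field_simps)
  ultimately show "rnorm (\<lambda>x. c * f x) \<le> c * rnorm f + e"
    using c e by (subst rnorm_le_iff[OF Lq_cmult[OF f]]) (auto simp: add_nonneg_pos)
qed

lemma rnorm_cmult: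
  assumes "f \<in> Lq"
  shows "rnorm (\<lambda>x. c * f x) = \<bar>c\<bar> * rnorm f"
proof (cases "c = 0")
  case True
  have "rnorm (\<lambda>x. 0) \<le> e" if "0 < e" for e
    using rnorm_le_iff[OF Lq_cmult[OF assms, of 0], of e] that by (simp add: rmod_def)
  then have "rnorm (\<lambda>x. 0) \<le> 0" using field_le_epsilon[of "rnorm (\<lambda>x. 0)" 0] by simp
  then have "rnorm (\<lambda>x. 0) = 0" using rnorm_nonneg antisym by blast
  then show ?thesis using True by simp
next
  case False
  have 1: "rnorm (\<lambda>x. c * f x) = rnorm (\<lambda>x. \<bar>c\<bar> * f x)" by (intro rnorm_cong) (simp add: abs_mult)
  have 2: "rnorm (\<lambda>x. \<bar>c\<bar> * f x) \<le> \<bar>c\<bar> * rnorm f" using False assms by (intro rnorm_mult_le) auto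
  have "rnorm (\<lambda>x. (1 / \<bar>c\<bar>) * (\<bar>c\<bar> * f x)) \<le> (1 / \<bar>c\<bar>) * rnorm (\<lambda>x. \<bar>c\<bar> * f x)"
    by (rule rnorm_mult_le[OF Lq_cmult[OF assms]]) (use False in simp)
  moreover have "(\<lambda>x. (1 / \<bar>c\<bar>) * (\<bar>c\<bar> * f x)) = f" using False by simp
  ultimately have "\<bar>c\<bar> * rnorm f \<le> \<bar>c\<bar> * ((1 / \<bar>c\<bar>) * rnorm (\<lambda>x. \<bar>c\<bar> * f x))"
    by (intro mult_left_mono) simp_all
  then show ?thesis using 1 2 False by simp
qed

text \<open>The quotient on the left is the convex combination of \<open>s / \<mu>\<close> and
  \<open>t / \<nu>\<close> with weights proportional to \<open>\<mu>\<close> and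
  \<open>\<nu>\<close>. This is the pointwise form of the triangle inequality for a gauge.\<close>

lemma powr_add_div_le:
  fixes s t \<mu> \<nu> p :: real
  assumes "0 < \<mu>" "0 < \<nu>" "1 \<le> p"
  shows "\<bar>(s + t) / (\<mu> + \<nu>)\<bar> powr p \<le> (\<mu> / (\<mu> + \<nu>)) * \<bar>s / \<mu>\<bar> powr p + (\<nu> / (\<mu> + \<nu>)) * \<bar>t / \<nu>\<bar> powr p"
proof -
  let ?l = "\<mu> / (\<mu> + \<nu>)"
  have l: "1 - ?l = \<nu> / (\<mu> + \<nu>)" "0 \<le> ?l" "?l \<le> 1" using assms by (auto simp: field_simps)
  have "?l * \<bar>s / \<mu>\<bar> + (1 - ?l) * \<bar>t / \<nu>\<bar> = (\<bar>s\<bar> + \<bar>t\<bar>) / (\<mu> + \<nu>)"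
    using assms unfolding l by (simp add: abs_div add_divide_distrib)
  then have "\<bar>(s + t) / (\<mu> + \<nu>)\<bar> \<le> ?l * \<bar>s / \<mu>\<bar> + (1 - ?l) * \<bar>t / \<nu>\<bar>"
    using assms by (simp add: abs_div divide_right_mono)
  then have "\<bar>(s + t) / (\<mu> + \<nu>)\<bar> powr p \<le> (?l * \<bar>s / \<mu>\<bar> + (1 - ?l) * \<bar>t / \<nu>\<bar>) powr p"
    using assms by (intro powr_mono2) auto
  also have "\<dots> \<le> ?l * \<bar>s / \<mu>\<bar> powr p + (1 - ?l) * \<bar>t / \<nu>\<bar> powr p"
    using assms l by (intro powr_convex_nonneg) auto
  finally show ?thesis unfolding l .
qed

lemma Lq_divide: "f \<in> Lq \<Longrightarrow> (\<lambda>x. f x / c) \<in> Lq"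
  using Lq_cmult[of f "1 / c"] by simp

lemma Lq_add:
  assumes "f \<in> Lq" "g \<in> Lq"
  shows "(\<lambda>x. f x + g x) \<in> Lq"
proof -
  note [measurable] = Lq_measurable[OF assms(1)] Lq_measurable[OF assms(2)]
  have i: "integrable M (\<lambda>x. (1/2) * \<bar>f x / 1\<bar> powr q x + (1/2) * \<bar>g x / 1\<bar> powr q x)"
    using assms by (auto intro!: Bochner_Integration.integrable_add integrable_mult_right Lq_integrable)
  have "(\<lambda>x. (f x + g x) / 2) \<in> Lq"
  proof (intro LqI_integrable Bochner_Integration.integrable_bound[OF i])
    show "AE x in M. norm (\<bar>(f x + g x) / 2\<bar> powr q x)
        \<le> norm ((1/2) * \<bar>f x / 1\<bar> powr q x + (1/2) * \<bar>g x / 1\<bar> powr q x)"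
    proof (intro AE_I2)
      fix x assume "x \<in> space M"
      then show "norm (\<bar>(f x + g x) / 2\<bar> powr q x)
        \<le> norm ((1/2) * \<bar>f x / 1\<bar> powr q x + (1/2) * \<bar>g x / 1\<bar> powr q x)"
        using powr_add_div_le[of 1 1 "q x" "f x" "g x"] q_gt_1[of x] by simp
    qed
  qed measurable
  from Lq_cmult[OF this, of 2] show ?thesis by (simp only: times_divide_eq_right nonzero_mult_div_cancel_left)
qed

lemma rnorm_triangle:
  assumes "f \<in> Lq" "g \<in> Lq"
  shows "rnorm (\<lambda>x. f x + g x) \<le> rnorm f + rnorm g"
proof (rule field_le_epsilon)
  fix e :: real assume e: "0 < e"
  define \<mu> \<nu> where "\<mu> = rnorm f + e / 2" and "\<nu> = rnorm g + e / 2"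
  have p: "0 < \<mu>" "0 < \<nu>" using e by (auto simp: \<mu>_def \<nu>_def add_nonneg_pos)
  have 1: "rmod (\<lambda>x. f x / \<mu>) \<le> 1" "rmod (\<lambda>x. g x / \<nu>) \<le> 1"
    using rnorm_le_iff[OF assms(1) p(1)] rnorm_le_iff[OF assms(2) p(2)] e by (auto simp: \<mu>_def \<nu>_def)
  have i: "integrable M (\<lambda>x. \<bar>f x / \<mu>\<bar> powr q x)" "integrable M (\<lambda>x. \<bar>g x / \<nu>\<bar> powr q x)"
    using assms by (intro Lq_integrable Lq_divide; simp)+
  have "rmod (\<lambda>x. (f x + g x) / (\<mu> + \<nu>))
      \<le> (\<integral>x. (\<mu> / (\<mu> + \<nu>)) * \<bar>f x / \<mu>\<bar> powr q x + (\<nu> / (\<mu> + \<nu>)) * \<bar>g x / \<nu>\<bar> powr q x \<partial>M)"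
    unfolding rmod_def
  proof (intro integral_mono)
    show "integrable M (\<lambda>x. \<bar>(f x + g x) / (\<mu> + \<nu>)\<bar> powr q x)"
      using assms by (intro Lq_integrable Lq_divide Lq_add)
    show "integrable M (\<lambda>x. (\<mu> / (\<mu> + \<nu>)) * \<bar>f x / \<mu>\<bar> powr q x + (\<nu> / (\<mu> + \<nu>)) * \<bar>g x / \<nu>\<bar> powr q x)"
      using i by (intro Bochner_Integration.integrable_add integrable_mult_right)
  qed (use p q_gt_1 in \<open>intro powr_add_div_le; force\<close>)
  also have "\<dots> = (\<mu> / (\<mu> + \<nu>)) * rmod (\<lambda>x. f x / \<mu>) + (\<nu> / (\<mu> + \<nu>)) * rmod (\<lambda>x. g x / \<nu>)"
    unfolding rmod_def using i by (simp add: Bochner_Integration.integral_add del: abs_divide)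
  also have "\<dots> \<le> (\<mu> / (\<mu> + \<nu>)) * 1 + (\<nu> / (\<mu> + \<nu>)) * 1"
    using 1 p by (intro add_mono mult_left_mono) auto
  also have "\<dots> = 1" using p by (simp add: add_divide_distrib[symmetric])
  finally have "rnorm (\<lambda>x. f x + g x) \<le> \<mu> + \<nu>"
    using p assms by (subst rnorm_le_iff) (auto intro!: Lq_add)
  then show "rnorm (\<lambda>x. f x + g x) \<le> rnorm f + rnorm g + e" by (simp add: \<mu>_def \<nu>_def)
qed

end

subsection \<open>Uniform convexity of powers of the norm\<close>

text \<open>Writing \<open>w = exp L\<close>, use \<open>1 + y < exp y\<close> twice, at
  \<open>y = - L\<close> and at \<open>y = (s - 1) * L\<close>, and multiply by
  \<open>exp L\<close>. Both uses are strict because \<open>w \<noteq> 1\<close> means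
  \<open>L \<noteq> 0\<close>.\<close>

lemma bernoulli_powr_strict:
  fixes w s :: real
  assumes "0 \<le> w" "w \<noteq> 1" "1 < s"
  shows "1 + s * (w - 1) < w powr s"
proof (cases "w = 0")
  case True
  then show ?thesis using assms by simp
next
  case False
  define L where "L = ln w"
  have w: "w = exp L" and L: "L \<noteq> 0" using assms False by (auto simp: L_def)
  have exp_strict: "1 + y < exp y" if "y \<noteq> 0" for y :: real
  proof -
    have "exp y \<noteq> 1 + y"
    proof
      assume "exp y = 1 + y"
      then have "ln (exp y) = exp y - 1" unfolding ln_exp by simp
      then have "exp y = 1" by (intro ln_eq_minus_one) simp_all
      then show False using that by simp
    qed
    then show ?thesis using exp_ge_add_one_self[of y] by linarith
  qed
  have "(s - 1) * (1 + (- L)) < (s - 1) * exp (- L)"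
    using exp_strict[of "- L"] L assms by (intro mult_strict_left_mono) auto
  then have "s - (s - 1) * exp (- L) < 1 + (s - 1) * L" by (simp add: algebra_simps)
  also have "\<dots> < exp ((s - 1) * L)" using L assms by (intro exp_strict) auto
  finally have "exp L * (s - (s - 1) * exp (- L)) < exp L * exp ((s - 1) * L)"
    by (intro mult_strict_left_mono) auto
  moreover have "exp L * (s - (s - 1) * exp (- L)) = 1 + s * (w - 1)"
    unfolding w by (simp add: algebra_simps exp_minus)
  moreover have "exp L * exp ((s - 1) * L) = w powr s"
    unfolding w by (simp add: powr_def mult_exp_exp algebra_simps)
  ultimately show ?thesis by simp
qed

text \<open>Compare with the tangent at the midpoint \<open>z\<close>: add the Bernoulli bounds for
  \<open>t / z\<close> and \<open>u / z\<close>; the linear terms cancel because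
  \<open>t + u = 2 * z\<close>.\<close>

lemma powr_midpoint_strict:
  fixes t u s :: real
  assumes "0 \<le> t" "0 \<le> u" "t \<noteq> u" "1 < s"
  shows "((t + u) / 2) powr s < (t powr s + u powr s) / 2"
proof -
  define z where "z = (t + u) / 2"
  have z: "0 < z" using assms by (auto simp: z_def)
  have "1 + s * (t / z - 1) < (t / z) powr s" "1 + s * (u / z - 1) < (u / z) powr s"
    using z assms by (auto intro!: bernoulli_powr_strict simp: z_def)
  then have "2 + s * ((t + u) / z - 2) < (t / z) powr s + (u / z) powr s"
    by (simp add: algebra_simps add_divide_distrib)
  moreover have "(t + u) / z = 2"
  proof -
    have "t + u = 2 * z" by (simp add: z_def)
    then show ?thesis using z by simp
  qed
  ultimately have "2 < (t powr s + u powr s) / z powr s"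
    using assms z by (simp add: powr_divide add_divide_distrib)
  then show ?thesis using z by (simp add: z_def[symmetric] field_simps)
qed

text \<open>Strictness has two sources. For equal norms the parallelogram identity makes the
  midpoint strictly shorter; for different norms the scalar power is strictly convex.\<close>

lemma norm_powr_midpoint_strict:
  fixes x y :: "'c::real_inner"
  assumes "x \<noteq> y" "1 < s"
  shows "norm ((1/2) *\<^sub>R (x + y)) powr s < (norm x powr s + norm y powr s) / 2"
proof (cases "norm x = norm y")
  case True
  have "(norm ((1/2) *\<^sub>R (x + y)))\<^sup>2 = (norm x)\<^sup>2 - (norm (x - y))\<^sup>2 / 4"
    using True unfolding power2_norm_eq_inner norm_eq
    by (simp add: inner_add_left inner_add_right inner_diff_left inner_diff_right inner_commute field_simps)
  also have "\<dots> < (norm x)\<^sup>2" using assms by simp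
  finally have "norm ((1/2) *\<^sub>R (x + y)) < norm x" by (rule power_less_imp_less_base) simp
  then have "norm ((1/2) *\<^sub>R (x + y)) powr s < norm x powr s"
    using assms by (intro powr_less_mono2) auto
  then show ?thesis using True by simp
next
  case False
  have "norm ((1/2) *\<^sub>R (x + y)) powr s \<le> ((norm x + norm y) / 2) powr s"
    using norm_triangle_ineq[of x y] assms by (intro powr_mono2) auto
  also have "\<dots> < (norm x powr s + norm y powr s) / 2"
    using False assms by (intro powr_midpoint_strict) auto
  finally show ?thesis .
qed

lemma norm_powr_midpoint:
  fixes x y :: "'c::real_inner"
  assumes "1 < s"
  shows "norm ((1/2) *\<^sub>R (x + y)) powr s \<le> (norm x powr s + norm y powr s) / 2"
proof (cases "x = y")
  case True
  then have "(1/2) *\<^sub>R (x + y) = x" by (simp add: scaleR_2[symmetric])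
  then show ?thesis using True by simp
qed (use norm_powr_midpoint_strict[of x y s] assms in auto)

text \<open>By homogeneity it suffices to bound the convexity defect from below on a compact set of
  triples \<open>(s, x, y)\<close>, where it is positive by strict convexity.\<close>

lemma uniform_convexity_powr:
  fixes a b \<eta> :: real
  assumes "1 < a" "0 < \<eta>"
  shows "\<exists>K>0. \<forall>s\<in>{a..b}. \<forall>x y :: 'c::euclidean_space.
    norm (x - y) powr s \<le> \<eta> * (norm x powr s + norm y powr s)
      + K * ((norm x powr s + norm y powr s) / 2 - norm ((1/2) *\<^sub>R (x + y)) powr s)"
proof -
  define D :: "real \<times> 'c \<times> 'c \<Rightarrow> real" where
    "D = (\<lambda>(s, x, y). (norm x powr s + norm y powr s) / 2 - norm ((1/2) *\<^sub>R (x + y)) powr s)"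
  \<comment> \<open>Since \<open>e \<le> 1\<close> and \<open>s > 1\<close>, one has
    \<open>e powr s \<le> e \<le> \<eta>\<close>. Pairs closer than \<open>e\<close> times their
    size are thus absorbed by the first term, and compactness is needed only for separated
    pairs.\<close>
  define e where "e = min 1 \<eta>"
  have e: "0 < e" "e \<le> 1" "e \<le> \<eta>" using assms by (auto simp: e_def)
  define S where "S = {z \<in> {a..b} \<times> cball 0 1 \<times> (cball 0 1 :: 'c set).
    max (norm (fst (snd z))) (norm (snd (snd z))) = 1 \<and> e \<le> norm (fst (snd z) - snd (snd z))}"
  have "closed {z :: real \<times> 'c \<times> 'c. max (norm (fst (snd z))) (norm (snd (snd z))) = 1 \<and> e \<le> norm (fst (snd z) - snd (snd z))}"
    by (intro closed_Collect_conj closed_Collect_eq closed_Collect_le continuous_intros)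
  then have "compact S"
    unfolding S_def Collect_conj_eq Collect_mem_eq by (intro compact_Int_closed compact_Times) auto
  moreover have "continuous_on S D"
    unfolding D_def case_prod_unfold S_def using assms
    by (intro continuous_intros continuous_on_powr') auto
  ultimately obtain d where d: "0 < d" "\<And>z. z \<in> S \<Longrightarrow> d \<le> D z"
  proof (cases "S = {}")
    case False
    assume "compact S" "continuous_on S D"
    then obtain z where z: "z \<in> S" "\<And>w. w \<in> S \<Longrightarrow> D z \<le> D w"
      using continuous_attains_inf[OF _ False, of D] by blast
    have "0 < D z"
      using z(1) e assms norm_powr_midpoint_strict[of "fst (snd z)" "snd (snd z)" "fst z"]
      by (cases "fst (snd z) = snd (snd z)") (auto simp: S_def D_def case_prod_unfold)
    then show ?thesis using z that[of "D z"] by blast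
  qed (use that[of 1] in auto)
  \<comment> \<open>With \<open>m\<close> the larger of the two norms, a separated pair has defect
    at least \<open>d * m powr s\<close>, whereas \<open>norm (x - y) \<le> 2 * m\<close>; this
    yields the constant \<open>2 powr b / d\<close>.\<close>
  have "norm (x - y) powr s \<le> \<eta> * (norm x powr s + norm y powr s) + (2 powr b / d) * D (s, x, y)"
    if s: "s \<in> {a..b}" for s and x y :: 'c
  proof -
    define m where "m = max (norm x) (norm y)"
    have D0: "0 \<le> D (s, x, y)" using norm_powr_midpoint[of s x y] s assms by (simp add: D_def)
    have m: "norm x \<le> m" "norm y \<le> m" "0 \<le> m" "m powr s \<le> norm x powr s + norm y powr s"
      by (auto simp: m_def max_def)
    consider "m = 0" | "0 < m" "norm (x - y) \<le> e * m" | "0 < m" "e * m < norm (x - y)"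
      using m by linarith
    then show ?thesis
    proof cases
      case 1
      then have "x = 0" "y = 0" using m by auto
      then show ?thesis by (simp add: D_def)
    next
      case 2
      have "norm (x - y) powr s \<le> (e * m) powr s" using 2 s assms by (intro powr_mono2) auto
      also have "\<dots> = e powr s * m powr s" using e m by (simp add: powr_mult)
      also have "e powr s \<le> e powr 1" using e s assms by (intro powr_mono') auto
      also have "e powr 1 \<le> \<eta>" using e by simp
      also have "\<eta> * m powr s \<le> \<eta> * (norm x powr s + norm y powr s)"
        using m assms by (intro mult_left_mono) auto
      finally show ?thesis using D0 d by (simp add: mult_right_mono add_increasing2)
    next
      case 3
      have inS: "(s, (1/m) *\<^sub>R x, (1/m) *\<^sub>R y) \<in> S"
      proof -
        have "max (norm x / m) (norm y / m) = 1" using 3(1) by (auto simp: m_def max_def)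
        moreover have "norm ((1/m) *\<^sub>R x - (1/m) *\<^sub>R y) = norm (x - y) / m"
          using 3(1) by (simp add: scaleR_diff_right[symmetric])
        moreover have "e \<le> norm (x - y) / m" using 3 by (simp add: field_simps)
        moreover have "norm x / m \<le> 1" "norm y / m \<le> 1" using m 3 by (auto simp: field_simps)
        ultimately show ?thesis using 3(1) s by (simp add: S_def)
      qed
      have "D (s, (1/m) *\<^sub>R x, (1/m) *\<^sub>R y) = D (s, x, y) / m powr s"
      proof -
        have "(1/2) *\<^sub>R ((1/m) *\<^sub>R x + (1/m) *\<^sub>R y) = (1/m) *\<^sub>R ((1/2) *\<^sub>R (x + y))"
          by (simp add: scaleR_add_right mult.commute)
        then have n: "norm ((1/2) *\<^sub>R ((1/m) *\<^sub>R x + (1/m) *\<^sub>R y)) = norm ((1/2) *\<^sub>R (x + y)) / m"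
          using 3(1) by (simp only: norm_scaleR) simp
        have "norm ((1/m) *\<^sub>R x) = norm x / m" "norm ((1/m) *\<^sub>R y) = norm y / m"
          using 3(1) by simp_all
        then show ?thesis
          unfolding D_def prod.case n using 3(1)
          by (simp only: powr_divide norm_ge_zero diff_divide_distrib add_divide_distrib) (simp add: mult.commute)
      qed
      then have "d \<le> D (s, x, y) / m powr s" using d(2)[OF inS] by simp
      then have dm: "d * m powr s \<le> D (s, x, y)" using 3 by (simp add: pos_le_divide_eq)
      have "norm (x - y) powr s \<le> (2 * m) powr s"
        using norm_triangle_ineq4[of x y] m s assms by (intro powr_mono2) auto
      also have "\<dots> = 2 powr s * m powr s" using m by (simp add: powr_mult)
      also have "\<dots> \<le> 2 powr b * m powr s" using s by (intro mult_right_mono powr_mono) auto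
      also have "\<dots> \<le> 2 powr b * (D (s, x, y) / d)"
        using dm d by (intro mult_left_mono) (auto simp: field_simps)
      also have "\<dots> \<le> \<eta> * (norm x powr s + norm y powr s) + (2 powr b / d) * D (s, x, y)"
        using assms by simp
      finally show ?thesis .
    qed
  qed
  then show ?thesis using d by (intro exI[of _ "2 powr b / d"]) (auto simp: D_def)
qed

section \<open>Hoelder-type bound and comparison of norm and modular\<close>

context variable_exponent
begin

lemma Lq_uminus: "f \<in> Lq \<Longrightarrow> (\<lambda>x. - f x) \<in> Lq"
  using Lq_cmult[of f "- 1"] by simp

lemma Lq_diff: "f \<in> Lq \<Longrightarrow> g \<in> Lq \<Longrightarrow> (\<lambda>x. f x - g x) \<in> Lq"
  using Lq_add[of f "\<lambda>x. - g x"] Lq_uminus[of g] by simp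

text \<open>Apply the crude Young bound to \<open>A\<close> and \<open>d / \<mu>\<close>, the latter
  having modular at most 1. A positive upper bound \<open>\<mu>\<close> stands for the norm of
  \<open>d\<close>, which may vanish. The modular of \<open>A\<close> enters the constant, so no
  space with the conjugate exponent appears.\<close>

lemma holder:
  assumes A: "A \<in> Lq" and d: "d \<in> Lq" and \<mu>: "rnorm d \<le> \<mu>" "0 < \<mu>"
  shows "integrable M (\<lambda>x. \<bar>A x\<bar> powr (q x - 1) * \<bar>d x\<bar>)"
    and "(\<integral>x. \<bar>A x\<bar> powr (q x - 1) * \<bar>d x\<bar> \<partial>M) \<le> \<mu> * (rmod A + 1)"
proof -
  note [measurable] = Lq_measurable[OF A] Lq_measurable[OF d]
  let ?g = "\<lambda>x. \<mu> * (\<bar>A x\<bar> powr q x + \<bar>d x / \<mu>\<bar> powr q x)"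
  have i: "integrable M (\<lambda>x. \<bar>A x\<bar> powr q x)" "integrable M (\<lambda>x. \<bar>d x / \<mu>\<bar> powr q x)"
    using A d by (intro Lq_integrable Lq_divide; simp)+
  then have ig: "integrable M ?g"
    by (intro integrable_mult_right Bochner_Integration.integrable_add)
  have le: "\<bar>A x\<bar> powr (q x - 1) * \<bar>d x\<bar> \<le> ?g x" if "x \<in> space M" for x
  proof -
    have "\<bar>A x\<bar> powr (q x - 1) * \<bar>d x / \<mu>\<bar> \<le> \<bar>A x\<bar> powr q x + \<bar>d x / \<mu>\<bar> powr q x"
      using q_gt_1[OF that] by (intro powr_minus_one_mult_le) auto
    then have "\<mu> * (\<bar>A x\<bar> powr (q x - 1) * \<bar>d x / \<mu>\<bar>) \<le> ?g x"
      using \<mu> by (intro mult_left_mono) auto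
    then show ?thesis using \<mu> by simp
  qed
  show I: "integrable M (\<lambda>x. \<bar>A x\<bar> powr (q x - 1) * \<bar>d x\<bar>)"
  proof (rule Bochner_Integration.integrable_bound[OF ig])
    show "AE x in M. norm (\<bar>A x\<bar> powr (q x - 1) * \<bar>d x\<bar>) \<le> norm (?g x)"
    proof (intro AE_I2)
      fix x assume "x \<in> space M"
      moreover have "0 \<le> \<bar>A x\<bar> powr (q x - 1) * \<bar>d x\<bar>" by simp
      ultimately show "norm (\<bar>A x\<bar> powr (q x - 1) * \<bar>d x\<bar>) \<le> norm (?g x)"
        using le[of x] unfolding real_norm_def by linarith
    qed
  qed measurable
  have "(\<integral>x. \<bar>A x\<bar> powr (q x - 1) * \<bar>d x\<bar> \<partial>M) \<le> (\<integral>x. ?g x \<partial>M)"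
    using I ig le by (intro integral_mono)
  also have "\<dots> = \<mu> * (rmod A + rmod (\<lambda>x. d x / \<mu>))"
    using i unfolding rmod_def by (simp only: integral_mult_right_zero Bochner_Integration.integral_add)
  also have "\<dots> \<le> \<mu> * (rmod A + 1)"
    using rnorm_le_iff[OF d \<mu>(2)] \<mu> by (intro mult_left_mono add_left_mono) auto
  finally show "(\<integral>x. \<bar>A x\<bar> powr (q x - 1) * \<bar>d x\<bar> \<partial>M) \<le> \<mu> * (rmod A + 1)" .
qed

lemma rmod_le_powr:
  assumes "f \<in> Lq" "rnorm f \<le> c" "1 \<le> c"
  shows "rmod f \<le> c powr b"
proof -
  have "rmod f = rmod (\<lambda>x. c * (f x / c))" using assms by simp
  also have "\<dots> \<le> c powr b * rmod (\<lambda>x. f x / c)" using assms by (intro rmod_scale_ge1 Lq_divide)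
  also have "\<dots> \<le> c powr b * 1" using rnorm_le_iff[of f c] assms by (intro mult_left_mono) auto
  finally show ?thesis by simp
qed

text \<open>Dividing by \<open>rmod f powr (1 / a)\<close>, a number at least 1, costs at most its
  power \<open>- a\<close>, which brings the modular down to 1. The companion for small modulars
  uses \<open>1 / b\<close> in the same way.\<close>

lemma rnorm_le_rmod_ge1:
  assumes f: "f \<in> Lq" and 1: "1 \<le> rmod f"
  shows "rnorm f \<le> rmod f powr (1 / a)"
proof -
  let ?G = "rmod f powr (1 / a)"
  have G: "1 \<le> ?G" using 1 a_gt_1 by (intro ge_one_powr_ge_zero) auto
  have "rmod (\<lambda>x. (1 / ?G) * f x) \<le> (1 / ?G) powr a * rmod f"
    using G by (intro rmod_scale_le1 f) (auto simp: divide_le_eq_1)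
  also have "\<dots> = 1" using 1 a_gt_1 G by (simp add: powr_divide powr_powr)
  finally show ?thesis using G by (subst rnorm_le_iff[OF f]) auto
qed

lemma rnorm_le_rmod_le1:
  assumes f: "f \<in> Lq" and 1: "rmod f \<le> 1"
  shows "rnorm f \<le> rmod f powr (1 / b)"
proof -
  \<comment> \<open>The modular is replaced by a positive upper bound \<open>e\<close> so that
    division is possible; a vanishing modular is then handled by letting \<open>e\<close> tend to
    0.\<close>
  have *: "rnorm f \<le> e powr (1 / b)" if e: "rmod f \<le> e" "0 < e" "e \<le> 1" for e
  proof -
    let ?G = "e powr (1 / b)"
    have b: "1 < b" using a_gt_1 a_le_b by simp
    have G: "0 < ?G" "?G \<le> 1" using e b powr_mono2[of "1 / b" e 1] by auto
    have "rmod (\<lambda>x. (1 / ?G) * f x) \<le> (1 / ?G) powr b * rmod f"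
      using G by (intro rmod_scale_ge1 f) auto
    also have "\<dots> = rmod f / e" using b e G by (simp add: powr_divide powr_powr)
    also have "\<dots> \<le> 1" using e by simp
    finally show ?thesis using G by (subst rnorm_le_iff[OF f]) auto
  qed
  show ?thesis
  proof (cases "rmod f = 0")
    case True
    have "rnorm f \<le> 0 + e" if "0 < e" for e
    proof -
      have b: "1 < b" using a_gt_1 a_le_b by simp
      have "rnorm f \<le> (min 1 e powr b) powr (1 / b)"
        using that b powr_mono2[of b "min 1 e" 1] by (intro *) (auto simp: True)
      then show ?thesis using that b by (simp add: powr_powr)
    qed
    then have "rnorm f \<le> 0" by (rule field_le_epsilon)
    then show ?thesis using True by simp
  next
    case False
    then have "0 < rmod f" using rmod_nonneg[of f] by linarith
    then show ?thesis using 1 by (intro *) auto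
  qed
qed

text \<open>The distinction by the size of the norm is the one made in \<open>p_star\<close>;
  applied to a gradient field it supplies the lower bound in the estimate for solutions.\<close>

lemma powr_rnorm_le_rmod:
  assumes f: "f \<in> Lq"
  shows "1 \<le> rnorm f \<Longrightarrow> rnorm f powr a \<le> rmod f" and "rnorm f < 1 \<Longrightarrow> rnorm f powr b \<le> rmod f"
proof -
  have b: "1 < b" using a_gt_1 a_le_b by simp
  show "rnorm f powr a \<le> rmod f" if "1 \<le> rnorm f"
  proof (cases "1 \<le> rmod f")
    case True
    have "rnorm f powr a \<le> (rmod f powr (1 / a)) powr a"
      using rnorm_le_rmod_ge1[OF f True] a_gt_1 by (intro powr_mono2) auto
    then show ?thesis using a_gt_1 by (simp add: powr_powr)
  next
    case False
    then have "rmod f powr (1 / b) < 1" using b powr_less_mono2[of "1 / b" "rmod f" 1] by simp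
    then show ?thesis using rnorm_le_rmod_le1[OF f] False that by simp
  qed
  show "rnorm f powr b \<le> rmod f" if "rnorm f < 1"
  proof (cases "rmod f \<le> 1")
    case True
    have "rnorm f powr b \<le> (rmod f powr (1 / b)) powr b"
      using rnorm_le_rmod_le1[OF f True] b by (intro powr_mono2) auto
    then show ?thesis using b by (simp add: powr_powr)
  next
    case False
    have "rnorm f powr b \<le> 1 powr b" using that b by (intro powr_mono2) auto
    then show ?thesis using False by simp
  qed
qed

lemma rmod_le_1: "f \<in> Lq \<Longrightarrow> rnorm f \<le> 1 \<Longrightarrow> rmod f \<le> 1"
  using rnorm_le_iff[of f 1] by simp

lemma rmod_eq_1: "f \<in> Lq \<Longrightarrow> rnorm f = 1 \<Longrightarrow> rmod f = 1"
  using rmod_le_1[of f] powr_rnorm_le_rmod(1)[of f] by simp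

lemma rnorm_tendsto_0:
  assumes f: "\<And>k. f k \<in> Lq" and lim: "(\<lambda>k. rmod (f k)) \<longlonglongrightarrow> 0"
  shows "(\<lambda>k. rnorm (f k)) \<longlonglongrightarrow> 0"
proof (rule tendsto_sandwich[of "\<lambda>_. 0" _ _ "\<lambda>k. rmod (f k) powr (1 / b)"])
  have "\<forall>\<^sub>F k in sequentially. rmod (f k) < 1" using lim by (rule order_tendstoD) simp
  then show "\<forall>\<^sub>F k in sequentially. rnorm (f k) \<le> rmod (f k) powr (1 / b)"
    by eventually_elim (intro rnorm_le_rmod_le1 f, simp)
  show "(\<lambda>k. rmod (f k) powr (1 / b)) \<longlonglongrightarrow> 0"
    using tendsto_powr'[OF lim tendsto_const[of "1 / b"]] a_gt_1 a_le_b by simp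
qed auto

lemma Lq_const: "(\<lambda>x. c) \<in> Lq"
proof (intro LqI_integrable)
  show "integrable M (\<lambda>x. \<bar>c\<bar> powr q x)"
  proof (rule Bochner_Integration.integrable_bound[of M "\<lambda>x. max 1 \<bar>c\<bar> powr b"])
    show "AE x in M. norm (\<bar>c\<bar> powr q x) \<le> norm (max 1 \<bar>c\<bar> powr b)"
    proof (intro AE_I2)
      fix x assume x: "x \<in> space M"
      have "\<bar>c\<bar> powr q x \<le> max 1 \<bar>c\<bar> powr q x" using q_gt_1[OF x] by (intro powr_mono2) auto
      also have "\<dots> \<le> max 1 \<bar>c\<bar> powr b" using q_le_b[OF x] by (intro powr_mono) auto
      finally show "norm (\<bar>c\<bar> powr q x) \<le> norm (max 1 \<bar>c\<bar> powr b)" by simp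
    qed
  qed auto
qed auto

text \<open>Hoelder against the constant 1, which lies in \<open>Lq\<close> because the measure is
  finite.\<close>

lemma Lq_integrable_self:
  assumes "f \<in> Lq" shows "integrable M f"
proof -
  have "integrable M (\<lambda>x. \<bar>1::real\<bar> powr (q x - 1) * \<bar>f x\<bar>)"
    by (rule holder(1)[OF Lq_const assms, of "rnorm f + 1"]) (auto simp: add_nonneg_pos)
  then have "integrable M (\<lambda>x. norm (f x))" by simp
  then show ?thesis using Lq_measurable[OF assms] by (rule integrable_norm_cancel)
qed

end

subsection \<open>Vector-valued functions\<close>

context variable_exponent
begin

definition Vq :: "('a \<Rightarrow> 'c::euclidean_space) set" where
  "Vq = {A \<in> borel_measurable M. (\<lambda>x. norm (A x)) \<in> Lq}"

definition vnorm :: "('a \<Rightarrow> 'c::euclidean_space) \<Rightarrow> real" where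
  "vnorm A = rnorm (\<lambda>x. norm (A x))"

definition vmod :: "('a \<Rightarrow> 'c::euclidean_space) \<Rightarrow> real" where
  "vmod A = rmod (\<lambda>x. norm (A x))"

lemma Vq_measurable: "A \<in> Vq \<Longrightarrow> A \<in> borel_measurable M"
  and Vq_norm: "A \<in> Vq \<Longrightarrow> (\<lambda>x. norm (A x)) \<in> Lq"
  by (auto simp: Vq_def)

lemma vnorm_nonneg [simp]: "0 \<le> vnorm A" and vmod_nonneg [simp]: "0 \<le> vmod A"
  by (auto simp: vnorm_def vmod_def)

lemma Vq_bound:
  assumes "g \<in> Lq" "A \<in> borel_measurable M" "\<And>x. x \<in> space M \<Longrightarrow> norm (A x) \<le> \<bar>g x\<bar>"
  shows "A \<in> Vq"
  using assms by (auto simp: Vq_def intro: Lq_mono)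

lemma vnorm_real: "vnorm f = rnorm f" for f :: "'a \<Rightarrow> real"
  unfolding vnorm_def by (intro rnorm_cong) simp

lemma Vq_real: "f \<in> Vq \<longleftrightarrow> f \<in> Lq" for f :: "'a \<Rightarrow> real"
proof
  assume "f \<in> Vq"
  then show "f \<in> Lq" by (intro Lq_mono[OF Vq_norm Vq_measurable]) auto
next
  assume f: "f \<in> Lq"
  then show "f \<in> Vq" by (intro Vq_bound[OF f] Lq_measurable) auto
qed

lemma Vq_add:
  assumes "A \<in> Vq" "B \<in> Vq"
  shows "(\<lambda>x. A x + B x) \<in> Vq"
proof (rule Vq_bound)
  show "(\<lambda>x. norm (A x) + norm (B x)) \<in> Lq" using assms by (intro Lq_add Vq_norm)
  show "(\<lambda>x. A x + B x) \<in> borel_measurable M"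
    using assms by (intro borel_measurable_add Vq_measurable)
  show "norm (A x + B x) \<le> \<bar>norm (A x) + norm (B x)\<bar>" for x
    using norm_triangle_ineq[of "A x" "B x"] by linarith
qed

lemma Vq_scaleR:
  assumes "A \<in> Vq"
  shows "(\<lambda>x. c *\<^sub>R A x) \<in> Vq"
proof (rule Vq_bound)
  show "(\<lambda>x. c * norm (A x)) \<in> Lq" using assms by (intro Lq_cmult Vq_norm)
  show "(\<lambda>x. c *\<^sub>R A x) \<in> borel_measurable M"
    using Vq_measurable[OF assms] by measurable
qed (simp add: abs_mult)

lemma Vq_diff: "A \<in> Vq \<Longrightarrow> B \<in> Vq \<Longrightarrow> (\<lambda>x. A x - B x) \<in> Vq"
  using Vq_add[of A "\<lambda>x. (- 1) *\<^sub>R B x"] Vq_scaleR[of B "- 1"] by simp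

lemma vnorm_triangle:
  assumes "A \<in> Vq" "B \<in> Vq"
  shows "vnorm (\<lambda>x. A x + B x) \<le> vnorm A + vnorm B"
proof -
  have "vnorm (\<lambda>x. A x + B x) \<le> rnorm (\<lambda>x. norm (A x) + norm (B x))"
    unfolding vnorm_def using assms by (intro rnorm_mono Lq_add Vq_norm) (auto intro: norm_triangle_ineq)
  also have "\<dots> \<le> vnorm A + vnorm B"
    unfolding vnorm_def using assms by (intro rnorm_triangle Vq_norm)
  finally show ?thesis .
qed

lemma vnorm_scaleR: "A \<in> Vq \<Longrightarrow> vnorm (\<lambda>x. c *\<^sub>R A x) = \<bar>c\<bar> * vnorm A"
  using rnorm_cmult[of "\<lambda>x. norm (A x)" "\<bar>c\<bar>"] by (simp add: vnorm_def Vq_norm)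

lemma vnorm_minus_commute: "vnorm (\<lambda>x. A x - B x) = vnorm (\<lambda>x. B x - A x)"
  by (simp add: vnorm_def norm_minus_commute)

lemma vnorm_triangle_diff:
  assumes "A \<in> Vq" "B \<in> Vq"
  shows "vnorm A \<le> vnorm (\<lambda>x. A x - B x) + vnorm B"
  using vnorm_triangle[OF Vq_diff[OF assms] assms(2)] by simp

text \<open>The Riesz-Fischer argument, run on the modular: uniform convexity delivers Cauchy
  sequences in this sense. The almost everywhere convergent subsequence is part of the conclusion
  because the form of the limit is read off pointwise later.\<close>

lemma Vq_complete:
  fixes A :: "nat \<Rightarrow> 'a \<Rightarrow> 'c::euclidean_space"
  assumes A: "\<And>k. A k \<in> Vq"
    and cauchy: "\<And>e. 0 < e \<Longrightarrow> \<exists>N. \<forall>j\<ge>N. \<forall>k\<ge>N. vmod (\<lambda>x. A j x - A k x) \<le> e"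
  obtains B r where "B \<in> Vq" "strict_mono (r :: nat \<Rightarrow> nat)"
    "AE x in M. (\<lambda>k. A (r k) x) \<longlonglongrightarrow> B x" "(\<lambda>k. vnorm (\<lambda>x. A k x - B x)) \<longlonglongrightarrow> 0"
proof -
  note [measurable] = Vq_measurable[OF A]
  \<comment> \<open>Scaling the \<open>n\<close>-th difference by \<open>2 ^ n\<close> costs the
    factor \<open>(2 ^ n) powr b\<close>; with this \<open>e n\<close> the scaled modulars are still
    bounded by a summable geometric sequence.\<close>
  define e :: "nat \<Rightarrow> real" where "e n = (1/2) ^ n / (2 ^ n) powr b" for n
  have "\<exists>N. \<forall>n. \<forall>j\<ge>N n. \<forall>k\<ge>N n. vmod (\<lambda>x. A j x - A k x) \<le> e n"
    by (intro choice allI cauchy) (simp add: e_def)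
  then obtain N where N: "\<And>n j k. N n \<le> j \<Longrightarrow> N n \<le> k \<Longrightarrow> vmod (\<lambda>x. A j x - A k x) \<le> e n"
    by blast
  \<comment> \<open>The summand \<open>n\<close> makes \<open>r\<close> strictly increasing, the
    partial sums put it beyond each threshold \<open>N n\<close>.\<close>
  define r where "r n = n + (\<Sum>i\<le>n. N i)" for n
  have r: "strict_mono r" unfolding strict_mono_Suc_iff r_def by simp
  have Nr: "N n \<le> r n" for n unfolding r_def using member_le_sum[of n "{..n}" N] by simp
  define d where "d n x = norm (A (r (Suc n)) x - A (r n) x)" for n x
  have dL: "d n \<in> Lq" for n unfolding d_def by (intro Vq_norm Vq_diff A)
  have dm [measurable]: "d n \<in> borel_measurable M" for n using dL by (rule Lq_measurable)
  have "rho (\<lambda>x. 2 ^ n * d n x) \<le> ennreal ((1/2) ^ n)" for n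
  proof -
    have "N n \<le> r (Suc n)" using Nr[of n] strict_monoD[OF r, of n "Suc n"] by simp
    then have "rmod (d n) \<le> e n" using N[of n "r (Suc n)" "r n"] Nr[of n] by (simp add: vmod_def d_def[abs_def])
    then have 1: "(2 ^ n) powr b * rmod (d n) \<le> (2 ^ n) powr b * e n" by (rule mult_left_mono) simp
    have "rmod (\<lambda>x. 2 ^ n * d n x) \<le> (2 ^ n) powr b * rmod (d n)" by (rule rmod_scale_ge1[OF dL]) simp
    from this 1 have "rmod (\<lambda>x. 2 ^ n * d n x) \<le> (2 ^ n) powr b * e n" by (rule order_trans)
    also have "\<dots> = (1/2) ^ n" by (simp add: e_def)
    finally show ?thesis by (simp add: rho_eq_rmod[OF Lq_cmult[OF dL]])
  qed
  then have "(\<Sum>n. rho (\<lambda>x. 2 ^ n * d n x)) \<le> (\<Sum>n. ennreal ((1/2) ^ n))"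
    by (intro suminf_le) auto
  also have "\<dots> < top" by (subst suminf_ennreal2) (auto simp: summable_geometric)
  finally have "(\<integral>\<^sup>+x. (\<Sum>n. ennreal (\<bar>2 ^ n * d n x\<bar> powr q x)) \<partial>M) \<noteq> \<infinity>"
    unfolding rho_def by (subst nn_integral_suminf) auto
  then have "AE x in M. (\<Sum>n. ennreal (\<bar>2 ^ n * d n x\<bar> powr q x)) \<noteq> \<infinity>"
    by (intro nn_integral_noteq_infinite) measurable
  then have conv: "AE x in M. convergent (\<lambda>n. A (r n) x)"
    using AE_space
  proof eventually_elim
    case (elim x)
    have "summable (\<lambda>n. \<bar>2 ^ n * d n x\<bar> powr q x)"
      using elim(1) by (intro summable_suminf_not_top) auto
    then have "(\<lambda>n. \<bar>2 ^ n * d n x\<bar> powr q x) \<longlonglongrightarrow> 0" by (rule summable_LIMSEQ_zero)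
    then have "\<forall>\<^sub>F n in sequentially. \<bar>2 ^ n * d n x\<bar> powr q x < 1"
      by (rule order_tendstoD) simp
    then have "\<forall>\<^sub>F n in sequentially. norm (A (r (Suc n)) x - A (r n) x) \<le> (1/2) ^ n"
    proof eventually_elim
      case (elim n)
      have "\<bar>2 ^ n * d n x\<bar> < 1"
        using elim ge_one_powr_ge_zero[of "\<bar>2 ^ n * d n x\<bar>" "q x"] q_gt_1[OF \<open>x \<in> space M\<close>] by force
      then show ?case by (simp add: d_def abs_mult field_simps)
    qed
    then have "\<forall>\<^sub>F n in sequentially. norm (norm (A (r (Suc n)) x - A (r n) x)) \<le> (1/2) ^ n"
      by (simp only: real_norm_def abs_norm_cancel)
    moreover have "summable (\<lambda>n. (1/2 :: real) ^ n)" by (rule summable_geometric) simp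
    ultimately have "summable (\<lambda>n. norm (A (r (Suc n)) x - A (r n) x))"
      by (rule summable_comparison_test_ev)
    then have "summable (\<lambda>n. A (r (Suc n)) x - A (r n) x)" by (rule summable_norm_cancel)
    then have "convergent (\<lambda>n. A (r 0) x + (\<Sum>i<n. A (r (Suc i)) x - A (r i) x))"
      by (simp add: summable_iff_convergent convergent_add_const_iff)
    then show ?case by (simp add: sum_lessThan_telescope[of "\<lambda>i. A (r i) x"])
  qed
  define B where "B x = lim (\<lambda>n. A (r n) x)" for x
  have [measurable]: "B \<in> borel_measurable M" unfolding B_def by measurable
  have AE: "AE x in M. (\<lambda>k. A (r k) x) \<longlonglongrightarrow> B x"
    using conv by eventually_elim (simp add: B_def convergent_LIMSEQ_iff)
  \<comment> \<open>Fatou along the subsequence carries a Cauchy bound over to the limit. It is used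
    twice: for \<open>B \<in> Vq\<close> and for convergence of the whole sequence.\<close>
  have fatou: "rho (\<lambda>x. norm (A j x - B x)) \<le> ennreal c"
    if c: "\<And>k. n0 \<le> k \<Longrightarrow> vmod (\<lambda>x. A j x - A k x) \<le> c" for n0 j c
  proof -
    have "rho (\<lambda>x. norm (A j x - B x))
        = (\<integral>\<^sup>+x. liminf (\<lambda>k. ennreal (\<bar>norm (A j x - A (r k) x)\<bar> powr q x)) \<partial>M)"
      unfolding rho_def
    proof (intro nn_integral_cong_AE)
      show "AE x in M. ennreal (\<bar>norm (A j x - B x)\<bar> powr q x)
          = liminf (\<lambda>k. ennreal (\<bar>norm (A j x - A (r k) x)\<bar> powr q x))"
        using AE AE_space
      proof eventually_elim
        case (elim x)
        have "(\<lambda>k. ennreal (\<bar>norm (A j x - A (r k) x)\<bar> powr q x)) \<longlonglongrightarrow> ennreal (\<bar>norm (A j x - B x)\<bar> powr q x)"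
          using elim(1) q_gt_1[OF elim(2)] by (intro tendsto_intros tendsto_ennrealI tendsto_powr') auto
        then show ?case by (intro lim_imp_Liminf[symmetric]) auto
      qed
    qed
    also have "\<dots> \<le> liminf (\<lambda>k. rho (\<lambda>x. norm (A j x - A (r k) x)))"
      unfolding rho_def by (rule nn_integral_liminf) measurable
    also have "\<dots> \<le> limsup (\<lambda>k. rho (\<lambda>x. norm (A j x - A (r k) x)))" by (intro Liminf_le_Limsup) simp
    also have "\<dots> \<le> ennreal c"
    proof (intro Limsup_bounded)
      have "rho (\<lambda>x. norm (A j x - A (r k) x)) \<le> ennreal c" if "n0 \<le> k" for k
        using c[of "r k"] seq_suble[OF r, of k] that rho_eq_rmod[OF Vq_norm[OF Vq_diff[OF A A]], of j "r k"]
        by (simp add: vmod_def ennreal_leI)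
      then show "\<forall>\<^sub>F k in sequentially. rho (\<lambda>x. norm (A j x - A (r k) x)) \<le> ennreal c"
        by (auto simp: eventually_sequentially)
    qed
    finally show ?thesis .
  qed
  obtain N1 where N1: "\<And>j k. N1 \<le> j \<Longrightarrow> N1 \<le> k \<Longrightarrow> vmod (\<lambda>x. A j x - A k x) \<le> 1"
    using cauchy[of 1] by auto
  have "rho (\<lambda>x. norm (A N1 x - B x)) \<le> ennreal 1" by (rule fatou[of N1]) (rule N1, auto)
  then have "rho (\<lambda>x. norm (A N1 x - B x)) < \<infinity>" by (rule order.strict_trans1) simp
  then have "(\<lambda>x. A N1 x - B x) \<in> Vq" by (simp add: Vq_def Lq_def)
  from Vq_diff[OF A[of N1] this] have B: "B \<in> Vq" by simp
  have "(\<lambda>k. vmod (\<lambda>x. A k x - B x)) \<longlonglongrightarrow> 0"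
  proof (rule LIMSEQ_I)
    fix c :: real assume c: "0 < c"
    then obtain n where n: "\<And>j k. n \<le> j \<Longrightarrow> n \<le> k \<Longrightarrow> vmod (\<lambda>x. A j x - A k x) \<le> c / 2"
      using cauchy[of "c / 2"] by auto
    have "vmod (\<lambda>x. A j x - B x) \<le> c / 2" if "n \<le> j" for j
      using fatou[of n j "c / 2", OF n[OF that]] c rho_eq_rmod[OF Vq_norm[OF Vq_diff[OF A B]], of j]
      by (simp add: vmod_def)
    then show "\<exists>n. \<forall>k\<ge>n. norm (vmod (\<lambda>x. A k x - B x) - 0) < c"
      using c by (intro exI[of _ n]) (auto intro: order.strict_trans1[of _ "c / 2"])
  qed
  then have "(\<lambda>k. vnorm (\<lambda>x. A k x - B x)) \<longlonglongrightarrow> 0"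
    unfolding vnorm_def vmod_def by (intro rnorm_tendsto_0 Vq_norm Vq_diff A B)
  with that[OF B r AE] show thesis by blast
qed

text \<open>The derivative of \<open>energy\<close> at \<open>A\<close> in direction
  \<open>B\<close>; linear in \<open>B\<close>, not in \<open>A\<close>. For real functions it also
  expresses the data term, being the pairing of \<open>f v\<close> with
  \<open>\<phi> v\<close>.\<close>

definition dual :: "('a \<Rightarrow> 'c::euclidean_space) \<Rightarrow> ('a \<Rightarrow> 'c) \<Rightarrow> real" where
  "dual A B = (\<integral>x. norm (A x) powr (q x - 2) * (B x \<bullet> A x) \<partial>M)"

definition energy :: "('a \<Rightarrow> 'c::euclidean_space) \<Rightarrow> real" where
  "energy A = (\<integral>x. norm (A x) powr q x / q x \<partial>M)"

lemma powr_inner_le: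
  fixes z y :: "'c::euclidean_space"
  shows "\<bar>norm z powr (s - 2) * (y \<bullet> z)\<bar> \<le> norm z powr (s - 1) * norm y"
proof (cases "z = 0")
  case False
  have "\<bar>norm z powr (s - 2) * (y \<bullet> z)\<bar> \<le> norm z powr (s - 2) * (norm y * norm z)"
    by (simp add: abs_mult Cauchy_Schwarz_ineq2 mult_left_mono)
  also have "\<dots> = norm z powr (s - 1) * norm y"
    using False powr_mult_base[of "norm z" "s - 2"] by (simp add: mult.commute mult.left_commute)
  finally show ?thesis .
qed simp

lemma dual_integrable:
  assumes A: "A \<in> Vq" and B: "B \<in> Vq"
  shows "integrable M (\<lambda>x. norm (A x) powr (q x - 2) * (B x \<bullet> A x))"
proof (rule Bochner_Integration.integrable_bound)
  note [measurable] = Vq_measurable[OF A] Vq_measurable[OF B]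
  show "integrable M (\<lambda>x. \<bar>norm (A x)\<bar> powr (q x - 1) * \<bar>norm (B x)\<bar>)"
    by (rule holder(1)[OF Vq_norm[OF A] Vq_norm[OF B], of "vnorm B + 1"]) (auto simp: vnorm_def add_nonneg_pos)
  show "AE x in M. norm (norm (A x) powr (q x - 2) * (B x \<bullet> A x))
      \<le> norm (\<bar>norm (A x)\<bar> powr (q x - 1) * \<bar>norm (B x)\<bar>)"
    using powr_inner_le by (intro AE_I2) (simp add: abs_mult)
qed (use Vq_measurable[OF A] Vq_measurable[OF B] in measurable)

lemma dual_bound:
  assumes A: "A \<in> Vq" and B: "B \<in> Vq" and \<mu>: "vnorm B \<le> \<mu>" "0 < \<mu>"
  shows "\<bar>dual A B\<bar> \<le> \<mu> * (vmod A + 1)"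
proof -
  have "\<bar>dual A B\<bar> \<le> (\<integral>x. \<bar>norm (A x)\<bar> powr (q x - 1) * \<bar>norm (B x)\<bar> \<partial>M)"
    unfolding dual_def
    using holder(1)[OF Vq_norm[OF A] Vq_norm[OF B], of \<mu>] \<mu> dual_integrable[OF A B] powr_inner_le
    by (intro order_trans[OF integral_abs_bound] integral_mono) (auto simp: vnorm_def)
  also have "\<dots> \<le> \<mu> * (vmod A + 1)"
    unfolding vmod_def using \<mu> by (intro holder Vq_norm A B) (auto simp: vnorm_def)
  finally show ?thesis .
qed

lemma dual_bound_vnorm:
  assumes A: "A \<in> Vq" and B: "B \<in> Vq"
  shows "\<bar>dual A B\<bar> \<le> vnorm B * (vmod A + 1)"
proof (rule field_le_epsilon)
  fix e :: real assume e: "0 < e"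
  \<comment> \<open>\<open>dual_bound\<close> needs a positive bound, but \<open>vnorm B\<close> may
    be 0; adding \<open>c\<close> enlarges the estimate by exactly \<open>e\<close>.\<close>
  define c where "c = e / (vmod A + 1)"
  have p: "0 < vmod A + 1" by (simp add: add_nonneg_pos)
  then have c: "0 < c" using e by (simp add: c_def)
  have "\<bar>dual A B\<bar> \<le> (vnorm B + c) * (vmod A + 1)"
    using c by (intro dual_bound A B) (auto simp: add_nonneg_pos)
  then show "\<bar>dual A B\<bar> \<le> vnorm B * (vmod A + 1) + e" using p by (simp add: c_def distrib_right)
qed

lemma dual_add:
  assumes "A \<in> Vq" "B \<in> Vq" "C \<in> Vq"
  shows "dual A (\<lambda>x. B x + C x) = dual A B + dual A C"
  unfolding dual_def inner_add_left distrib_left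
  using assms by (intro Bochner_Integration.integral_add dual_integrable)

lemma dual_scaleR: "dual A (\<lambda>x. c *\<^sub>R B x) = c * dual A B"
  unfolding dual_def by (subst integral_mult_right_zero[symmetric]) (simp add: mult.left_commute)

lemma dual_self:
  fixes A :: "'a \<Rightarrow> 'c::euclidean_space"
  shows "dual A A = vmod A"
proof -
  have "norm z powr (s - 2) * (z \<bullet> z) = norm z powr s" for z :: 'c and s
    using powr_mult_base[of "norm z" "s - 2"] powr_mult_base[of "norm z" "s - 1"]
    by (cases "z = 0") (auto simp: power2_norm_eq_inner[symmetric] power2_eq_square ac_simps)
  then show ?thesis by (simp add: dual_def vmod_def rmod_def)
qed

lemma dual_diff:
  assumes "A \<in> Vq" "B \<in> Vq" "C \<in> Vq"
  shows "dual A (\<lambda>x. B x - C x) = dual A B - dual A C"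
  using dual_add[OF assms(1,2) Vq_scaleR[OF assms(3), of "- 1"]] dual_scaleR[of A "- 1" C] by simp

lemma dual_tendsto:
  assumes A: "A \<in> Vq" and B: "\<And>k. B k \<in> Vq" "C \<in> Vq"
    and lim: "(\<lambda>k. vnorm (\<lambda>x. B k x - C x)) \<longlonglongrightarrow> 0"
  shows "(\<lambda>k. dual A (B k)) \<longlonglongrightarrow> dual A C"
proof (rule LIM_zero_cancel, rule Lim_null_comparison)
  show "\<forall>\<^sub>F k in sequentially. norm (dual A (B k) - dual A C) \<le> vnorm (\<lambda>x. B k x - C x) * (vmod A + 1)"
    using dual_bound_vnorm[OF A Vq_diff[OF B(1) B(2)]] dual_diff[OF A B(1) B(2)] by auto
  show "(\<lambda>k. vnorm (\<lambda>x. B k x - C x) * (vmod A + 1)) \<longlonglongrightarrow> 0"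
    using tendsto_mult_right[OF lim, of "vmod A + 1"] by simp
qed

lemma vmod_integrable: "A \<in> Vq \<Longrightarrow> integrable M (\<lambda>x. norm (A x) powr q x)"
  using Lq_integrable[OF Vq_norm, of A] by simp

lemma energy_integrable:
  assumes A: "A \<in> Vq"
  shows "integrable M (\<lambda>x. norm (A x) powr q x / q x)"
proof (rule Bochner_Integration.integrable_bound[OF vmod_integrable[OF A]])
  note [measurable] = Vq_measurable[OF A]
  show "(\<lambda>x. norm (A x) powr q x / q x) \<in> borel_measurable M" by measurable
  have "norm (A x) powr q x / q x \<le> norm (A x) powr q x / 1" if "x \<in> space M" for x
    using q_gt_1[OF that] by (intro divide_left_mono) auto
  then show "AE x in M. norm (norm (A x) powr q x / q x) \<le> norm (norm (A x) powr q x)"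
    using q_gt_1 by (intro AE_I2) (force simp: abs_div)
qed

lemma vmod_le_energy:
  assumes A: "A \<in> Vq"
  shows "vmod A \<le> b * energy A"
proof -
  have "vmod A \<le> (\<integral>x. b * (norm (A x) powr q x / q x) \<partial>M)"
    unfolding vmod_def rmod_def abs_norm_cancel
  proof (intro integral_mono vmod_integrable integrable_mult_right energy_integrable A)
    fix x assume x: "x \<in> space M"
    have "1 * norm (A x) powr q x \<le> (b / q x) * norm (A x) powr q x"
      using q_gt_1[OF x] q_le_b[OF x] by (intro mult_right_mono) auto
    then show "norm (A x) powr q x \<le> b * (norm (A x) powr q x / q x)" by simp
  qed
  also have "\<dots> = b * energy A" unfolding energy_def by (rule integral_mult_right_zero)
  finally show ?thesis .
qed

text \<open>The sharp Young inequality, integrated. It states convexity with \<open>dual\<close> as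
  gradient and so replaces differentiation under the integral, both for continuity of the energy and
  for the Euler-Lagrange equation.\<close>

lemma energy_subgradient:
  assumes A: "A \<in> Vq" and Z: "Z \<in> Vq"
  shows "energy Z + dual Z (\<lambda>x. A x - Z x) \<le> energy A"
proof -
  have "dual Z A \<le> (\<integral>x. norm (A x) powr q x / q x + (norm (Z x) powr q x - norm (Z x) powr q x / q x) \<partial>M)"
    unfolding dual_def
  proof (intro integral_mono dual_integrable A Z Bochner_Integration.integrable_add
      Bochner_Integration.integrable_diff energy_integrable vmod_integrable)
    fix x assume x: "x \<in> space M"
    have "norm (Z x) powr (q x - 2) * (A x \<bullet> Z x) \<le> norm (Z x) powr (q x - 1) * norm (A x)"
      using powr_inner_le[of "Z x" "q x" "A x"] by linarith
    also have "\<dots> \<le> norm (A x) powr q x / q x + (1 - 1 / q x) * norm (Z x) powr q x"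
      using q_gt_1[OF x] by (intro young_powr) auto
    finally show "norm (Z x) powr (q x - 2) * (A x \<bullet> Z x)
        \<le> norm (A x) powr q x / q x + (norm (Z x) powr q x - norm (Z x) powr q x / q x)"
      by (simp add: left_diff_distrib)
  qed
  also have "\<dots> = energy A + (vmod Z - energy Z)"
    unfolding energy_def vmod_def rmod_def abs_norm_cancel
    by (simp add: Bochner_Integration.integral_add Bochner_Integration.integral_diff
        energy_integrable vmod_integrable A Z)
  finally show ?thesis using dual_diff[OF Z A Z] dual_self[of Z] by simp
qed


text \<open>The subgradient inequality at \<open>B\<close> bounds the difference from one side, the
  one at \<open>A k\<close> from the other. The modulars of \<open>A k\<close> stay bounded since
  the sequence is eventually within distance 1 of \<open>B\<close>.\<close>

lemma energy_tendsto:
  assumes A: "\<And>k. A k \<in> Vq" "B \<in> Vq" and lim: "(\<lambda>k. vnorm (\<lambda>x. A k x - B x)) \<longlonglongrightarrow> 0"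
  shows "(\<lambda>k. energy (A k)) \<longlonglongrightarrow> energy B"
proof (rule LIM_zero_cancel, rule Lim_null_comparison)
  define c where "c = (vnorm B + 1) powr b"
  have "\<forall>\<^sub>F k in sequentially. vnorm (\<lambda>x. A k x - B x) < 1" using lim by (rule order_tendstoD) simp
  then show "\<forall>\<^sub>F k in sequentially. norm (energy (A k) - energy B)
      \<le> vnorm (\<lambda>x. A k x - B x) * ((c + 1) + (vmod B + 1))"
  proof eventually_elim
    case (elim k)
    have "vnorm (A k) \<le> vnorm B + 1" using elim vnorm_triangle_diff[OF A(1) A(2), of k] by simp
    then have c: "vmod (A k) \<le> c"
      unfolding vmod_def c_def by (intro rmod_le_powr Vq_norm A) (auto simp: vnorm_def)
    have "energy B - energy (A k) \<le> dual B (\<lambda>x. B x - A k x)"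
      using energy_subgradient[OF A(1) A(2), of k] dual_diff[OF A(2) A(1) A(2), of k]
        dual_diff[OF A(2) A(2) A(1), of k] by simp
    also have "\<dots> \<le> vnorm (\<lambda>x. A k x - B x) * (vmod B + 1)"
      using dual_bound_vnorm[OF A(2) Vq_diff[OF A(2) A(1)], of k] vnorm_minus_commute[of "A k" B] by simp
    also have "\<dots> \<le> vnorm (\<lambda>x. A k x - B x) * ((c + 1) + (vmod B + 1))"
      unfolding c_def by (intro mult_left_mono) auto
    finally have 1: "energy B - energy (A k) \<le> vnorm (\<lambda>x. A k x - B x) * ((c + 1) + (vmod B + 1))" .
    have "energy (A k) - energy B \<le> dual (A k) (\<lambda>x. A k x - B x)"
      using energy_subgradient[OF A(2) A(1), of k] dual_diff[OF A(1) A(1) A(2), of k]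
        dual_diff[OF A(1) A(2) A(1), of k k] by simp
    also have "\<dots> \<le> vnorm (\<lambda>x. A k x - B x) * (vmod (A k) + 1)"
      using dual_bound_vnorm[OF A(1) Vq_diff[OF A(1) A(2)], of k k] by simp
    also have "\<dots> \<le> vnorm (\<lambda>x. A k x - B x) * ((c + 1) + (vmod B + 1))"
    proof (intro mult_left_mono)
      show "vmod (A k) + 1 \<le> (c + 1) + (vmod B + 1)" using c vmod_nonneg[of B] by linarith
    qed simp
    finally show ?case using 1 by (simp add: abs_le_iff)
  qed
  show "(\<lambda>k. vnorm (\<lambda>x. A k x - B x) * ((c + 1) + (vmod B + 1))) \<longlonglongrightarrow> 0"
    using tendsto_mult_right[OF lim, of "(c + 1) + (vmod B + 1)"] by simp
qed

text \<open>The \<open>\<eta>\<close> term lets one inequality cover all exponents: below 2 the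
  convexity defect is of second order for nearby values and cannot control the power of their
  difference alone.\<close>

lemma energy_uniformly_convex:
  fixes A B :: "'a \<Rightarrow> 'c::euclidean_space"
  assumes "0 < \<eta>"
  shows "\<exists>K>0. \<forall>A\<in>Vq. \<forall>B\<in>(Vq :: ('a \<Rightarrow> 'c) set). vmod (\<lambda>x. A x - B x) \<le> \<eta> * (vmod A + vmod B)
    + K * ((energy A + energy B) / 2 - energy (\<lambda>x. (1/2) *\<^sub>R (A x + B x)))"
proof -
  obtain K where K: "0 < K" "\<And>s x y :: 'c. a \<le> s \<Longrightarrow> s \<le> b \<Longrightarrow>
      norm (x - y) powr s \<le> \<eta> * (norm x powr s + norm y powr s)
      + K * ((norm x powr s + norm y powr s) / 2 - norm ((1/2) *\<^sub>R (x + y)) powr s)"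
    using uniform_convexity_powr[OF a_gt_1 assms, of b, where 'c = 'c] by auto
  have "vmod (\<lambda>x. A x - B x) \<le> \<eta> * (vmod A + vmod B)
      + (K * b) * ((energy A + energy B) / 2 - energy (\<lambda>x. (1/2) *\<^sub>R (A x + B x)))"
    if A: "A \<in> Vq" and B: "B \<in> Vq" for A B :: "'a \<Rightarrow> 'c"
  proof -
    have AB: "(\<lambda>x. (1/2) *\<^sub>R (A x + B x)) \<in> Vq" by (intro Vq_scaleR Vq_add A B)
    note I = energy_integrable[OF A] energy_integrable[OF B] energy_integrable[OF AB]
      vmod_integrable[OF A] vmod_integrable[OF B]
    let ?D = "\<lambda>x. (norm (A x) powr q x / q x + norm (B x) powr q x / q x) / 2 - norm ((1/2) *\<^sub>R (A x + B x)) powr q x / q x"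
    have "vmod (\<lambda>x. A x - B x)
        \<le> (\<integral>x. \<eta> * (norm (A x) powr q x + norm (B x) powr q x) + (K * b) * ?D x \<partial>M)"
      unfolding vmod_def rmod_def abs_norm_cancel
    proof (rule integral_mono)
      show "integrable M (\<lambda>x. norm (A x - B x) powr q x)" by (intro vmod_integrable Vq_diff A B)
      show "integrable M (\<lambda>x. \<eta> * (norm (A x) powr q x + norm (B x) powr q x) + (K * b) * ?D x)"
        by (intro Bochner_Integration.integrable_add Bochner_Integration.integrable_diff
            integrable_mult_right integrable_divide_zero impI I)
      fix x assume x: "x \<in> space M"
      let ?d = "(norm (A x) powr q x + norm (B x) powr q x) / 2 - norm ((1/2) *\<^sub>R (A x + B x)) powr q x"
      have d: "0 \<le> ?d" using norm_powr_midpoint[OF q_gt_1[OF x], of "A x" "B x"] by linarith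
      \<comment> \<open>The pointwise defect lacks the weight \<open>1 / q x\<close> of the energy.
        As it is nonnegative and \<open>q x \<le> b\<close>, a factor \<open>b / q x \<ge> 1\<close>
        may be inserted, whence the constant \<open>K * b\<close>.\<close>
      have "1 * ?d \<le> (b / q x) * ?d"
        using q_gt_1[OF x] q_le_b[OF x] by (intro mult_right_mono d) auto
      also have "\<dots> = b * ?D x"
        using q_gt_1[OF x] by (simp only: diff_divide_distrib add_divide_distrib) (simp add: field_simps)
      finally have "K * ?d \<le> K * (b * ?D x)" using K by (intro mult_left_mono) auto
      then show "norm (A x - B x) powr q x \<le> \<eta> * (norm (A x) powr q x + norm (B x) powr q x) + (K * b) * ?D x"
        using K(2)[OF a_le_q[OF x] q_le_b[OF x], of "A x" "B x"] by (simp only: mult.assoc)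
    qed
    also have "\<dots> = \<eta> * (vmod A + vmod B) + (K * b) * ((energy A + energy B) / 2 - energy (\<lambda>x. (1/2) *\<^sub>R (A x + B x)))"
    proof -
      have 1: "(\<integral>x. ?D x \<partial>M) = (energy A + energy B) / 2 - energy (\<lambda>x. (1/2) *\<^sub>R (A x + B x))"
      proof -
        have "(\<integral>x. ?D x \<partial>M) = (\<integral>x. (norm (A x) powr q x / q x + norm (B x) powr q x / q x) / 2 \<partial>M)
            - energy (\<lambda>x. (1/2) *\<^sub>R (A x + B x))"
          unfolding energy_def
          by (intro Bochner_Integration.integral_diff integrable_divide_zero impI Bochner_Integration.integrable_add I)
        then show ?thesis
          unfolding integral_divide_zero energy_def Bochner_Integration.integral_add[OF I(1,2)] .
      qed
      have 2: "(\<integral>x. norm (A x) powr q x + norm (B x) powr q x \<partial>M) = vmod A + vmod B"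
        unfolding vmod_def rmod_def abs_norm_cancel by (intro Bochner_Integration.integral_add I)
      show ?thesis
        unfolding 1[symmetric] 2[symmetric] integral_mult_right_zero[symmetric]
        by (intro Bochner_Integration.integral_add integrable_mult_right Bochner_Integration.integrable_add
            Bochner_Integration.integrable_diff integrable_divide_zero impI I)
    qed
    finally show ?thesis .
  qed
  moreover have "0 < K * b" using K a_gt_1 a_le_b by simp
  ultimately show ?thesis by blast
qed

text \<open>At \<open>w = 0\<close> the factor with exponent \<open>s - 2\<close> may blow up, but
  the inner product contributes one more power of the norm, leaving the positive exponent
  \<open>s - 1\<close>.\<close>

lemma tendsto_powr_inner:
  fixes z :: "nat \<Rightarrow> 'c::euclidean_space"
  assumes s: "1 < s" and z: "z \<longlonglongrightarrow> w"
  shows "(\<lambda>k. norm (z k) powr (s - 2) * (y \<bullet> z k)) \<longlonglongrightarrow> norm w powr (s - 2) * (y \<bullet> w)"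
proof (cases "w = 0")
  case True
  have "(\<lambda>k. norm (z k) powr (s - 1) * norm y) \<longlonglongrightarrow> norm w powr (s - 1) * norm y"
    using s by (intro tendsto_intros z tendsto_powr') auto
  then have lim: "(\<lambda>k. norm (z k) powr (s - 1) * norm y) \<longlonglongrightarrow> 0" using True by simp
  have "\<forall>\<^sub>F k in sequentially. norm (norm (z k) powr (s - 2) * (y \<bullet> z k)) \<le> norm (z k) powr (s - 1) * norm y"
    using powr_inner_le by (intro always_eventually allI) (simp only: real_norm_def)
  from Lim_null_comparison[OF this lim] show ?thesis using True by simp
next
  case False
  then show ?thesis by (intro tendsto_mult tendsto_powr tendsto_norm tendsto_inner tendsto_const z) auto
qed

text \<open>The pairing is nonlinear in its first argument, so continuity is only shown along a
  line, by dominated convergence with majorant \<open>(norm (A x) + norm (B x)) powr q x\<close>.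
  This is all that the first variation requires.\<close>

lemma dual_perturb_tendsto:
  fixes A B :: "'a \<Rightarrow> 'c::euclidean_space"
  assumes A: "A \<in> Vq" and B: "B \<in> Vq"
  shows "(\<lambda>k. dual (\<lambda>x. A x + (1 / Suc k) *\<^sub>R B x) B) \<longlonglongrightarrow> dual A B"
  unfolding dual_def
proof (rule integral_dominated_convergence)
  note [measurable] = Vq_measurable[OF A] Vq_measurable[OF B]
  show "(\<lambda>x. norm (A x) powr (q x - 2) * (B x \<bullet> A x)) \<in> borel_measurable M" by measurable
  show "\<And>k. (\<lambda>x. norm (A x + (1 / Suc k) *\<^sub>R B x) powr (q x - 2) * (B x \<bullet> (A x + (1 / Suc k) *\<^sub>R B x))) \<in> borel_measurable M"
    by measurable
  have "(\<lambda>x. norm (A x) + norm (B x)) \<in> Lq" by (intro Lq_add Vq_norm A B)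
  from Lq_integrable[OF this] show "integrable M (\<lambda>x. (norm (A x) + norm (B x)) powr q x)" by simp
  show "AE x in M. (\<lambda>k. norm (A x + (1 / Suc k) *\<^sub>R B x) powr (q x - 2) * (B x \<bullet> (A x + (1 / Suc k) *\<^sub>R B x)))
      \<longlonglongrightarrow> norm (A x) powr (q x - 2) * (B x \<bullet> A x)"
  proof (intro AE_I2 tendsto_powr_inner q_gt_1)
    fix x
    have "(\<lambda>k. A x + (1 / Suc k) *\<^sub>R B x) \<longlonglongrightarrow> A x + 0 *\<^sub>R B x"
      by (intro tendsto_intros LIMSEQ_Suc[OF lim_1_over_n])
    then show "(\<lambda>k. A x + (1 / Suc k) *\<^sub>R B x) \<longlonglongrightarrow> A x" by simp
  qed
  show "AE x in M. norm (norm (A x + (1 / Suc k) *\<^sub>R B x) powr (q x - 2) * (B x \<bullet> (A x + (1 / Suc k) *\<^sub>R B x)))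
      \<le> (norm (A x) + norm (B x)) powr q x" for k
  proof (intro AE_I2)
    fix x assume x: "x \<in> space M"
    let ?z = "A x + (1 / Suc k) *\<^sub>R B x" and ?m = "norm (A x) + norm (B x)"
    have "norm ((1 / Suc k) *\<^sub>R B x) \<le> norm (B x)"
      using mult_right_mono[of "1 / Suc k" 1 "norm (B x)"] by simp
    then have z: "norm ?z \<le> ?m" using norm_triangle_ineq[of "A x" "(1 / Suc k) *\<^sub>R B x"] by linarith
    have "norm (norm ?z powr (q x - 2) * (B x \<bullet> ?z)) \<le> norm ?z powr (q x - 1) * norm (B x)"
      using powr_inner_le[of ?z "q x" "B x"] by (simp only: real_norm_def)
    also have "\<dots> \<le> ?m powr (q x - 1) * ?m"
      using z q_gt_1[OF x] by (intro mult_mono powr_mono2) auto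
    also have "\<dots> = ?m powr q x" using powr_mult_base[of ?m "q x - 1"] by (simp add: mult.commute)
    finally show "norm (norm ?z powr (q x - 2) * (B x \<bullet> ?z)) \<le> ?m powr q x" .
  qed
qed

end

subsection \<open>Minimisation on a linear space of pairs\<close>

context variable_exponent
begin

text \<open>Turns smallness in norm, as the Poincare inequality provides it, into smallness of the
  modular, as \<open>Vq_complete\<close> demands it.\<close>

lemma rmod_le_small:
  assumes f: "f \<in> Lq" and c: "rnorm f \<le> c" "0 < c" "c \<le> 1"
  shows "rmod f \<le> c"
proof -
  have "rmod f = rmod (\<lambda>x. c * (f x / c))" using c by simp
  also have "\<dots> \<le> c powr a * rmod (\<lambda>x. f x / c)" using c f by (intro rmod_scale_le1 Lq_divide) auto
  also have "\<dots> \<le> c powr 1 * 1"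
    using rnorm_le_iff[of f c] c f a_gt_1 by (intro mult_mono powr_mono') auto
  finally show ?thesis using c by simp
qed

end

locale linear_pairs = variable_exponent M q a b for M :: "'a measure" and q a b +
  fixes X :: "(('a \<Rightarrow> real) \<times> ('a \<Rightarrow> 'c::euclidean_space)) set"
  assumes X_fst: "(U, A) \<in> X \<Longrightarrow> U \<in> Lq" and X_snd: "(U, A) \<in> X \<Longrightarrow> A \<in> Vq"
    and X_add: "(U, A) \<in> X \<Longrightarrow> (V, B) \<in> X \<Longrightarrow> (\<lambda>x. U x + V x, \<lambda>x. A x + B x) \<in> X"
    and X_scale: "(U, A) \<in> X \<Longrightarrow> (\<lambda>x. c *\<^sub>R U x, \<lambda>x. c *\<^sub>R A x) \<in> X"
    and X_zero: "(\<lambda>x. 0, \<lambda>x. 0) \<in> X"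
begin

text \<open>Describes the closure of \<open>X\<close>, in which the minimiser lives. The
  approximating sequence is an explicit argument because pointwise convergence of that same sequence
  is asserted later.\<close>

definition limit_of :: "(nat \<Rightarrow> 'a \<Rightarrow> real) \<Rightarrow> (nat \<Rightarrow> 'a \<Rightarrow> 'c) \<Rightarrow> ('a \<Rightarrow> real) \<Rightarrow> ('a \<Rightarrow> 'c) \<Rightarrow> bool" where
  "limit_of Us As U A \<longleftrightarrow> U \<in> Lq \<and> A \<in> Vq \<and> (\<forall>k. (Us k, As k) \<in> X) \<and>
    (\<lambda>k. rnorm (\<lambda>x. Us k x - U x)) \<longlonglongrightarrow> 0 \<and> (\<lambda>k. vnorm (\<lambda>x. As k x - A x)) \<longlonglongrightarrow> 0"

definition solves :: "('a \<Rightarrow> real) \<Rightarrow> ('a \<Rightarrow> 'c) \<Rightarrow> bool" where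
  "solves F A \<longleftrightarrow> (\<forall>(\<Phi>, B) \<in> X. dual A B = - dual F \<Phi>)"

definition functional :: "('a \<Rightarrow> real) \<Rightarrow> ('a \<Rightarrow> real) \<times> ('a \<Rightarrow> 'c) \<Rightarrow> real" where
  "functional F z = energy (snd z) + dual F (fst z)"

lemma functional_tendsto:
  assumes F: "F \<in> Lq" and lim: "limit_of Us As U A"
  shows "(\<lambda>k. functional F (Us k, As k)) \<longlonglongrightarrow> functional F (U, A)"
  unfolding functional_def fst_conv snd_conv
proof (intro tendsto_add energy_tendsto dual_tendsto)
  have "(Us k, As k) \<in> X" for k using lim by (simp add: limit_of_def)
  then show "As k \<in> Vq" "Us k \<in> Vq" for k using X_fst X_snd Vq_real by blast+
qed (use lim F in \<open>auto simp: limit_of_def Vq_real vnorm_real\<close>)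

lemma limit_of_perturb:
  assumes lim: "limit_of Us As U A" and B: "(\<Phi>, B) \<in> X"
  shows "limit_of (\<lambda>k x. Us k x + c *\<^sub>R \<Phi> x) (\<lambda>k x. As k x + c *\<^sub>R B x)
    (\<lambda>x. U x + c *\<^sub>R \<Phi> x) (\<lambda>x. A x + c *\<^sub>R B x)"
  using lim X_scale[OF B, of c] X_fst[OF X_scale[OF B, of c]] X_snd[OF X_scale[OF B, of c]]
  unfolding limit_of_def by (auto intro!: Lq_add Vq_add X_add)

text \<open>The subgradient inequality at the perturbed field \<open>?Z\<close>, evaluated at
  \<open>A\<close>, combined with minimality gives
  \<open>0 \<le> t * (dual ?Z B + dual F \<Phi>)\<close>. Divide by \<open>t\<close>, let it tend to
  0, and repeat with the opposite direction.\<close>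

lemma minimizer_solves:
  assumes F: "F \<in> Lq" and lim: "limit_of Us As U A"
    and min: "\<And>z. z \<in> X \<Longrightarrow> m \<le> functional F z" and m: "functional F (U, A) \<le> m"
  shows "solves F A"
proof -
  have U: "U \<in> Lq" and A: "A \<in> Vq" using lim by (auto simp: limit_of_def)
  have ge: "0 \<le> dual A B + dual F \<Phi>" if B: "(\<Phi>, B) \<in> X" for \<Phi> B
  proof -
    note BV = X_snd[OF B] and \<Phi>L = X_fst[OF B]
    have "0 \<le> dual (\<lambda>x. A x + (1 / Suc k) *\<^sub>R B x) B + dual F \<Phi>" for k
    proof -
      define t where "t = 1 / real (Suc k)"
      have t: "0 < t" by (simp add: t_def)
      let ?Z = "\<lambda>x. A x + t *\<^sub>R B x"
      have Z: "?Z \<in> Vq" by (intro Vq_add Vq_scaleR A BV)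
      \<comment> \<open>The perturbed pair need not lie in \<open>X\<close>, but it is a limit of
        pairs that do, so the lower bound \<open>m\<close> reaches it by continuity of the
        functional.\<close>
      have "m \<le> functional F (\<lambda>x. U x + t *\<^sub>R \<Phi> x, ?Z)"
      proof (rule LIMSEQ_le_const[OF functional_tendsto[OF F limit_of_perturb[OF lim B]]])
        show "\<exists>N. \<forall>n\<ge>N. m \<le> functional F (\<lambda>x. Us n x + t *\<^sub>R \<Phi> x, \<lambda>x. As n x + t *\<^sub>R B x)"
          using lim X_scale[OF B, of t] unfolding limit_of_def by (intro exI allI impI min X_add) auto
      qed
      also have "\<dots> = energy ?Z + (dual F U + t * dual F \<Phi>)"
        using dual_add[of F U "\<lambda>x. t *\<^sub>R \<Phi> x"] dual_scaleR[of F t \<Phi>] F U \<Phi>L Lq_cmult[OF \<Phi>L, of t]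
        by (simp add: functional_def Vq_real)
      finally have "energy A + dual F U \<le> energy ?Z + (dual F U + t * dual F \<Phi>)"
        using m by (simp add: functional_def)
      moreover have "dual ?Z (\<lambda>x. A x - ?Z x) = - t * dual ?Z B"
        using dual_scaleR[of ?Z "- t" B] by simp
      ultimately have "0 \<le> t * (dual ?Z B + dual F \<Phi>)"
        using energy_subgradient[OF A Z] by (simp add: distrib_left)
      then have "0 \<le> dual ?Z B + dual F \<Phi>" using t by (simp only: zero_le_mult_iff) linarith
      then show ?thesis by (simp only: t_def)
    qed
    moreover have "(\<lambda>k. dual (\<lambda>x. A x + (1 / Suc k) *\<^sub>R B x) B + dual F \<Phi>) \<longlonglongrightarrow> dual A B + dual F \<Phi>"
      by (intro tendsto_intros dual_perturb_tendsto A BV)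
    ultimately show ?thesis by (intro LIMSEQ_le_const) auto
  qed
  show ?thesis unfolding solves_def
  proof safe
    fix \<Phi> B assume B: "(\<Phi>, B) \<in> X"
    have "dual A B + dual F \<Phi> \<le> 0"
      using ge[OF X_scale[OF B, of "- 1"]] dual_scaleR[of A "- 1" B] dual_scaleR[of F "- 1" \<Phi>] by simp
    then show "dual A B = - dual F \<Phi>" using ge[OF B] by simp
  qed
qed

lemma superlinear:
  fixes K :: real
  assumes "0 \<le> K"
  shows "\<exists>D. \<forall>G\<ge>0. K * G - D \<le> G powr a / b"
proof -
  have b: "0 < b" using a_gt_1 a_le_b by simp
  \<comment> \<open>The threshold where \<open>G powr (a - 1)\<close> equals \<open>b * K\<close>:
    above it the power dominates \<open>K * G\<close>, below it \<open>K * G\<close> is at most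
    \<open>K * G0\<close>.\<close>
  define G0 where "G0 = (b * K) powr (1 / (a - 1))"
  have "K * G - K * G0 \<le> G powr a / b" if G: "0 \<le> G" for G
  proof (cases "G \<le> G0")
    case True
    then have "K * G \<le> K * G0" using assms by (rule mult_left_mono)
    moreover have "0 \<le> G powr a / b" using b by simp
    ultimately show ?thesis by linarith
  next
    case False
    have G0: "0 \<le> G0" by (simp add: G0_def)
    have "b * K = G0 powr (a - 1)" using assms b a_gt_1 by (simp add: G0_def powr_powr)
    also have "\<dots> \<le> G powr (a - 1)" using False G0 a_gt_1 by (intro powr_mono2) auto
    finally have "b * K * G \<le> G powr (a - 1) * G" using G by (rule mult_right_mono)
    also have "\<dots> = G powr a" using G powr_mult_base[of G "a - 1"] by (simp add: mult.commute)
    finally have "K * G \<le> G powr a / b" using b by (simp add: field_simps)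
    moreover have "0 \<le> K * G0" using assms G0 by simp
    ultimately show ?thesis by linarith
  qed
  then show ?thesis by blast
qed

text \<open>By the Poincare inequality the data term is at most \<open>K\<close> times the gradient
  norm, and the energy grows with a power \<open>a > 1\<close>. Superlinearity is applied with
  \<open>K + 1\<close> so that one copy of the gradient norm is left over.\<close>

lemma functional_coercive:
  assumes F: "F \<in> Lq" and C0: "0 < C0" and poincare: "\<And>U A. (U, A) \<in> X \<Longrightarrow> rnorm U \<le> C0 * vnorm A"
  shows "\<exists>D. \<forall>z\<in>X. vnorm (snd z) - D \<le> functional F z"
proof -
  have b: "0 < b" using a_gt_1 a_le_b by simp
  define K where "K = C0 * (rmod F + 1)"
  have K: "0 \<le> K" using C0 by (simp add: K_def)
  obtain D where D: "\<And>G. 0 \<le> G \<Longrightarrow> (K + 1) * G - D \<le> G powr a / b"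
    using superlinear[of "K + 1"] K by auto
  have "vnorm A - (D + 1 / b) \<le> functional F (U, A)" if UA: "(U, A) \<in> X" for U A
  proof -
    have AV: "A \<in> Vq" and UL: "U \<in> Lq" using UA X_fst X_snd by auto
    have "vnorm A powr a - 1 \<le> vmod A"
    proof (cases "1 \<le> vnorm A")
      case True
      then show ?thesis using powr_rnorm_le_rmod(1)[OF Vq_norm[OF AV]] by (simp add: vnorm_def vmod_def)
    next
      case False
      then have "vnorm A powr a \<le> 1 powr a" using a_gt_1 by (intro powr_mono2) auto
      then show ?thesis using vmod_nonneg[of A] unfolding powr_one_eq_one by linarith
    qed
    also have "\<dots> \<le> b * energy A" by (rule vmod_le_energy[OF AV])
    finally have "vnorm A powr a / b - 1 / b \<le> energy A" using b by (simp add: field_simps)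
    moreover have "- (K * vnorm A) \<le> dual F U"
    proof -
      have "\<bar>dual F U\<bar> \<le> rnorm U * (rmod F + 1)"
        using dual_bound_vnorm[of F U] F UL rnorm_cong[of "\<lambda>x. norm (U x)" U]
        by (simp add: Vq_real vnorm_real vmod_def rmod_def)
      also have "\<dots> \<le> (C0 * vnorm A) * (rmod F + 1)"
        using poincare[OF UA] by (intro mult_right_mono) auto
      finally show ?thesis by (simp add: K_def mult_ac abs_le_iff)
    qed
    ultimately show ?thesis using D[of "vnorm A"] by (simp add: functional_def algebra_simps)
  qed
  then show ?thesis by (intro exI[of _ "D + 1 / b"]) auto
qed

text \<open>The midpoint of two pairs is again in \<open>X\<close>, so its functional is at least
  \<open>m\<close>. The data term is linear and cancels, hence the convexity defect of the energy is
  at most the mean of the two errors.\<close>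

lemma minimizing_Cauchy:
  assumes F: "F \<in> Lq" and coercive: "\<And>z. z \<in> X \<Longrightarrow> vnorm (snd z) - D \<le> functional F z"
    and w: "\<And>k. (Us k, As k) \<in> X" and lower: "\<And>z. z \<in> X \<Longrightarrow> m \<le> functional F z"
    and upper: "\<And>k. functional F (Us k, As k) \<le> m + 1 / Suc k" and e: "0 < e"
  shows "\<exists>N. \<forall>j\<ge>N. \<forall>k\<ge>N. vmod (\<lambda>x. As j x - As k x) \<le> e"
proof -
  have AV: "As k \<in> Vq" and UL: "Us k \<in> Lq" for k using w X_fst X_snd by blast+
  \<comment> \<open>Coercivity at functional values up to \<open>m + 1\<close> bounds the gradient
    norms; the maximum with 1 is what \<open>rmod_le_powr\<close> asks for.\<close>
  define c where "c = max 1 (m + 1 + D)"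
  define R where "R = c powr b"
  have R: "vmod (As k) \<le> R" for k
  proof -
    have "1 / real (Suc k) \<le> 1" by simp
    then have "vnorm (As k) \<le> c" using coercive[OF w, of k] upper[of k] unfolding c_def snd_conv by linarith
    then show ?thesis
      unfolding vmod_def R_def by (intro rmod_le_powr Vq_norm AV) (auto simp: vnorm_def c_def)
  qed
  have R0: "0 \<le> R" by (simp add: R_def)
  \<comment> \<open>Chosen so that \<open>\<eta>\<close> times the bound \<open>2 * (R + 1)\<close>
    for the two modulars is \<open>e / 2\<close>; the other half comes from the defect term once
    \<open>N\<close> is large.\<close>
  define \<eta> where "\<eta> = e / (4 * (R + 1))"
  have \<eta>: "0 < \<eta>" using e R0 by (simp add: \<eta>_def)
  obtain K where K: "0 < K" "\<And>A B :: 'a \<Rightarrow> 'c. A \<in> Vq \<Longrightarrow> B \<in> Vq \<Longrightarrow> vmod (\<lambda>x. A x - B x)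
      \<le> \<eta> * (vmod A + vmod B) + K * ((energy A + energy B) / 2 - energy (\<lambda>x. (1/2) *\<^sub>R (A x + B x)))"
    using energy_uniformly_convex[OF \<eta>, where 'c = 'c] by blast
  obtain N :: nat where N: "2 * K / e < N" using reals_Archimedean2 by blast
  have KN: "K * (1 / Suc N) \<le> e / 2"
  proof -
    have "2 * K < e * N" using N e by (simp add: field_simps)
    then have "2 * K \<le> e * Suc N" using e by (simp add: algebra_simps)
    then show ?thesis by (simp add: field_simps)
  qed
  have "vmod (\<lambda>x. As j x - As k x) \<le> e" if jk: "N \<le> j" "N \<le> k" for j k
  proof -
    have inX: "(\<lambda>x. (1/2) *\<^sub>R (Us j x + Us k x), \<lambda>x. (1/2) *\<^sub>R (As j x + As k x)) \<in> X"
      by (intro X_scale X_add w)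
    have d: "dual F (\<lambda>x. (1/2) *\<^sub>R (Us j x + Us k x)) = (dual F (Us j) + dual F (Us k)) / 2"
      using dual_scaleR[of F "1/2" "\<lambda>x. Us j x + Us k x"] dual_add[of F "Us j" "Us k"] F UL
      by (simp add: Vq_real)
    have "(energy (As j) + energy (As k)) / 2 - energy (\<lambda>x. (1/2) *\<^sub>R (As j x + As k x))
        \<le> (1 / Suc j + 1 / Suc k) / 2"
      using lower[OF inX] upper[of j] upper[of k] unfolding functional_def fst_conv snd_conv d by argo
    also have "\<dots> \<le> (1 / Suc N + 1 / Suc N) / 2"
      using jk by (intro divide_right_mono add_mono divide_left_mono) auto
    also have "\<dots> = 1 / Suc N" by (simp only: add_divide_distrib field_sum_of_halves)
    finally have "K * ((energy (As j) + energy (As k)) / 2 - energy (\<lambda>x. (1/2) *\<^sub>R (As j x + As k x)))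
        \<le> K * (1 / Suc N)" using K by (intro mult_left_mono) auto
    moreover have "\<eta> * (vmod (As j) + vmod (As k)) \<le> \<eta> * (2 * (R + 1))"
      using R[of j] R[of k] \<eta> by (intro mult_left_mono) auto
    moreover have "\<eta> * (2 * (R + 1)) = e / 2" using R0 unfolding \<eta>_def by (simp add: divide_simps)
    ultimately show ?thesis using K(2)[OF AV AV, of j k] KN by linarith
  qed
  then show ?thesis by blast
qed

theorem exists_solution:
  assumes F: "F \<in> Lq" and C0: "0 < C0" and poincare: "\<And>U A. (U, A) \<in> X \<Longrightarrow> rnorm U \<le> C0 * vnorm A"
  obtains Us As U A where "limit_of Us As U A" "solves F A"
    "AE x in M. (\<lambda>k. Us k x) \<longlonglongrightarrow> U x" "AE x in M. (\<lambda>k. As k x) \<longlonglongrightarrow> A x"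
proof -
  obtain D where D: "\<And>z. z \<in> X \<Longrightarrow> vnorm (snd z) - D \<le> functional F z"
    using functional_coercive[OF F C0 poincare] by blast
  define m where "m = (INF z\<in>X. functional F z)"
  have bdd: "bdd_below (functional F ` X)"
    using D order_trans[of "- D" "vnorm (snd _) - D"] by (intro bdd_belowI[of _ "- D"]) (force intro: order_trans[OF _ D])
  have lower: "m \<le> functional F z" if "z \<in> X" for z
    unfolding m_def using bdd that by (rule cINF_lower)
  have "\<exists>z\<in>X. functional F z < m + 1 / Suc k" for k
    using bdd X_zero unfolding m_def by (subst cINF_less_iff[symmetric]) (auto simp: m_def[symmetric])
  then obtain w where w: "\<And>k. w k \<in> X" "\<And>k. functional F (w k) \<le> m + 1 / Suc k"
    by (meson less_imp_le)
  define Us As where "Us k = fst (w k)" and "As k = snd (w k)" for k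
  have X: "(Us k, As k) \<in> X" for k using w by (simp add: Us_def As_def)
  have upper: "functional F (Us k, As k) \<le> m + 1 / Suc k" for k using w by (simp add: Us_def As_def)
  have AV: "As k \<in> Vq" and UL: "Us k \<in> Lq" for k using X X_fst X_snd by blast+
  obtain A r1 where A: "A \<in> Vq" "strict_mono (r1 :: nat \<Rightarrow> nat)"
      "AE x in M. (\<lambda>k. As (r1 k) x) \<longlonglongrightarrow> A x" "(\<lambda>k. vnorm (\<lambda>x. As k x - A x)) \<longlonglongrightarrow> 0"
    using Vq_complete[OF AV minimizing_Cauchy[OF F D X lower upper]] by blast
  \<comment> \<open>Minimality says nothing direct about \<open>Us\<close>; its Cauchy property is
    inherited from the gradients by the Poincare inequality for differences, which lie in
    \<open>X\<close>.\<close>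
  have "\<exists>N. \<forall>j\<ge>N. \<forall>k\<ge>N. vmod (\<lambda>x. Us (r1 j) x - Us (r1 k) x) \<le> e" if e: "0 < e" for e
  proof -
    define c where "c = min 1 e"
    have c: "0 < c" "c \<le> 1" "c \<le> e" using e by (auto simp: c_def)
    have "\<forall>\<^sub>F k in sequentially. vnorm (\<lambda>x. As k x - A x) < c / (2 * C0)"
      using A(4) c C0 by (intro order_tendstoD) auto
    then obtain N where N: "\<And>k. N \<le> k \<Longrightarrow> vnorm (\<lambda>x. As k x - A x) < c / (2 * C0)"
      by (auto simp: eventually_sequentially)
    have "vmod (\<lambda>x. Us (r1 j) x - Us (r1 k) x) \<le> e" if "N \<le> j" "N \<le> k" for j k
    proof -
      have r: "N \<le> r1 j" "N \<le> r1 k" using that seq_suble[OF A(2)] order_trans by blast+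
      have "vnorm (\<lambda>x. As (r1 j) x - As (r1 k) x) = vnorm (\<lambda>x. (As (r1 j) x - A x) + (A x - As (r1 k) x))"
        by simp
      also have "\<dots> \<le> vnorm (\<lambda>x. As (r1 j) x - A x) + vnorm (\<lambda>x. A x - As (r1 k) x)"
        by (intro vnorm_triangle Vq_diff AV A)
      also have "\<dots> \<le> c / (2 * C0) + c / (2 * C0)"
        using N[OF r(1)] N[OF r(2)] vnorm_minus_commute[of A "As (r1 k)"] by simp
      also have "\<dots> = c / C0" by simp
      finally have v: "vnorm (\<lambda>x. As (r1 j) x - As (r1 k) x) \<le> c / C0" .
      have "(\<lambda>x. Us (r1 j) x - Us (r1 k) x, \<lambda>x. As (r1 j) x - As (r1 k) x) \<in> X"
        using X_add[OF X X_scale[OF X, of "- 1"], of "r1 j" "r1 k"] by simp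
      from poincare[OF this] have "rnorm (\<lambda>x. Us (r1 j) x - Us (r1 k) x) \<le> C0 * vnorm (\<lambda>x. As (r1 j) x - As (r1 k) x)" .
      also have "\<dots> \<le> C0 * (c / C0)" using v C0 by (intro mult_left_mono) auto
      finally have "rnorm (\<lambda>x. Us (r1 j) x - Us (r1 k) x) \<le> c" using C0 by simp
      then have "rmod (\<lambda>x. Us (r1 j) x - Us (r1 k) x) \<le> c" using c by (intro rmod_le_small Lq_diff UL)
      then show ?thesis using c by (simp add: vmod_def rmod_def)
    qed
    then show ?thesis by blast
  qed
  moreover have "Us (r1 k) \<in> Vq" for k using UL by (simp add: Vq_real)
  ultimately obtain U r2 where U: "U \<in> Vq" "strict_mono (r2 :: nat \<Rightarrow> nat)"
      "AE x in M. (\<lambda>k. Us (r1 (r2 k)) x) \<longlonglongrightarrow> U x" "(\<lambda>k. vnorm (\<lambda>x. Us (r1 k) x - U x)) \<longlonglongrightarrow> 0"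
    using Vq_complete[of "\<lambda>k. Us (r1 k)"] by blast
  define r where "r = r1 \<circ> r2"
  have r: "strict_mono r" unfolding r_def using A(2) U(2) by (rule strict_mono_o)
  have lim: "limit_of (\<lambda>k. Us (r k)) (\<lambda>k. As (r k)) U A"
    unfolding limit_of_def
  proof (intro conjI allI X A(1))
    show "U \<in> Lq" using U(1) by (simp add: Vq_real)
    show "(\<lambda>k. rnorm (\<lambda>x. Us (r k) x - U x)) \<longlonglongrightarrow> 0"
      using LIMSEQ_subseq_LIMSEQ[OF U(4) U(2)] by (simp add: r_def o_def vnorm_real)
    show "(\<lambda>k. vnorm (\<lambda>x. As (r k) x - A x)) \<longlonglongrightarrow> 0"
      using LIMSEQ_subseq_LIMSEQ[OF A(4) r] by (simp add: o_def)
  qed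
  have "(\<lambda>k. m + 1 / Suc (r k)) \<longlonglongrightarrow> m + 0"
    using LIMSEQ_subseq_LIMSEQ[OF LIMSEQ_Suc[OF lim_1_over_n] r] by (intro tendsto_intros) (simp add: o_def)
  then have "functional F (U, A) \<le> m"
    using LIMSEQ_le[OF functional_tendsto[OF F lim]] upper by auto
  then have "solves F A" by (intro minimizer_solves[OF F lim lower])
  moreover have "AE x in M. (\<lambda>k. Us (r k) x) \<longlonglongrightarrow> U x" using U(3) by (simp add: r_def)
  moreover have "AE x in M. (\<lambda>k. As (r k) x) \<longlonglongrightarrow> A x"
    using A(3)
  proof eventually_elim
    case (elim x)
    from LIMSEQ_subseq_LIMSEQ[OF this U(2)] show ?case by (simp add: r_def o_def)
  qed
  ultimately show thesis using that lim by blast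
qed

text \<open>Testing the equation with the solution itself is not immediate, since it lies only in
  the closure of \<open>X\<close>; the equation is tested with the approximants and both pairings
  pass to the limit.\<close>

lemma vmod_solution:
  assumes F: "F \<in> Lq" and lim: "limit_of Us As U A" and sol: "solves F A"
  shows "vmod A = - dual F U"
proof -
  have UA: "U \<in> Lq" "A \<in> Vq" using lim by (auto simp: limit_of_def)
  have X: "(Us k, As k) \<in> X" for k using lim by (simp add: limit_of_def)
  have "(\<lambda>k. dual A (As k)) \<longlonglongrightarrow> dual A A"
    using lim X X_snd UA by (intro dual_tendsto) (auto simp: limit_of_def)
  moreover have "(\<lambda>k. - dual F (Us k)) \<longlonglongrightarrow> - dual F U"
    using lim X X_fst F UA by (intro tendsto_minus dual_tendsto) (auto simp: limit_of_def Vq_real vnorm_real)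
  moreover have "dual A (As k) = - dual F (Us k)" for k using sol X[of k] by (auto simp: solves_def)
  ultimately show ?thesis using LIMSEQ_unique dual_self[of A] by fastforce
qed

end

subsection \<open>Estimates for solutions\<close>

context linear_pairs
begin

lemma dual_bound_rnorm:
  assumes "F \<in> Lq" "U \<in> Lq"
  shows "\<bar>dual F U\<bar> \<le> rnorm U * (rmod F + 1)"
  using dual_bound_vnorm[of F U] assms by (simp add: Vq_real vnorm_real vmod_def rmod_def)

text \<open>Pulling \<open>c\<close> out of \<open>F\<close> costs at most
  \<open>c powr (b - 1)\<close> or \<open>c powr (a - 1)\<close>, depending on whether
  \<open>c \<ge> 1\<close>, as in \<open>r_star\<close>. What remains has modular at most 1, which
  gives the factor 2. Allowing any \<open>c\<close> above the norm covers data of norm 0.\<close>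

lemma dual_bound_scaled:
  fixes F U :: "'a \<Rightarrow> real"
  assumes F: "F \<in> Lq" and U: "U \<in> Lq" and c: "rnorm F \<le> c" "0 < c"
  shows "\<bar>dual F U\<bar> \<le> 2 * c powr ((if 1 \<le> c then b else a) - 1) * rnorm U"
proof -
  let ?r = "if 1 \<le> c then b else a"
  let ?k = "\<lambda>x. F x / c"
  have k: "?k \<in> Lq" by (rule Lq_divide[OF F])
  have mk: "rmod ?k \<le> 1" using rnorm_le_iff[OF F c(2)] c by simp
  have *: "\<bar>dual F U\<bar> \<le> c powr (?r - 1) * (\<mu> * (rmod ?k + 1))" if \<mu>: "rnorm U \<le> \<mu>" "0 < \<mu>" for \<mu>
  proof -
    have "\<bar>dual F U\<bar> \<le> (\<integral>x. c powr (?r - 1) * (\<bar>?k x\<bar> powr (q x - 1) * \<bar>U x\<bar>) \<partial>M)"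
      unfolding dual_def
    proof (intro order_trans[OF integral_abs_bound] integral_mono integrable_abs integrable_mult_right
        holder(1)[OF k U \<mu>] dual_integrable)
      fix x assume x: "x \<in> space M"
      have "\<bar>norm (F x) powr (q x - 2) * (U x \<bullet> F x)\<bar> \<le> \<bar>F x\<bar> powr (q x - 1) * \<bar>U x\<bar>"
        using powr_inner_le[of "F x" "q x" "U x"] by simp
      also have "\<bar>F x\<bar> = c * \<bar>?k x\<bar>" using c by simp
      also have "(c * \<bar>?k x\<bar>) powr (q x - 1) = c powr (q x - 1) * \<bar>?k x\<bar> powr (q x - 1)"
        by (rule powr_mult)
      also have "\<dots> * \<bar>U x\<bar> \<le> (c powr (?r - 1) * \<bar>?k x\<bar> powr (q x - 1)) * \<bar>U x\<bar>"
      proof (intro mult_right_mono)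
        show "c powr (q x - 1) \<le> c powr (?r - 1)"
        proof (cases "1 \<le> c")
          case True
          then show ?thesis using q_le_b[OF x] by (simp add: powr_mono)
        next
          case False
          then show ?thesis using c a_le_q[OF x] by (simp add: powr_mono')
        qed
      qed auto
      finally show "\<bar>norm (F x) powr (q x - 2) * (U x \<bullet> F x)\<bar>
          \<le> c powr (?r - 1) * (\<bar>?k x\<bar> powr (q x - 1) * \<bar>U x\<bar>)" by (simp only: mult.assoc)
    qed (use F U Vq_real in auto)
    also have "\<dots> = c powr (?r - 1) * (\<integral>x. \<bar>?k x\<bar> powr (q x - 1) * \<bar>U x\<bar> \<partial>M)"
      by (rule integral_mult_right_zero)
    also have "\<dots> \<le> c powr (?r - 1) * (\<mu> * (rmod ?k + 1))"
      by (intro mult_left_mono holder(2)[OF k U \<mu>]) simp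
    finally show ?thesis .
  qed
  show ?thesis
  proof (rule field_le_epsilon)
    fix e :: real assume e: "0 < e"
    define d where "d = e / (2 * c powr (?r - 1))"
    have d: "0 < d" using e c unfolding d_def by (intro divide_pos_pos) auto
    have "\<bar>dual F U\<bar> \<le> c powr (?r - 1) * ((rnorm U + d) * (rmod ?k + 1))"
      using d by (intro *) (auto simp: add_nonneg_pos)
    also have "\<dots> \<le> c powr (?r - 1) * ((rnorm U + d) * 2)"
      using mk d by (intro mult_left_mono) auto
    also have "\<dots> = 2 * c powr (?r - 1) * rnorm U + 2 * c powr (?r - 1) * d" by (simp add: algebra_simps)
    also have "2 * c powr (?r - 1) * d = e" unfolding d_def using c by (simp del: if_split)
    finally show "\<bar>dual F U\<bar> \<le> 2 * c powr (?r - 1) * rnorm U + e" .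
  qed
qed

lemma poincare_limit:
  assumes lim: "limit_of Us As U A" and C0: "0 < C0"
    and poincare: "\<And>U A. (U, A) \<in> X \<Longrightarrow> rnorm U \<le> C0 * vnorm A"
  shows "rnorm U \<le> C0 * vnorm A"
proof (rule LIMSEQ_le_const)
  have UA: "U \<in> Lq" "A \<in> Vq" and X: "(Us k, As k) \<in> X" for k using lim by (auto simp: limit_of_def)
  have "(\<lambda>k. rnorm (\<lambda>x. Us k x - U x) + C0 * (vnorm (\<lambda>x. As k x - A x) + vnorm A)) \<longlonglongrightarrow> 0 + C0 * (0 + vnorm A)"
    using lim by (intro tendsto_intros) (auto simp: limit_of_def)
  then show "(\<lambda>k. rnorm (\<lambda>x. Us k x - U x) + C0 * (vnorm (\<lambda>x. As k x - A x) + vnorm A)) \<longlonglongrightarrow> C0 * vnorm A"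
    by simp
  have "rnorm U \<le> rnorm (\<lambda>x. Us k x - U x) + C0 * (vnorm (\<lambda>x. As k x - A x) + vnorm A)" for k
  proof -
    have "rnorm U \<le> rnorm (\<lambda>x. Us k x - U x) + rnorm (Us k)"
      using vnorm_triangle_diff[of U "Us k"] UA X_fst[OF X] vnorm_minus_commute[of U "Us k"]
      by (simp add: Vq_real vnorm_real)
    also have "rnorm (Us k) \<le> C0 * vnorm (As k)" by (rule poincare[OF X])
    also have "\<dots> \<le> C0 * (vnorm (\<lambda>x. As k x - A x) + vnorm A)"
      using vnorm_triangle_diff[OF X_snd[OF X] UA(2)] C0 by (intro mult_left_mono) auto
    finally show ?thesis by simp
  qed
  then show "\<exists>N. \<forall>k\<ge>N. rnorm U \<le> rnorm (\<lambda>x. Us k x - U x) + C0 * (vnorm (\<lambda>x. As k x - A x) + vnorm A)" by blast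
qed

text \<open>The chain is \<open>vnorm A powr s \<le> vmod A = - dual F U\<close>, which is at most
  \<open>2 * rnorm F powr (r - 1) * rnorm U\<close>. Insert the Poincare inequality, cancel one
  factor \<open>vnorm A\<close>, take the root of order \<open>s - 1\<close>, and apply Poincare
  once more.\<close>

theorem solution_estimate:
  assumes F: "F \<in> Lq" and lim: "limit_of Us As U A" and sol: "solves F A" and C0: "0 < C0"
    and poincare: "\<And>U A. (U, A) \<in> X \<Longrightarrow> rnorm U \<le> C0 * vnorm A"
  defines "r \<equiv> if 1 \<le> rnorm F then b else a" and "s \<equiv> if vnorm A < 1 then b else a"
  shows "rnorm U \<le> C0 * (2 * C0) powr (1 / (s - 1)) * rnorm F powr ((r - 1) / (s - 1))"
proof -
  have UA: "U \<in> Lq" "A \<in> Vq" using lim by (auto simp: limit_of_def)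
  have P: "rnorm U \<le> C0 * vnorm A" by (rule poincare_limit[OF lim C0 poincare])
  show ?thesis
  proof (cases "vnorm A = 0")
    case True
    then have "rnorm U \<le> 0" using P by simp
    also have "0 \<le> C0 * (2 * C0) powr (1 / (s - 1)) * rnorm F powr ((r - 1) / (s - 1))" using C0 by simp
    finally show ?thesis .
  next
    case False
    then have G: "0 < vnorm A" using vnorm_nonneg[of A] by linarith
    have s: "1 < s" using a_gt_1 a_le_b by (simp add: s_def)
    have "vnorm A powr s \<le> vmod A"
      using powr_rnorm_le_rmod[OF Vq_norm[OF UA(2)]] by (simp add: s_def vnorm_def vmod_def)
    then have low: "vnorm A powr s \<le> \<bar>dual F U\<bar>"
      using vmod_solution[OF F lim sol] by simp
    \<comment> \<open>If the data had norm 0, letting the bound in \<open>dual_bound_scaled\<close>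
      tend to 0 would make the pairing vanish, contradicting a nonzero gradient.\<close>
    have t: "0 < rnorm F"
    proof (rule ccontr)
      assume "\<not> 0 < rnorm F"
      then have t0: "rnorm F = 0" using rnorm_nonneg[of F] by linarith
      have "(\<lambda>k. 2 * (1 / Suc (Suc k)) powr (a - 1) * rnorm U) \<longlonglongrightarrow> 2 * 0 powr (a - 1) * rnorm U"
        using a_gt_1 by (intro tendsto_intros tendsto_powr' LIMSEQ_Suc[OF LIMSEQ_Suc[OF lim_1_over_n]]) auto
      moreover have "\<bar>dual F U\<bar> \<le> 2 * (1 / Suc (Suc k)) powr (a - 1) * rnorm U" for k
        using dual_bound_scaled[OF F UA(1), of "1 / Suc (Suc k)"] t0 by simp
      ultimately have "\<bar>dual F U\<bar> \<le> 2 * 0 powr (a - 1) * rnorm U" by (intro LIMSEQ_le_const) auto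
      then have "vnorm A powr s \<le> 0" using low by simp
      then show False using G by simp
    qed
    have "vnorm A powr (s - 1) * vnorm A = vnorm A powr s"
      using G powr_mult_base[of "vnorm A" "s - 1"] by (simp add: mult.commute)
    also have "\<dots> \<le> 2 * rnorm F powr (r - 1) * rnorm U"
      using low dual_bound_scaled[OF F UA(1) order_refl t] by (simp add: r_def)
    also have "\<dots> \<le> 2 * rnorm F powr (r - 1) * (C0 * vnorm A)" using P by (intro mult_left_mono) auto
    also have "\<dots> = (2 * C0 * rnorm F powr (r - 1)) * vnorm A" by simp
    finally have "vnorm A powr (s - 1) \<le> 2 * C0 * rnorm F powr (r - 1)" using G by simp
    then have "(vnorm A powr (s - 1)) powr (1 / (s - 1)) \<le> (2 * C0 * rnorm F powr (r - 1)) powr (1 / (s - 1))"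
      using s by (intro powr_mono2) auto
    then have "vnorm A \<le> (2 * C0) powr (1 / (s - 1)) * rnorm F powr ((r - 1) / (s - 1))"
      using s C0 G by (simp add: powr_powr powr_mult)
    then have "C0 * vnorm A \<le> C0 * ((2 * C0) powr (1 / (s - 1)) * rnorm F powr ((r - 1) / (s - 1)))"
      using C0 by (intro mult_left_mono) auto
    then show ?thesis using P by (simp only: mult.assoc)
  qed
qed

text \<open>For data of norm 1 the modular is 1 as well, so testing with the data gives
  \<open>1 = - dual A B\<close>. The pairing is bounded by \<open>vnorm B * (vmod A + 1)\<close>,
  and \<open>vmod A \<le> 2 * C1\<close> follows from the assumed estimate and the energy
  identity.\<close>

theorem poincare_from_estimate:
  assumes X: "(\<Phi>, B) \<in> X" and lim: "limit_of Us As U A" and sol: "solves \<Phi> A"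
    and 1: "rnorm \<Phi> = 1" and C1: "rnorm U \<le> C1"
  shows "1 \<le> (2 * C1 + 1) * vnorm B"
proof -
  have UA: "U \<in> Lq" "A \<in> Vq" using lim by (auto simp: limit_of_def)
  have \<Phi>: "\<Phi> \<in> Lq" "B \<in> Vq" using X X_fst X_snd by auto
  have m: "rmod \<Phi> = 1" by (rule rmod_eq_1[OF \<Phi>(1) 1])
  have "vmod A \<le> rnorm U * (rmod \<Phi> + 1)"
    using vmod_solution[OF \<Phi>(1) lim sol] dual_bound_rnorm[OF \<Phi>(1) UA(1)] by linarith
  also have "\<dots> \<le> 2 * C1" using C1 m by simp
  finally have A: "vmod A \<le> 2 * C1" .
  have "1 = dual \<Phi> \<Phi>" using m by (simp add: dual_self vmod_def rmod_def)
  also have "\<dots> = - dual A B" using sol X by (auto simp: solves_def)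
  also have "\<dots> \<le> vnorm B * (vmod A + 1)" using dual_bound_vnorm[OF UA(2) \<Phi>(2)] by linarith
  also have "\<dots> \<le> vnorm B * (2 * C1 + 1)" using A by (intro mult_left_mono) auto
  finally show ?thesis by (simp add: mult.commute)
qed

end

subsection \<open>Square roots of positive semi-definite matrices\<close>

text \<open>A maximiser \<open>b\<close> of the quadratic form on the unit sphere of
  \<open>V\<close> is an eigenvector: the form \<open>l * (w \<bullet> w) - w \<bullet> f w\<close>
  is nonnegative on \<open>V\<close> and vanishes at \<open>b\<close>, so its first variation there
  is zero.\<close>

lemma self_adjoint_eigenvector:
  fixes f :: "'v::euclidean_space \<Rightarrow> 'v"
  assumes f: "linear f" and adj: "\<And>x y. f x \<bullet> y = x \<bullet> f y"
    and V: "subspace V" "f ` V \<subseteq> V" "V \<noteq> {0}"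
  obtains b l where "b \<in> V" "norm b = 1" "f b = l *\<^sub>R b"
proof -
  have cont: "continuous_on (V \<inter> sphere 0 1) (\<lambda>x. x \<bullet> f x)"
    using f by (intro continuous_intros linear_continuous_on linear_conv_bounded_linear[THEN iffD1])
  have "compact (V \<inter> sphere 0 1)"
    using V by (intro closed_Int_compact closed_subspace) auto
  moreover have "V \<inter> sphere 0 1 \<noteq> {}"
  proof -
    obtain x where x: "x \<in> V" "x \<noteq> 0" using V subspace_0 by blast
    then have "(1 / norm x) *\<^sub>R x \<in> V \<inter> sphere 0 1" using V by (simp add: subspace_scale)
    then show ?thesis by blast
  qed
  ultimately obtain b where b: "b \<in> V" "norm b = 1"
    and max: "\<And>x. x \<in> V \<Longrightarrow> norm x = 1 \<Longrightarrow> x \<bullet> f x \<le> b \<bullet> f b"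
    using continuous_attains_sup[OF _ _ cont] by fastforce
  define l where "l = b \<bullet> f b"
  have nonneg: "0 \<le> l * (w \<bullet> w) - w \<bullet> f w" if w: "w \<in> V" for w
  proof (cases "w = 0")
    case False
    have "(1 / norm w) *\<^sub>R w \<bullet> f ((1 / norm w) *\<^sub>R w) \<le> l"
      unfolding l_def using w False V by (intro max) (auto simp: subspace_scale)
    then have "(w \<bullet> f w) / (norm w)\<^sup>2 \<le> l"
      by (simp add: linear_scale[OF f] power2_eq_square)
    then show ?thesis using False by (simp add: power2_norm_eq_inner field_simps)
  qed (simp add: linear_0[OF f])
  \<comment> \<open>Moving from \<open>b\<close> along its own residual makes the linear term
    \<open>2 * t * (w \<bullet> w)\<close>, so negative \<open>t\<close> forces the residual to
    vanish.\<close>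
  define w where "w = l *\<^sub>R b - f b"
  have wV: "w \<in> V" unfolding w_def using V b by (intro subspace_diff subspace_scale) auto
  define d where "d = l * (w \<bullet> w) - w \<bullet> f w"
  have d: "0 \<le> d" unfolding d_def by (rule nonneg[OF wV])
  have quad: "0 \<le> 2 * t * (w \<bullet> w) + t\<^sup>2 * d" for t
  proof -
    have bb: "b \<bullet> b = 1" using b by (simp add: power2_norm_eq_inner[symmetric])
    have ww: "w \<bullet> w = l * (b \<bullet> w) - f b \<bullet> w" by (simp add: w_def inner_diff_left)
    have "0 \<le> l * ((b + t *\<^sub>R w) \<bullet> (b + t *\<^sub>R w)) - (b + t *\<^sub>R w) \<bullet> f (b + t *\<^sub>R w)"
      using V b wV by (intro nonneg subspace_add subspace_scale)
    also have "\<dots> = 2 * t * (l * (b \<bullet> w) - f b \<bullet> w) + t\<^sup>2 * d"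
      using adj[of b w] bb
      by (simp add: linear_add[OF f] linear_scale[OF f] inner_add_left inner_add_right d_def l_def
          inner_commute algebra_simps power2_eq_square)
    finally show ?thesis unfolding ww .
  qed
  define c where "c = w \<bullet> w"
  \<comment> \<open>A step of near-optimal size; \<open>d + 1\<close> instead of \<open>d\<close>
    keeps the denominator positive when \<open>d = 0\<close>.\<close>
  have "0 \<le> 2 * (- c / (d + 1)) * c + (- c / (d + 1))\<^sup>2 * d" using quad[of "- c / (d + 1)"] by (simp add: c_def)
  also have "\<dots> = - (c\<^sup>2 * (d + 2)) / (d + 1)\<^sup>2"
    using d by (simp add: divide_simps power2_eq_square) (simp add: algebra_simps)
  finally have "c\<^sup>2 * (d + 2) \<le> 0" using d by (simp add: field_simps zero_le_divide_iff)
  then have "c = 0" using d by (simp add: mult_le_0_iff)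
  then have "f b = l *\<^sub>R b" by (simp add: c_def w_def)
  then show thesis using that b by blast
qed

text \<open>Induction on the dimension: the orthogonal complement in \<open>V\<close> of one
  eigenvector is again invariant, because \<open>f\<close> is self-adjoint.\<close>

lemma self_adjoint_eigenbasis_subspace:
  fixes f :: "'v::euclidean_space \<Rightarrow> 'v"
  assumes f: "linear f" and adj: "\<And>x y. f x \<bullet> y = x \<bullet> f y"
  shows "subspace V \<Longrightarrow> f ` V \<subseteq> V \<Longrightarrow> \<exists>B\<subseteq>V. pairwise orthogonal B \<and>
    (\<forall>b\<in>B. norm b = 1 \<and> (\<exists>l. f b = l *\<^sub>R b)) \<and> span B = V"
proof (induction "dim V" arbitrary: V rule: less_induct)
  case less
  show ?case
  proof (cases "V = {0}")
    case True
    then show ?thesis by (intro exI[of _ "{}"]) auto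
  next
    case False
    obtain b l where b: "b \<in> V" "norm b = 1" "f b = l *\<^sub>R b"
      using self_adjoint_eigenvector[OF f adj less.prems False] by blast
    define W where "W = V \<inter> {w. b \<bullet> w = 0}"
    have W: "subspace W" unfolding W_def by (intro subspace_inter less.prems subspace_hyperplane)
    have fW: "f ` W \<subseteq> W"
    proof
      fix y assume "y \<in> f ` W"
      then obtain w where w: "y = f w" "w \<in> V" "b \<bullet> w = 0" by (auto simp: W_def)
      have "b \<bullet> f w = 0" using adj[of b w] b w by simp
      then show "y \<in> W" using w less.prems by (auto simp: W_def)
    qed
    have "b \<notin> W" using b by (auto simp: W_def power2_norm_eq_inner[symmetric])
    then have "W \<subset> V" using b(1) unfolding W_def by blast
    moreover have "span W = W" "span V = V" using W less.prems(1) by (simp_all add: span_eq_iff)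
    ultimately have "span W \<subset> span V" by (simp only:)
    then have "dim W < dim V" by (rule dim_psubset)
    from less.hyps[OF this W fW] obtain B where B: "B \<subseteq> W" "pairwise orthogonal B"
        "\<forall>b\<in>B. norm b = 1 \<and> (\<exists>l. f b = l *\<^sub>R b)" "span B = W" by blast
    have orth: "b \<bullet> w = 0" if "w \<in> W" for w using that by (simp add: W_def)
    have "V \<subseteq> span (insert b B)"
    proof
      fix x assume x: "x \<in> V"
      have "x - (b \<bullet> x) *\<^sub>R b \<in> W"
        using x b less.prems
        by (auto simp: W_def inner_diff_right power2_norm_eq_inner[symmetric] intro: subspace_diff subspace_scale)
      then show "x \<in> span (insert b B)" using B(4) by (auto simp: span_insert)
    qed
    moreover have "span (insert b B) \<subseteq> V"
      using b(1) B(1) less.prems(1) by (intro span_minimal) (auto simp: W_def)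
    moreover have "pairwise orthogonal (insert b B)"
      using B(1,2) orth by (auto simp: pairwise_insert orthogonal_def inner_commute)
    ultimately show ?thesis
      using b B(1,3) by (intro exI[of _ "insert b B"]) (auto simp: W_def)
  qed
qed

lemma symmetric_matrix_inner:
  fixes A :: "real^'n^'n"
  assumes "transpose A = A"
  shows "(A *v x) \<bullet> y = x \<bullet> (A *v y)"
  using dot_lmul_matrix[of x A y] transpose_matrix_vector[of A x] assms by simp

lemma psd_eigenbasis:
  fixes A :: "real^'n^'n"
  assumes A: "psd A"
  obtains B l where "finite B" "\<And>x. x = (\<Sum>b\<in>B. (x \<bullet> b) *\<^sub>R b)" "span B = UNIV"
    "\<And>b. b \<in> B \<Longrightarrow> norm b = 1" "pairwise orthogonal B"
    "\<And>b. b \<in> B \<Longrightarrow> A *v b = l b *\<^sub>R b" "\<And>b. b \<in> B \<Longrightarrow> 0 \<le> l b"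
proof -
  obtain B where B: "pairwise orthogonal B" "\<forall>b\<in>B. norm b = 1 \<and> (\<exists>l. A *v b = l *\<^sub>R b)" "span B = UNIV"
    using self_adjoint_eigenbasis_subspace[OF matrix_vector_mul_linear symmetric_matrix_inner subspace_UNIV, of A] A
    by (auto simp: psd_def)
  obtain l where l: "\<And>b. b \<in> B \<Longrightarrow> A *v b = l b *\<^sub>R b" using B(2) by metis
  have fin: "finite B" using B(1) by (rule pairwise_orthogonal_imp_finite)
  have "x = (\<Sum>b\<in>B. (x \<bullet> b) *\<^sub>R b)" for x
  proof -
    define y where "y = x - (\<Sum>b\<in>B. (x \<bullet> b) *\<^sub>R b)"
    have yB: "orthogonal y c" if c: "c \<in> B" for c
    proof -
      have "(\<Sum>b\<in>B. (x \<bullet> b) *\<^sub>R b) \<bullet> c = (\<Sum>b\<in>B. (x \<bullet> b) * (if b = c then 1 else 0))"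
        unfolding inner_sum_left
      proof (intro sum.cong refl)
        fix b assume b: "b \<in> B"
        show "(x \<bullet> b) *\<^sub>R b \<bullet> c = (x \<bullet> b) * (if b = c then 1 else 0)"
          using B(1,2) b c by (auto simp: pairwise_def orthogonal_def power2_norm_eq_inner[symmetric])
      qed
      also have "\<dots> = x \<bullet> c" using fin c by (simp add: sum.delta' if_distrib cong: if_cong)
      finally show ?thesis by (simp add: y_def orthogonal_def inner_diff_left)
    qed
    have "orthogonal y y" by (rule orthogonal_to_span[of y B]) (use B(3) yB in simp_all)
    then have "y = 0" by (simp add: orthogonal_self)
    then show ?thesis by (simp add: y_def)
  qed
  moreover have "0 \<le> l b" if b: "b \<in> B" for b
  proof -
    have "0 \<le> b \<bullet> (A *v b)" using A by (simp add: psd_def)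
    then show ?thesis using l[OF b] B(2) b by (simp add: power2_norm_eq_inner[symmetric])
  qed
  ultimately show thesis using that[OF fin _ B(3) _ B(1) l] B(2) by blast
qed

text \<open>The defect \<open>z\<close> satisfies \<open>S *v z = - sqrt l *\<^sub>R z\<close>,
  which contradicts semi-definiteness unless \<open>z = 0\<close> or \<open>l = 0\<close>; in the
  latter case symmetry gives \<open>z \<bullet> z = b \<bullet> (S *v z) = 0\<close>. Hence a root
  is determined on an eigenbasis, which yields uniqueness.\<close>

lemma psd_sqrt_eigenvector:
  fixes S A :: "real^'n^'n"
  assumes S: "psd S" "S ** S = A" and b: "A *v b = l *\<^sub>R b" and l: "0 \<le> l"
  shows "S *v b = sqrt l *\<^sub>R b"
proof -
  define z where "z = S *v b - sqrt l *\<^sub>R b"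
  have Sb: "S *v (S *v b) = l *\<^sub>R b" using S b by (simp add: matrix_vector_mul_assoc)
  have Sz: "S *v z = - sqrt l *\<^sub>R z"
    unfolding z_def using l
    by (simp add: matrix_vector_mult_diff_distrib matrix_vector_mult_scaleR Sb scaleR_diff_right)
  have "0 \<le> z \<bullet> (S *v z)" using S by (simp add: psd_def)
  then have *: "sqrt l * (z \<bullet> z) \<le> 0" unfolding Sz by simp
  have "z = 0"
  proof (cases "l = 0")
    case True
    then have z: "z = S *v b" by (simp add: z_def)
    have "z \<bullet> z = b \<bullet> (S *v z)"
      unfolding z using S symmetric_matrix_inner[of S b "S *v b"] by (simp add: psd_def)
    also have "\<dots> = 0" using Sz True by simp
    finally show ?thesis by simp
  next
    case False
    then have "z \<bullet> z \<le> 0" using * l by (simp add: mult_le_0_iff)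
    then have "z \<bullet> z = 0" using inner_ge_zero[of z] by linarith
    then show ?thesis by simp
  qed
  then show ?thesis by (simp add: z_def)
qed

text \<open>Justifies the definite description in \<open>mat_sqrt\<close>: existence comes from the
  diagonal operator with entries \<open>sqrt (l b)\<close>, uniqueness from
  \<open>psd_sqrt_eigenvector\<close>.\<close>

lemma mat_sqrt:
  fixes A :: "real^'n^'n"
  assumes A: "psd A"
  shows "psd (mat_sqrt A)" "mat_sqrt A ** mat_sqrt A = A"
proof -
  obtain B l where B: "finite B" "\<And>x. x = (\<Sum>b\<in>B. (x \<bullet> b) *\<^sub>R b)" "span B = UNIV"
      "\<And>b. b \<in> B \<Longrightarrow> norm b = 1" "pairwise orthogonal B"
      "\<And>b. b \<in> B \<Longrightarrow> A *v b = l b *\<^sub>R b" "\<And>b. b \<in> B \<Longrightarrow> 0 \<le> l b"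
    using psd_eigenbasis[OF A] by blast
  have eqI: "S = T" if "\<And>b. b \<in> B \<Longrightarrow> S *v b = T *v b" for S T :: "real^'n^'n"
  proof -
    have "S *v x = T *v x" for x
      using linear_eq_on_span[OF matrix_vector_mul_linear matrix_vector_mul_linear, of B S T x] that B(3) by auto
    then show ?thesis by (simp add: matrix_eq)
  qed
  define f where "f x = (\<Sum>b\<in>B. (sqrt (l b) * (x \<bullet> b)) *\<^sub>R b)" for x
  have "linear f"
    by (intro linearI) (auto simp: f_def inner_add_left scaleR_add_left distrib_left sum.distrib scaleR_sum_right mult_ac)
  then have Sv: "matrix f *v x = f x" for x by (simp add: matrix_works)
  have fb: "f c = sqrt (l c) *\<^sub>R c" if c: "c \<in> B" for c
  proof -
    have "f c = (\<Sum>b\<in>B. if b = c then sqrt (l c) *\<^sub>R c else 0)"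
      unfolding f_def
    proof (intro sum.cong refl)
      fix b assume b: "b \<in> B"
      show "(sqrt (l b) * (c \<bullet> b)) *\<^sub>R b = (if b = c then sqrt (l c) *\<^sub>R c else 0)"
        using B(4,5) b c by (auto simp: pairwise_def orthogonal_def power2_norm_eq_inner[symmetric] inner_commute)
    qed
    then show ?thesis using B(1) c by simp
  qed
  have inner: "f x \<bullet> y = (\<Sum>b\<in>B. sqrt (l b) * (x \<bullet> b) * (y \<bullet> b))" for x y
    unfolding f_def inner_sum_left by (simp add: inner_commute)
  have psd: "psd (matrix f)"
    unfolding psd_def
  proof (intro conjI allI)
    have "(matrix f *v x) \<bullet> y = x \<bullet> (matrix f *v y)" for x y
      unfolding Sv inner_commute[of x "f y"] inner by (simp add: mult_ac)
    then have "x \<bullet> (transpose (matrix f) *v y) = x \<bullet> (matrix f *v y)" for x y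
      using dot_lmul_matrix[of y "matrix f" x] by (simp add: transpose_matrix_vector inner_commute)
    then show "transpose (matrix f) = matrix f"
      by (metis matrix_eq vector_eq_ldot)
    show "0 \<le> x \<bullet> (matrix f *v x)" for x
      unfolding Sv inner_commute[of x "f x"] inner mult.assoc
      by (intro sum_nonneg mult_nonneg_nonneg[OF _ zero_le_square]) (simp add: B(7))
  qed
  have sq: "matrix f ** matrix f = A"
  proof (rule eqI)
    fix b assume b: "b \<in> B"
    show "(matrix f ** matrix f) *v b = A *v b"
      unfolding matrix_vector_mul_assoc[symmetric] Sv fb[OF b] linear_scale[OF \<open>linear f\<close>]
      using B(6,7)[OF b] by simp
  qed
  have uniq: "T = matrix f" if "psd T" "T ** T = A" for T
  proof (rule eqI)
    fix b assume b: "b \<in> B"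
    show "T *v b = matrix f *v b"
      unfolding Sv fb[OF b] by (rule psd_sqrt_eigenvector[OF that B(6,7)[OF b]])
  qed
  have "mat_sqrt A = matrix f"
    unfolding mat_sqrt_def by (rule the_equality) (auto intro: psd sq uniq)
  then show "psd (mat_sqrt A)" "mat_sqrt A ** mat_sqrt A = A" using psd sq by auto
qed

lemma mat_sqrt_inner:
  assumes "psd A"
  shows "(mat_sqrt A *v x) \<bullet> (mat_sqrt A *v y) = x \<bullet> (A *v y)"
proof -
  have "(mat_sqrt A *v x) \<bullet> (mat_sqrt A *v y) = x \<bullet> (mat_sqrt A *v (mat_sqrt A *v y))"
    using mat_sqrt(1)[OF assms] by (intro symmetric_matrix_inner) (simp add: psd_def)
  also have "mat_sqrt A *v (mat_sqrt A *v y) = A *v y"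
    by (simp add: matrix_vector_mul_assoc mat_sqrt(2)[OF assms])
  finally show ?thesis .
qed

lemma norm_mat_sqrt_le:
  assumes "psd A"
  shows "norm (mat_sqrt A *v x) \<le> sqrt (onorm ((*v) A)) * norm x"
proof (rule power2_le_imp_le)
  have bl: "bounded_linear ((*v) A)" by (simp add: linear_conv_bounded_linear[symmetric])
  have "(norm (mat_sqrt A *v x))\<^sup>2 = x \<bullet> (A *v x)"
    by (simp add: power2_norm_eq_inner mat_sqrt_inner[OF assms])
  also have "\<dots> \<le> norm x * norm (A *v x)" by (rule norm_cauchy_schwarz)
  also have "\<dots> \<le> norm x * (onorm ((*v) A) * norm x)" by (intro mult_left_mono onorm[OF bl]) simp
  also have "\<dots> = (sqrt (onorm ((*v) A)) * norm x)\<^sup>2"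
    using onorm_pos_le[OF bl] by (simp add: power_mult_distrib) (simp add: power2_eq_square)
  finally show "(norm (mat_sqrt A *v x))\<^sup>2 \<le> (sqrt (onorm ((*v) A)) * norm x)\<^sup>2" .
  show "0 \<le> sqrt (onorm ((*v) A)) * norm x" using onorm_pos_le[OF bl] by simp
qed

subsection \<open>Measurability of the square root and of preimages\<close>

text \<open>Fixed-point iteration for the square root of \<open>t \<in> [0, 1]\<close>; being polynomial, it makes sense
  for matrices and yields measurability of \<open>mat_sqrt\<close>.\<close>

primrec sqrt_iter :: "real \<Rightarrow> nat \<Rightarrow> real" where
  "sqrt_iter t 0 = 0"
| "sqrt_iter t (Suc k) = sqrt_iter t k + (t - (sqrt_iter t k)\<^sup>2) / 2"

primrec mat_sqrt_iter :: "real^'n^'n \<Rightarrow> nat \<Rightarrow> real^'n^'n" where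
  "mat_sqrt_iter A 0 = 0"
| "mat_sqrt_iter A (Suc k) = mat_sqrt_iter A k + (1/2) *\<^sub>R (A - mat_sqrt_iter A k ** mat_sqrt_iter A k)"

text \<open>The error factorises: the next one equals the current one times
  \<open>1 - (sqrt t + sqrt_iter t k) / 2\<close>, a factor between 0 and
  \<open>1 - sqrt t / 2\<close>. So the iterates never overshoot the root and converge geometrically
  for \<open>t > 0\<close>.\<close>

lemma sqrt_iter_bounds:
  assumes "0 \<le> t" "t \<le> 1"
  shows "0 \<le> sqrt_iter t k \<and> sqrt_iter t k \<le> sqrt t \<and>
    sqrt t - sqrt_iter t k \<le> sqrt t * (1 - sqrt t / 2) ^ k"
proof (induction k)
  case (Suc k)
  let ?s = "sqrt t" and ?y = "sqrt_iter t k"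
  have s: "0 \<le> ?s" "?s \<le> 1" "?s\<^sup>2 = t" using assms by auto
  have eq: "?s - sqrt_iter t (Suc k) = (?s - ?y) * (1 - (?s + ?y) / 2)"
  proof -
    have "sqrt_iter t (Suc k) = ?y + (?s\<^sup>2 - ?y\<^sup>2) / 2" unfolding s(3) by simp
    then show ?thesis by (simp only:) (simp add: field_simps power2_eq_square)
  qed
  have lin: "0 \<le> r - y" "0 \<le> 1 - (r + y) / 2" "1 - (r + y) / 2 \<le> 1 - r / 2" "0 \<le> 1 - r / 2"
    if "0 \<le> y" "y \<le> r" "r \<le> 1" for r y :: real
    using that by (auto simp: field_simps)
  note u = lin[OF conjunct1[OF Suc] conjunct1[OF conjunct2[OF Suc]] s(2)] conjunct2[OF conjunct2[OF Suc]]
  have "0 \<le> (?s - ?y) * (1 - (?s + ?y) / 2)" by (intro mult_nonneg_nonneg u)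
  moreover have "(?s - ?y) * (1 - (?s + ?y) / 2) \<le> (?s * (1 - ?s / 2) ^ k) * (1 - ?s / 2)"
    using u s(1) by (intro mult_mono mult_nonneg_nonneg zero_le_power)
  moreover have "0 \<le> sqrt_iter t (Suc k)"
  proof -
    have "?y\<^sup>2 \<le> ?s\<^sup>2" using Suc by (intro power_mono) auto
    then show ?thesis using Suc s(3) by simp
  qed
  ultimately show ?case using eq unfolding power_Suc2 mult.assoc[symmetric] by (intro conjI) simp_all
qed (use assms in auto)

lemma sqrt_iter_tendsto:
  assumes "0 \<le> t" "t \<le> 1"
  shows "sqrt_iter t \<longlonglongrightarrow> sqrt t"
proof (cases "t = 0")
  case True
  have "sqrt_iter 0 k = 0" for k by (induction k) auto
  then show ?thesis using True by (simp add: LIMSEQ_iff)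
next
  case False
  then have "0 < sqrt t" "sqrt t \<le> 1" using assms by auto
  then have s: "0 \<le> 1 - sqrt t / 2" "1 - sqrt t / 2 < 1" by linarith+
  have "(\<lambda>k. sqrt t * (1 - sqrt t / 2) ^ k) \<longlonglongrightarrow> sqrt t * 0"
    by (intro tendsto_mult tendsto_const LIMSEQ_realpow_zero s)
  then have lim: "(\<lambda>k. sqrt t * (1 - sqrt t / 2) ^ k) \<longlonglongrightarrow> 0" by simp
  have "\<forall>\<^sub>F k in sequentially. norm (sqrt_iter t k - sqrt t) \<le> sqrt t * (1 - sqrt t / 2) ^ k"
    using sqrt_iter_bounds[OF assms] by (intro always_eventually allI) (simp add: abs_le_iff)
  from Lim_null_comparison[OF this lim] show ?thesis by (rule LIM_zero_cancel)
qed

text \<open>Used to rescale eigenvalues into \<open>[0, 1]\<close>. Being explicit in the entries,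
  it depends measurably on the matrix; the summand 1 allows division by it for the zero matrix
  too.\<close>

definition mat_bound :: "real^'n^'n \<Rightarrow> real" where
  "mat_bound A = 1 + (\<Sum>i\<in>UNIV. \<Sum>j\<in>UNIV. \<bar>A $ i $ j\<bar>)"

lemma mat_bound_pos: "0 < mat_bound A"
  unfolding mat_bound_def by (intro add_pos_nonneg sum_nonneg) auto

lemma eigenvalue_le_mat_bound:
  assumes "A *v b = l *\<^sub>R b" "norm b = 1"
  shows "l \<le> mat_bound A"
proof -
  have "norm (A *v b) \<le> onorm ((*v) A) * norm b"
    by (rule onorm) (simp add: linear_conv_bounded_linear[symmetric])
  then have "\<bar>l\<bar> \<le> onorm ((*v) A)" using assms by simp
  also have "\<dots> \<le> (\<Sum>i\<in>UNIV. \<Sum>j\<in>UNIV. \<bar>A $ i $ j\<bar>)" by (rule onorm_le_matrix_component_sum)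
  finally show ?thesis by (simp add: mat_bound_def)
qed

lemma mat_sqrt_iter_eigenvector:
  assumes "A *v b = l *\<^sub>R b"
  shows "mat_sqrt_iter A k *v b = sqrt_iter l k *\<^sub>R b"
proof (induction k)
  case (Suc k)
  have "mat_sqrt_iter A (Suc k) *v b
      = mat_sqrt_iter A k *v b + (1/2) *\<^sub>R (A *v b - mat_sqrt_iter A k *v (mat_sqrt_iter A k *v b))"
    by (simp add: matrix_vector_mult_add_rdistrib scaleR_matrix_vector_assoc[symmetric]
        matrix_vector_mult_diff_rdistrib matrix_vector_mul_assoc)
  also have "\<dots> = sqrt_iter l (Suc k) *\<^sub>R b"
    unfolding Suc assms matrix_vector_mult_scaleR
    by (simp add: scaleR_add_left[symmetric] scaleR_diff_left[symmetric] power2_eq_square)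
  finally show ?case .
qed simp

text \<open>On each eigenvector the matrix iteration is the scalar one at \<open>l b / c\<close>;
  the factor \<open>sqrt c\<close> undoes the rescaling. Expanding vectors in the eigenbasis gives
  convergence of every entry.\<close>

lemma mat_sqrt_LIMSEQ:
  fixes A :: "real^'n^'n"
  assumes A: "psd A"
  shows "(\<lambda>k. sqrt (mat_bound A) * mat_sqrt_iter ((1 / mat_bound A) *\<^sub>R A) k $ i $ j) \<longlonglongrightarrow> mat_sqrt A $ i $ j"
proof -
  define c where "c = mat_bound A"
  have c: "0 < c" unfolding c_def by (rule mat_bound_pos)
  define Y where "Y k = sqrt c *\<^sub>R mat_sqrt_iter ((1 / c) *\<^sub>R A) k" for k
  obtain B l where *: "finite B" "\<And>x. x = (\<Sum>b\<in>B. (x \<bullet> b) *\<^sub>R b)" "span B = UNIV"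
      "\<And>b. b \<in> B \<Longrightarrow> norm b = 1" "pairwise orthogonal B"
      "\<And>b. b \<in> B \<Longrightarrow> A *v b = l b *\<^sub>R b" "\<And>b. b \<in> B \<Longrightarrow> 0 \<le> l b"
    using psd_eigenbasis[OF A] by blast
  note B = *(1,2,4,6,7)
  have b_lim: "(\<lambda>k. Y k *v b) \<longlonglongrightarrow> mat_sqrt A *v b" if b: "b \<in> B" for b
  proof -
    have l: "0 \<le> l b / c" "l b / c \<le> 1"
      using B(5)[OF b] c eigenvalue_le_mat_bound[OF B(4)[OF b] B(3)[OF b]] by (auto simp: c_def)
    have eig: "((1 / c) *\<^sub>R A) *v b = (l b / c) *\<^sub>R b"
      by (simp add: scaleR_matrix_vector_assoc[symmetric] B(4)[OF b])
    then have Yb: "Y k *v b = (sqrt c * sqrt_iter (l b / c) k) *\<^sub>R b" for k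
      unfolding Y_def scaleR_matrix_vector_assoc[symmetric] mat_sqrt_iter_eigenvector[OF eig] by simp
    have "(\<lambda>k. (sqrt c * sqrt_iter (l b / c) k) *\<^sub>R b) \<longlonglongrightarrow> (sqrt c * sqrt (l b / c)) *\<^sub>R b"
      by (intro tendsto_intros sqrt_iter_tendsto l)
    also have "sqrt c * sqrt (l b / c) = sqrt (l b)" using c by (simp add: real_sqrt_divide)
    also have "sqrt (l b) *\<^sub>R b = mat_sqrt A *v b"
      using psd_sqrt_eigenvector[OF mat_sqrt[OF A] B(4)[OF b] B(5)[OF b]] by simp
    finally show ?thesis unfolding Yb .
  qed
  have "(\<lambda>k. Y k *v x) \<longlonglongrightarrow> mat_sqrt A *v x" for x
  proof -
    have exp: "S *v x = (\<Sum>b\<in>B. (x \<bullet> b) *\<^sub>R (S *v b))" for S :: "real^'n^'n"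
      by (subst B(2)[of x]) (simp add: linear_sum[OF matrix_vector_mul_linear] matrix_vector_mult_scaleR)
    show ?thesis unfolding exp by (intro tendsto_sum tendsto_scaleR tendsto_const b_lim)
  qed
  from tendsto_vec_nth[OF this[of "axis j 1"], of i] show ?thesis
    by (simp add: matrix_vector_mul_component inner_axis Y_def c_def)
qed

lemma measurable_vec_nth_iff:
  fixes f :: "'a \<Rightarrow> real^'n"
  shows "f \<in> borel_measurable M \<longleftrightarrow> (\<forall>i. (\<lambda>x. f x $ i) \<in> borel_measurable M)"
proof
  assume [measurable]: "f \<in> borel_measurable M"
  show "\<forall>i. (\<lambda>x. f x $ i) \<in> borel_measurable M"
    unfolding inner_axis[symmetric, where y = "1::real", simplified] by measurable
next
  assume "\<forall>i. (\<lambda>x. f x $ i) \<in> borel_measurable M"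
  then show "f \<in> borel_measurable M"
    by (subst borel_measurable_euclidean_space) (auto simp: Basis_vec_def inner_axis)
qed

lemma measurable_matrix_vector_mult:
  fixes T :: "'a \<Rightarrow> real^'n^'n" and g :: "'a \<Rightarrow> real^'n"
  assumes "\<And>i j. (\<lambda>x. T x $ i $ j) \<in> borel_measurable M" "g \<in> borel_measurable M"
  shows "(\<lambda>x. T x *v g x) \<in> borel_measurable M"
proof -
  have [measurable]: "(\<lambda>x. T x $ i $ j) \<in> borel_measurable M" "(\<lambda>x. g x $ j) \<in> borel_measurable M" for i j
    using assms by (auto simp: measurable_vec_nth_iff)
  show ?thesis unfolding measurable_vec_nth_iff matrix_vector_mult_def by simp
qed

lemma measurable_mat_sqrt:
  fixes Q :: "'a \<Rightarrow> real^'n^'n"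
  assumes psd: "\<And>x. x \<in> space M \<Longrightarrow> psd (Q x)"
    and Q: "\<And>i j. (\<lambda>x. Q x $ i $ j) \<in> borel_measurable M"
  shows "(\<lambda>x. mat_sqrt (Q x) $ i $ j) \<in> borel_measurable M"
proof (rule borel_measurable_LIMSEQ_metric)
  note [measurable] = Q
  have [measurable]: "(\<lambda>x. mat_bound (Q x)) \<in> borel_measurable M"
    unfolding mat_bound_def by measurable
  have [measurable]: "(\<lambda>x. mat_sqrt_iter ((1 / mat_bound (Q x)) *\<^sub>R Q x) k $ i $ j) \<in> borel_measurable M" for k i j
  proof (induction k arbitrary: i j)
    case (Suc k)
    note [measurable] = Suc
    show ?case by (simp add: matrix_matrix_mult_def)
  qed simp
  show "(\<lambda>x. sqrt (mat_bound (Q x)) * mat_sqrt_iter ((1 / mat_bound (Q x)) *\<^sub>R Q x) k $ i $ j) \<in> borel_measurable M" for k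
    by measurable
  show "(\<lambda>k. sqrt (mat_bound (Q x)) * mat_sqrt_iter ((1 / mat_bound (Q x)) *\<^sub>R Q x) k $ i $ j) \<longlonglongrightarrow> mat_sqrt (Q x) $ i $ j"
    if "x \<in> space M" for x by (rule mat_sqrt_LIMSEQ[OF psd[OF that]])
qed

text \<open>Landweber iteration: it converges to the solution of \<open>S *v g = y\<close> of minimal norm, which is
  therefore a measurable function of \<open>S\<close> and \<open>y\<close>.\<close>

primrec landweber :: "real^'n^'n \<Rightarrow> real^'n \<Rightarrow> nat \<Rightarrow> real^'n" where
  "landweber S y 0 = 0"
| "landweber S y (Suc k) = landweber S y k + (1 / mat_bound S) *\<^sub>R (y - S *v landweber S y k)"

text \<open>In the eigenbasis the coordinates of the iterates are
  \<open>1 - (1 - l b / c) ^ k\<close> times those of \<open>z\<close>. They converge to those of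
  \<open>z\<close> where \<open>l b > 0\<close> and stay 0 where \<open>l b = 0\<close>, and
  \<open>S\<close> does not see the latter directions.\<close>

lemma landweber_limit:
  fixes S :: "real^'n^'n"
  assumes S: "psd S"
  shows "\<exists>g. landweber S (S *v z) \<longlonglongrightarrow> g \<and> S *v g = S *v z"
proof -
  define c where "c = mat_bound S"
  have c: "0 < c" unfolding c_def by (rule mat_bound_pos)
  obtain B l where *: "finite B" "\<And>x. x = (\<Sum>b\<in>B. (x \<bullet> b) *\<^sub>R b)" "span B = UNIV"
      "\<And>b. b \<in> B \<Longrightarrow> norm b = 1" "pairwise orthogonal B"
      "\<And>b. b \<in> B \<Longrightarrow> S *v b = l b *\<^sub>R b" "\<And>b. b \<in> B \<Longrightarrow> 0 \<le> l b"
    using psd_eigenbasis[OF S] by blast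
  note B = *(1,2,4,6,7)
  have Sb: "(S *v x) \<bullet> b = l b * (x \<bullet> b)" if "b \<in> B" for x b
    using symmetric_matrix_inner[of S x b] S B(4)[OF that] by (simp add: psd_def)
  have coord: "landweber S (S *v z) k \<bullet> b = (1 - (1 - l b / c) ^ k) * (z \<bullet> b)" if b: "b \<in> B" for k b
  proof (induction k)
    case (Suc k)
    have "landweber S (S *v z) (Suc k) \<bullet> b
        = landweber S (S *v z) k \<bullet> b + (l b / c) * (z \<bullet> b - landweber S (S *v z) k \<bullet> b)"
      by (simp add: inner_add_left inner_diff_left Sb[OF b] c_def diff_divide_distrib right_diff_distrib)
    also have "\<dots> = (1 - (1 - l b / c) ^ Suc k) * (z \<bullet> b)"
      unfolding Suc by (simp add: algebra_simps)
    finally show ?case .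
  qed simp
  define g where "g = (\<Sum>b\<in>B. (if l b = 0 then 0 else z \<bullet> b) *\<^sub>R b)"
  have "(\<lambda>k. \<Sum>b\<in>B. (landweber S (S *v z) k \<bullet> b) *\<^sub>R b) \<longlonglongrightarrow> g"
    unfolding g_def
  proof (intro tendsto_sum tendsto_scaleR tendsto_const)
    fix b assume b: "b \<in> B"
    show "(\<lambda>k. landweber S (S *v z) k \<bullet> b) \<longlonglongrightarrow> (if l b = 0 then 0 else z \<bullet> b)"
    proof (cases "l b = 0")
      case False
      then have "0 < l b / c" "l b / c \<le> 1"
        using B(5)[OF b] c eigenvalue_le_mat_bound[OF B(4)[OF b] B(3)[OF b]] by (auto simp: c_def)
      then have "(\<lambda>k. (1 - (1 - l b / c) ^ k) * (z \<bullet> b)) \<longlonglongrightarrow> (1 - 0) * (z \<bullet> b)"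
        by (intro tendsto_intros LIMSEQ_realpow_zero) auto
      then show ?thesis using False by (simp add: coord[OF b])
    qed (simp add: coord[OF b])
  qed
  moreover have "(\<Sum>b\<in>B. (landweber S (S *v z) k \<bullet> b) *\<^sub>R b) = landweber S (S *v z) k" for k
    using B(2)[of "landweber S (S *v z) k"] by simp
  ultimately have "landweber S (S *v z) \<longlonglongrightarrow> g" by simp
  moreover have "S *v g = S *v z"
  proof -
    have "S *v g = (\<Sum>b\<in>B. (if l b = 0 then 0 else z \<bullet> b) *\<^sub>R (S *v b))"
      by (simp add: g_def linear_sum[OF matrix_vector_mul_linear] matrix_vector_mult_scaleR)
    also have "\<dots> = (\<Sum>b\<in>B. (z \<bullet> b) *\<^sub>R (S *v b))" by (intro sum.cong) (auto simp: B(4))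
    also have "\<dots> = S *v z"
      by (subst (2) B(2)[of z]) (simp add: linear_sum[OF matrix_vector_mul_linear] matrix_vector_mult_scaleR)
    finally show ?thesis .
  qed
  ultimately show ?thesis by blast
qed

lemma measurable_preimage:
  fixes T :: "'a \<Rightarrow> real^'n^'n" and A :: "'a \<Rightarrow> real^'n"
  assumes T: "\<And>i j. (\<lambda>x. T x $ i $ j) \<in> borel_measurable M" and A: "A \<in> borel_measurable M"
    and psd: "\<And>x. x \<in> space M \<Longrightarrow> psd (T x)" and range: "AE x in M. A x \<in> range ((*v) (T x))"
  obtains g where "g \<in> borel_measurable M" "AE x in M. T x *v g x = A x"
proof
  note [measurable] = A T
  have [measurable]: "(\<lambda>x. mat_bound (T x)) \<in> borel_measurable M"
    unfolding mat_bound_def by measurable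
  have [measurable]: "(\<lambda>x. landweber (T x) (A x) k) \<in> borel_measurable M" for k
  proof (induction k)
    case (Suc k)
    note [measurable] = Suc measurable_matrix_vector_mult[OF T Suc]
    show ?case by simp
  qed simp
  show "(\<lambda>x. lim (landweber (T x) (A x))) \<in> borel_measurable M" by measurable
  show "AE x in M. T x *v lim (landweber (T x) (A x)) = A x"
    using range AE_space
  proof eventually_elim
    case (elim x)
    then obtain z where z: "A x = T x *v z" by auto
    then show ?case using landweber_limit[OF psd[OF elim(2)], of z] by (auto dest: limI)
  qed
qed

section \<open>Auxiliary facts: limits of integrals, null-set changes, essential bounds\<close>

lemma (in variable_exponent) integral_tendsto:
  assumes f: "\<And>k. f k \<in> Lq" and g: "g \<in> Lq" and lim: "(\<lambda>k. rnorm (\<lambda>x. f k x - g x)) \<longlonglongrightarrow> 0"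
  shows "(\<lambda>k. \<integral>x. f k x \<partial>M) \<longlonglongrightarrow> (\<integral>x. g x \<partial>M)"
  using dual_tendsto[of "\<lambda>x. 1 :: real" f g] f g lim Lq_const[of 1]
  by (simp add: Vq_real vnorm_real dual_def)

lemma (in variable_exponent) luxnorm_cong_AE:
  assumes "AE x in M. f x = g x"
  shows "luxnorm f = luxnorm g"
proof -
  have "rho (\<lambda>x. f x / \<mu>) = rho (\<lambda>x. g x / \<mu>)" for \<mu>
    unfolding rho_def using assms by (intro nn_integral_cong_AE) auto
  then show ?thesis by (simp add: luxnorm_def)
qed

lemma (in variable_exponent) luxnorm_eq_vnorm: "A \<in> Vq \<Longrightarrow> luxnorm (\<lambda>x. norm (A x)) = ennreal (vnorm A)"
  by (simp add: vnorm_def luxnorm_eq_rnorm Vq_norm)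

text \<open>The supremum ranges over possibly uncountably many lower bounds, each with its own null
  set; a countable sequence with the same supremum leaves a single null set.\<close>

lemma AE_p_minus_le: "AE x in lebesgue_on E. p_minus E p \<le> p x"
proof -
  let ?S = "{z. AE x in lebesgue_on E. z \<le> p x}"
  have "- \<infinity> \<in> ?S" by simp
  then obtain f :: "nat \<Rightarrow> ereal" where f: "range f \<subseteq> ?S" "Sup ?S = (SUP i. f i)"
    using Sup_countable_SUP[of ?S] by blast
  have "AE x in lebesgue_on E. \<forall>i. f i \<le> p x"
    using f(1) by (subst AE_all_countable) auto
  then show ?thesis
    unfolding p_minus_def f(2) by eventually_elim (auto intro: SUP_least)
qed

subsection \<open>Continuously differentiable functions\<close>

lemma gradient_lincomb:
  assumes "f differentiable (at x)" "g differentiable (at x)"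
  shows "gradient (\<lambda>x. c * f x + d * g x) x = c *\<^sub>R gradient f x + d *\<^sub>R gradient g x"
proof -
  have "((\<lambda>x. c * f x + d * g x) has_derivative
      (\<lambda>h. c * frechet_derivative f (at x) h + d * frechet_derivative g (at x) h)) (at x)"
    using assms by (auto intro!: derivative_eq_intros simp: frechet_derivative_works)
  from frechet_derivative_at[OF this, symmetric] show ?thesis by (simp add: gradient_def vec_eq_iff)
qed

lemma C1_closure_lincomb:
  assumes f: "f \<in> C1_closure E" and g: "g \<in> C1_closure E"
  shows "(\<lambda>x. c * f x + d * g x) \<in> C1_closure E"
proof -
  obtain F G where "continuous_on (closure E) F" "\<forall>x\<in>E. F x = gradient f x"
      "continuous_on (closure E) G" "\<forall>x\<in>E. G x = gradient g x"
    using f g by (auto simp: C1_closure_def)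
  then have "continuous_on (closure E) (\<lambda>x. c *\<^sub>R F x + d *\<^sub>R G x)"
      "\<forall>x\<in>E. c *\<^sub>R F x + d *\<^sub>R G x = gradient (\<lambda>x. c * f x + d * g x) x"
    using f g by (auto intro!: continuous_intros simp: gradient_lincomb C1_closure_def)
  then have "\<exists>H. continuous_on (closure E) H \<and> (\<forall>x\<in>E. H x = gradient (\<lambda>x. c * f x + d * g x) x)"
    by blast
  then show ?thesis
    using f g by (auto simp: C1_closure_def intro!: continuous_intros derivative_intros)
qed

lemma gradient_const: "gradient (\<lambda>x. c) x = 0"
  using frechet_derivative_at[OF has_derivative_const[of c "at x"]]
  by (simp add: gradient_def vec_eq_iff)

lemma C1_closure_const: "(\<lambda>x. c) \<in> C1_closure E"
  by (auto simp: C1_closure_def gradient_const intro!: exI[of _ "\<lambda>x. 0"])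

lemma C1_closure_shift:
  assumes "f \<in> C1_closure E"
  shows "(\<lambda>x. f x - c) \<in> C1_closure E" and "x \<in> E \<Longrightarrow> gradient (\<lambda>x. f x - c) x = gradient f x"
  using C1_closure_lincomb[OF assms C1_closure_const[of 1], of 1 "- c"]
    gradient_lincomb[of f x "\<lambda>x. 1" 1 "- c"] assms
  by (auto simp: C1_closure_def gradient_const)

lemma continuous_closure_measurable_bounded:
  fixes f :: "'a::euclidean_space \<Rightarrow> 'b::euclidean_space"
  assumes E: "open E" "bounded E" and f: "continuous_on (closure E) f"
  shows "f \<in> borel_measurable (lebesgue_on E)" and "\<exists>K\<ge>0. \<forall>x\<in>E. norm (f x) \<le> K"
proof -
  show "f \<in> borel_measurable (lebesgue_on E)"
    using continuous_on_subset[OF f closure_subset] E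
    by (intro continuous_imp_measurable_on_sets_lebesgue) auto
  have "compact (f ` closure E)" using E f by (intro compact_continuous_image) auto
  then obtain K where "\<forall>y\<in>f ` closure E. norm y \<le> K" using compact_imp_bounded bounded_iff by blast
  then show "\<exists>K\<ge>0. \<forall>x\<in>E. norm (f x) \<le> K"
    using closure_subset by (intro exI[of _ "max 0 K"]) (auto simp: le_max_iff_disj)
qed

lemma C1_closure_measurable_bounded:
  assumes E: "open E" "bounded E" and f: "f \<in> C1_closure E"
  shows "f \<in> borel_measurable (lebesgue_on E)" "\<exists>K\<ge>0. \<forall>x\<in>E. \<bar>f x\<bar> \<le> K"
    "gradient f \<in> borel_measurable (lebesgue_on E)" "\<exists>K\<ge>0. \<forall>x\<in>E. norm (gradient f x) \<le> K"
proof -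
  have c: "continuous_on (closure E) f" using f by (simp add: C1_closure_def)
  obtain G where G: "continuous_on (closure E) G" "\<And>x. x \<in> E \<Longrightarrow> G x = gradient f x"
    using f by (auto simp: C1_closure_def)
  show "f \<in> borel_measurable (lebesgue_on E)" "\<exists>K\<ge>0. \<forall>x\<in>E. \<bar>f x\<bar> \<le> K"
    using continuous_closure_measurable_bounded[OF E c] by auto
  have "gradient f \<in> borel_measurable (lebesgue_on E) \<longleftrightarrow> G \<in> borel_measurable (lebesgue_on E)"
    by (rule measurable_cong) (simp add: G(2) space_restrict_space)
  then show "gradient f \<in> borel_measurable (lebesgue_on E)"
    using continuous_closure_measurable_bounded(1)[OF E G(1)] by simp
  show "\<exists>K\<ge>0. \<forall>x\<in>E. norm (gradient f x) \<le> K"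
    using continuous_closure_measurable_bounded(2)[OF E G(1)] G(2) by auto
qed

subsection \<open>The degenerate Neumann problem\<close>

locale neumann_setting =
  fixes E :: "(real^'n) set" and p :: "real^'n \<Rightarrow> ereal" and v :: "real^'n \<Rightarrow> real"
    and Q :: "real^'n \<Rightarrow> real^'n^'n"
  assumes open_E: "open E" and bounded_E: "bounded E"
    and p_exponent: "p \<in> exponents E" and p_minus_gt_1: "1 < p_minus E p" and p_plus_finite: "p_plus E p < \<infinity>"
    and v_nonneg: "\<And>x. x \<in> E \<Longrightarrow> 0 \<le> v x" and v_pos: "0 < (\<integral>x. v x \<partial>lebesgue_on E)"
    and Q_psd: "\<And>x. x \<in> E \<Longrightarrow> psd (Q x)"
    and Q_measurable: "\<And>i j. (\<lambda>x. Q x $ i $ j) \<in> borel_measurable (lebesgue_on E)"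
    and v_Lp: "v \<in> Lp E p" and Q_Lp: "(\<lambda>x. sqrt (onorm ((*v) (Q x)))) \<in> Lp E p"
begin

definition pm :: real where "pm = real_of_ereal (p_minus E p)"
definition pp :: real where "pp = real_of_ereal (p_plus E p)"

text \<open>Clipping to the essential range gives the pointwise bounds of
  \<open>variable_exponent\<close> while changing the exponent only on a null set.\<close>

definition q :: "real^'n \<Rightarrow> real" where "q x = max pm (min pp (real_of_ereal (p x)))"

lemma space_E [simp]: "space (lebesgue_on E) = E"
  by (simp add: space_restrict_space)

lemma p_measurable: "p \<in> borel_measurable (lebesgue_on E)"
  using p_exponent by (simp add: exponents_def)

lemma AE_p: "AE x in lebesgue_on E. p_minus E p \<le> p x \<and> p x \<le> p_plus E p"
  using AE_p_minus_le esssup_AE[of p "lebesgue_on E"] unfolding p_plus_def by eventually_elim auto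

lemma p_minus_eq: "p_minus E p = ereal pm" and p_plus_eq: "p_plus E p = ereal pp"
  and pm_gt_1: "1 < pm" and pm_le_pp: "pm \<le> pp"
proof -
  have le: "p_minus E p \<le> p_plus E p"
  proof (rule ccontr)
    assume "\<not> p_minus E p \<le> p_plus E p"
    \<comment> \<open>If the two bounds were reversed, no point could satisfy both; almost every
      point would then satisfy anything, in particular \<open>v x = 0\<close>, against
      \<open>v_pos\<close>.\<close>
    have "AE x in lebesgue_on E. v x = 0"
      using AE_p
    proof eventually_elim
      case (elim x)
      then have "p_minus E p \<le> p_plus E p" using order_trans by blast
      with \<open>\<not> p_minus E p \<le> p_plus E p\<close> show ?case by blast
    qed
    then have "(\<integral>x. v x \<partial>lebesgue_on E) = 0" by (rule integral_eq_zero_AE)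
    then show False using v_pos by simp
  qed
  show 1: "p_minus E p = ereal pm" "p_plus E p = ereal pp"
    using le p_minus_gt_1 p_plus_finite unfolding pm_def pp_def
    by (cases "p_minus E p"; cases "p_plus E p"; auto)+
  show "1 < pm" "pm \<le> pp" using le p_minus_gt_1 unfolding 1 by auto
qed

lemma AE_q: "AE x in lebesgue_on E. real_of_ereal (p x) = q x"
  using AE_p
proof eventually_elim
  case (elim x)
  then show ?case unfolding p_minus_eq p_plus_eq q_def by (cases "p x") auto
qed

sublocale variable_exponent "lebesgue_on E" q pm pp
proof (rule variable_exponent.intro)
  show "finite_measure (lebesgue_on E)"
    using open_E bounded_E by (intro finite_measure_lebesgue_on bounded_set_imp_lmeasurable) auto
  show "variable_exponent_axioms (lebesgue_on E) q pm pp"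
  proof
    show "q \<in> borel_measurable (lebesgue_on E)"
      using p_measurable unfolding q_def[abs_def] by measurable
  qed (use pm_gt_1 pm_le_pp in \<open>auto simp: q_def\<close>)
qed

section \<open>Translation of the weighted spaces into the abstract setting\<close>

lemma modular_eq_rho: "modular E p f = rho f"
  unfolding modular_def rho_def by (intro nn_integral_cong_AE) (use AE_q in eventually_elim, simp)

lemma Lp_norm_eq_luxnorm: "Lp_norm E p f = luxnorm f"
  by (simp add: Lp_norm_def luxnorm_def modular_eq_rho)

lemma Lp_eq_Lq: "Lp E p = Lq"
  by (auto simp: Lp_def Lp_norm_eq_luxnorm Lq_iff_luxnorm)

lemma v_Lq: "v \<in> Lq" and Q_Lq: "(\<lambda>x. sqrt (onorm ((*v) (Q x)))) \<in> Lq"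
  using v_Lp Q_Lp by (auto simp: Lp_eq_Lq)

lemma v_measurable [measurable]: "v \<in> borel_measurable (lebesgue_on E)"
  by (rule Lq_measurable[OF v_Lq])

definition T :: "real^'n \<Rightarrow> real^'n^'n" where "T x = mat_sqrt (Q x)"

lemma T_measurable: "(\<lambda>x. T x $ i $ j) \<in> borel_measurable (lebesgue_on E)"
  unfolding T_def by (rule measurable_mat_sqrt[OF _ Q_measurable]) (simp add: Q_psd)

lemma T_mult_measurable:
  "g \<in> borel_measurable (lebesgue_on E) \<Longrightarrow> (\<lambda>x. T x *v g x) \<in> borel_measurable (lebesgue_on E)"
  by (rule measurable_matrix_vector_mult[OF T_measurable])

lemma Lpv_iff: "f \<in> Lpv E p v \<longleftrightarrow> f \<in> borel_measurable (lebesgue_on E) \<and> (\<lambda>x. f x * v x) \<in> Lq"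
  unfolding Lpv_def Lpv_norm_def Lp_norm_eq_luxnorm Lq_iff_luxnorm by auto

lemma LQ_iff: "g \<in> LQ E p Q \<longleftrightarrow> g \<in> borel_measurable (lebesgue_on E) \<and> (\<lambda>x. T x *v g x) \<in> Vq"
  unfolding LQ_def LQ_norm_def Lp_norm_eq_luxnorm Vq_def Lq_iff_luxnorm T_def[symmetric]
  using T_mult_measurable[of g] by auto

lemma C1_Lpv: "w \<in> C1_closure E \<Longrightarrow> w \<in> Lpv E p v"
proof -
  assume w: "w \<in> C1_closure E"
  note b = C1_closure_measurable_bounded[OF open_E bounded_E w]
  obtain K where K: "0 \<le> K" "\<And>x. x \<in> E \<Longrightarrow> \<bar>w x\<bar> \<le> K" using b(2) by auto
  have "(\<lambda>x. w x * v x) \<in> Lq"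
    using b(1) K by (intro Lq_mono[OF Lq_cmult[OF v_Lq, of K]]) (auto simp: abs_mult intro: mult_right_mono)
  then show ?thesis using b(1) by (simp add: Lpv_iff)
qed

lemma C1_LQ: "w \<in> C1_closure E \<Longrightarrow> gradient w \<in> LQ E p Q"
proof -
  assume w: "w \<in> C1_closure E"
  note b = C1_closure_measurable_bounded[OF open_E bounded_E w]
  obtain K where K: "0 \<le> K" "\<And>x. x \<in> E \<Longrightarrow> norm (gradient w x) \<le> K" using b(4) by auto
  have "(\<lambda>x. T x *v gradient w x) \<in> Vq"
  proof (rule Vq_bound[OF Lq_cmult[OF Q_Lq, of K] T_mult_measurable[OF b(3)]])
    fix x assume "x \<in> space (lebesgue_on E)"
    then have x: "x \<in> E" by simp
    have "norm (T x *v gradient w x) \<le> sqrt (onorm ((*v) (Q x))) * norm (gradient w x)"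
      unfolding T_def by (rule norm_mat_sqrt_le[OF Q_psd[OF x]])
    also have "\<dots> \<le> \<bar>sqrt (onorm ((*v) (Q x)))\<bar> * K" using K x by (intro mult_mono) auto
    finally show "norm (T x *v gradient w x) \<le> \<bar>K * sqrt (onorm ((*v) (Q x)))\<bar>"
      using K by (simp add: abs_mult mult.commute)
  qed
  then show ?thesis using b(3) by (simp add: LQ_iff)
qed

lemma C1_Lq: "w \<in> C1_closure E \<Longrightarrow> (\<lambda>x. w x * v x) \<in> Lq"
  using C1_Lpv by (simp add: Lpv_iff)

lemma C1_Vq: "w \<in> C1_closure E \<Longrightarrow> (\<lambda>x. T x *v gradient w x) \<in> Vq"
  using C1_LQ by (simp add: LQ_iff)

text \<open>The pairs are prescribed on \<open>E\<close> only: outside \<open>E\<close> the gradient is a junk value and not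
  additive, so otherwise \<open>X\<close> would not be a linear space.\<close>

definition X :: "((real^'n \<Rightarrow> real) \<times> (real^'n \<Rightarrow> real^'n)) set" where
  "X = {(U, A). \<exists>w\<in>C1_closure E. (\<integral>x. w x * v x \<partial>lebesgue_on E) = 0 \<and>
    (\<forall>x\<in>E. U x = w x * v x \<and> A x = T x *v gradient w x)}"

lemma XI:
  "w \<in> C1_closure E \<Longrightarrow> (\<integral>x. w x * v x \<partial>lebesgue_on E) = 0 \<Longrightarrow>
    (\<lambda>x. w x * v x, \<lambda>x. T x *v gradient w x) \<in> X"
  by (auto simp: X_def)

lemma X_lincomb:
  assumes "(U, A) \<in> X" "(V, B) \<in> X"
  shows "(\<lambda>x. c * U x + d * V x, \<lambda>x. c *\<^sub>R A x + d *\<^sub>R B x) \<in> X"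
proof -
  obtain w z where w: "w \<in> C1_closure E" "(\<integral>x. w x * v x \<partial>lebesgue_on E) = 0"
      "\<forall>x\<in>E. U x = w x * v x \<and> A x = T x *v gradient w x"
    and z: "z \<in> C1_closure E" "(\<integral>x. z x * v x \<partial>lebesgue_on E) = 0"
      "\<forall>x\<in>E. V x = z x * v x \<and> B x = T x *v gradient z x"
    using assms by (auto simp: X_def)
  have i: "integrable (lebesgue_on E) (\<lambda>x. w x * v x)" "integrable (lebesgue_on E) (\<lambda>x. z x * v x)"
    using w z by (auto intro: Lq_integrable_self C1_Lq)
  have "(\<integral>x. c * (w x * v x) + d * (z x * v x) \<partial>lebesgue_on E) = 0"
    using i w(2) z(2) by simp
  then have 0: "(\<integral>x. (c * w x + d * z x) * v x \<partial>lebesgue_on E) = 0"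
    by (simp add: distrib_right mult.assoc)
  have "gradient (\<lambda>x. c * w x + d * z x) x = c *\<^sub>R gradient w x + d *\<^sub>R gradient z x" if "x \<in> E" for x
    using w(1) z(1) that by (intro gradient_lincomb) (auto simp: C1_closure_def)
  then show ?thesis
    unfolding X_def using w z 0 C1_closure_lincomb[OF w(1) z(1), of c d]
    by (auto intro!: bexI[of _ "\<lambda>x. c * w x + d * z x"]
        simp: matrix_vector_right_distrib matrix_vector_mult_scaleR algebra_simps)
qed

sublocale linear_pairs "lebesgue_on E" q pm pp X
proof (rule linear_pairs.intro[OF variable_exponent_axioms], unfold_locales)
  fix U A assume "(U, A) \<in> X"
  then obtain w where w: "w \<in> C1_closure E" "\<And>x. x \<in> E \<Longrightarrow> U x = w x * v x"
      "\<And>x. x \<in> E \<Longrightarrow> A x = T x *v gradient w x"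
    by (auto simp: X_def)
  have "U \<in> borel_measurable (lebesgue_on E)"
    using Lq_measurable[OF C1_Lq[OF w(1)]] w(2) by (subst measurable_cong) auto
  then show "U \<in> Lq" using w(2) by (intro Lq_mono[OF C1_Lq[OF w(1)]]) auto
  have "A \<in> borel_measurable (lebesgue_on E)"
    using Vq_measurable[OF C1_Vq[OF w(1)]] w(3) by (subst measurable_cong) auto
  then show "A \<in> Vq" using w(3) by (intro Vq_bound[OF Vq_norm[OF C1_Vq[OF w(1)]]]) auto
next
  fix U V A B assume "(U, A) \<in> X" "(V, B) \<in> X"
  from X_lincomb[OF this, of 1 1] show "(\<lambda>x. U x + V x, \<lambda>x. A x + B x) \<in> X" by simp
next
  fix U A c assume "(U, A) \<in> X"
  from X_lincomb[OF this this, of c 0] show "(\<lambda>x. c *\<^sub>R U x, \<lambda>x. c *\<^sub>R A x) \<in> X" by simp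
next
  show "(\<lambda>x. 0, \<lambda>x. 0) \<in> X"
    unfolding X_def using C1_closure_const[of 0 E] by (auto intro!: bexI[of _ "\<lambda>x. 0"] simp: gradient_const)
qed

lemma v_integrable: "integrable (lebesgue_on E) v"
  by (rule Lq_integrable_self[OF v_Lq])

lemma mean_zero_shift:
  assumes w: "w \<in> C1_closure E"
  shows "(\<integral>x. (w x - weighted_avg E v w) * v x \<partial>lebesgue_on E) = 0"
proof -
  have "(\<integral>x. (w x - weighted_avg E v w) * v x \<partial>lebesgue_on E)
      = (\<integral>x. w x * v x - weighted_avg E v w * v x \<partial>lebesgue_on E)"
    by (simp add: left_diff_distrib)
  also have "\<dots> = (\<integral>x. w x * v x \<partial>lebesgue_on E) - weighted_avg E v w * (\<integral>x. v x \<partial>lebesgue_on E)"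
    using Lq_integrable_self[OF C1_Lq[OF w]] v_integrable by simp
  also have "\<dots> = 0" using v_pos by (simp add: weighted_avg_def)
  finally show ?thesis .
qed

lemma XI_shift:
  assumes w: "w \<in> C1_closure E"
  shows "(\<lambda>x. (w x - weighted_avg E v w) * v x, \<lambda>x. T x *v gradient w x) \<in> X"
  unfolding X_def using C1_closure_shift[OF w] mean_zero_shift[OF w]
  by (auto intro!: bexI[of _ "\<lambda>x. w x - weighted_avg E v w"])

lemma Lpv_norm_eq:
  "(\<lambda>x. f x * v x) \<in> Lq \<Longrightarrow> Lpv_norm E p v f = ennreal (rnorm (\<lambda>x. f x * v x))"
  by (simp add: Lpv_norm_def Lp_norm_eq_luxnorm luxnorm_eq_rnorm)

lemma LQ_norm_eq:
  "(\<lambda>x. T x *v g x) \<in> Vq \<Longrightarrow> LQ_norm E p Q g = ennreal (vnorm (\<lambda>x. T x *v g x))"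
  using luxnorm_eq_vnorm[of "\<lambda>x. T x *v g x"] by (simp add: LQ_norm_def Lp_norm_eq_luxnorm T_def)

text \<open>Subtracting the weighted average leaves the gradient unchanged and lands in the
  mean-zero class, while mean-zero functions have average 0; so the Poincare property is a statement
  about \<open>X\<close> alone.\<close>

lemma poincare_iff:
  "poincare_property E p v Q \<longleftrightarrow> (\<exists>C0>0. \<forall>(U, A)\<in>X. rnorm U \<le> C0 * vnorm A)"
proof -
  have *: "Lpv_norm E p v (\<lambda>x. w x - weighted_avg E v w) \<le> ennreal C0 * LQ_norm E p Q (gradient w)
      \<longleftrightarrow> rnorm (\<lambda>x. (w x - weighted_avg E v w) * v x) \<le> C0 * vnorm (\<lambda>x. T x *v gradient w x)"
    if w: "w \<in> C1_closure E" and C0: "0 < C0" for w C0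
    using X_fst[OF XI_shift[OF w]] C1_Vq[OF w] C0
    by (simp add: Lpv_norm_eq LQ_norm_eq ennreal_mult'[symmetric])
  have "(\<forall>w\<in>C1_closure E. rnorm (\<lambda>x. (w x - weighted_avg E v w) * v x) \<le> C0 * vnorm (\<lambda>x. T x *v gradient w x))
      \<longleftrightarrow> (\<forall>(U, A)\<in>X. rnorm U \<le> C0 * vnorm A)" for C0
  proof
    assume L: "\<forall>w\<in>C1_closure E. rnorm (\<lambda>x. (w x - weighted_avg E v w) * v x) \<le> C0 * vnorm (\<lambda>x. T x *v gradient w x)"
    show "\<forall>(U, A)\<in>X. rnorm U \<le> C0 * vnorm A"
    proof safe
      fix U A assume "(U, A) \<in> X"
      then obtain w where w: "w \<in> C1_closure E" "(\<integral>x. w x * v x \<partial>lebesgue_on E) = 0"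
          "\<And>x. x \<in> E \<Longrightarrow> U x = w x * v x" "\<And>x. x \<in> E \<Longrightarrow> A x = T x *v gradient w x"
        by (auto simp: X_def)
      have "rnorm U = rnorm (\<lambda>x. (w x - weighted_avg E v w) * v x)"
        using w by (intro rnorm_cong) (simp add: weighted_avg_def)
      moreover have "vnorm A = vnorm (\<lambda>x. T x *v gradient w x)"
        unfolding vnorm_def using w by (intro rnorm_cong) simp
      ultimately show "rnorm U \<le> C0 * vnorm A" using L w(1) by simp
    qed
  qed (use XI_shift in blast)
  then show ?thesis unfolding poincare_property_def using * by blast
qed


section \<open>Sobolev pairs as limits of \<open>X\<close>\<close>

lemma H1_iff:
  assumes "u \<in> Lpv E p v" "g \<in> LQ E p Q"
  shows "(u, g) \<in> H1 E p v Q \<longleftrightarrow> (\<exists>w. (\<forall>k. w k \<in> C1_closure E) \<and>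
    (\<lambda>k. rnorm (\<lambda>x. w k x * v x - u x * v x) + vnorm (\<lambda>x. T x *v gradient (w k) x - T x *v g x)) \<longlonglongrightarrow> 0)"
proof -
  have "Lpv_norm E p v (\<lambda>x. w k x - u x) + LQ_norm E p Q (\<lambda>x. gradient (w k) x - g x)
      = ennreal (rnorm (\<lambda>x. w k x * v x - u x * v x) + vnorm (\<lambda>x. T x *v gradient (w k) x - T x *v g x))"
    if w: "\<forall>k. w k \<in> C1_closure E" for w :: "nat \<Rightarrow> real^'n \<Rightarrow> real" and k
  proof -
    have "(\<lambda>x. w k x * v x - u x * v x) \<in> Lq"
      using w assms C1_Lq[of "w k"] by (intro Lq_diff) (auto simp: Lpv_iff)
    moreover have "(\<lambda>x. T x *v gradient (w k) x - T x *v g x) \<in> Vq"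
      using w assms C1_Vq[of "w k"] by (intro Vq_diff) (auto simp: LQ_iff)
    ultimately show ?thesis
      by (simp add: Lpv_norm_eq LQ_norm_eq left_diff_distrib matrix_vector_mult_diff_distrib)
  qed
  then have "(\<lambda>k. Lpv_norm E p v (\<lambda>x. w k x - u x) + LQ_norm E p Q (\<lambda>x. gradient (w k) x - g x)) \<longlonglongrightarrow> 0
      \<longleftrightarrow> (\<lambda>k. rnorm (\<lambda>x. w k x * v x - u x * v x) + vnorm (\<lambda>x. T x *v gradient (w k) x - T x *v g x)) \<longlonglongrightarrow> 0"
    if "\<forall>k. w k \<in> C1_closure E" for w :: "nat \<Rightarrow> real^'n \<Rightarrow> real"
    using that tendsto_ennreal_iff[of "\<lambda>k. rnorm (\<lambda>x. w k x * v x - u x * v x)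
      + vnorm (\<lambda>x. T x *v gradient (w k) x - T x *v g x)" sequentially 0]
    by (simp del: ennreal_plus)
  then show ?thesis using assms unfolding H1_def by blast
qed

text \<open>The approximants that membership in \<open>H1\<close> provides need not have mean zero.
  Their averages converge to the average of \<open>u\<close>, which is 0, so subtracting them
  changes neither the gradients nor the limit.\<close>

lemma limit_of_H1_mean_zero:
  assumes ug: "(u, g) \<in> H1_mean_zero E p v Q"
  obtains Us As where "limit_of Us As (\<lambda>x. u x * v x) (\<lambda>x. T x *v g x)"
proof -
  have u: "u \<in> Lpv E p v" and g: "g \<in> LQ E p Q" and mean: "(\<integral>x. u x * v x \<partial>lebesgue_on E) = 0"
    using ug by (auto simp: H1_mean_zero_def H1_def)
  have U: "(\<lambda>x. u x * v x) \<in> Lq" and A: "(\<lambda>x. T x *v g x) \<in> Vq"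
    using u g by (auto simp: Lpv_iff LQ_iff)
  obtain w where w: "\<And>k. w k \<in> C1_closure E"
    and lim: "(\<lambda>k. rnorm (\<lambda>x. w k x * v x - u x * v x) + vnorm (\<lambda>x. T x *v gradient (w k) x - T x *v g x)) \<longlonglongrightarrow> 0"
    using ug H1_iff[OF u g] by (auto simp: H1_mean_zero_def)
  have lim1: "(\<lambda>k. rnorm (\<lambda>x. w k x * v x - u x * v x)) \<longlonglongrightarrow> 0"
    and lim2: "(\<lambda>k. vnorm (\<lambda>x. T x *v gradient (w k) x - T x *v g x)) \<longlonglongrightarrow> 0"
    by (rule tendsto_sandwich[OF _ _ tendsto_const lim]; simp)+
  define c where "c k = weighted_avg E v (w k)" for k
  have "c \<longlonglongrightarrow> (\<integral>x. u x * v x \<partial>lebesgue_on E) / (\<integral>x. v x \<partial>lebesgue_on E)"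
    unfolding c_def weighted_avg_def
    using v_pos by (intro tendsto_divide tendsto_const integral_tendsto[OF C1_Lq[OF w] U lim1]) simp
  then have c: "c \<longlonglongrightarrow> 0" using mean by simp
  have "limit_of (\<lambda>k x. (w k x - c k) * v x) (\<lambda>k x. T x *v gradient (w k) x)
      (\<lambda>x. u x * v x) (\<lambda>x. T x *v g x)"
    unfolding limit_of_def
  proof (intro conjI allI U A lim2)
    show "(\<lambda>x. (w k x - c k) * v x, \<lambda>x. T x *v gradient (w k) x) \<in> X" for k
      unfolding c_def by (rule XI_shift[OF w])
    show "(\<lambda>k. rnorm (\<lambda>x. (w k x - c k) * v x - u x * v x)) \<longlonglongrightarrow> 0"
    proof (rule tendsto_sandwich[OF _ _ tendsto_const])
      have "rnorm (\<lambda>x. (w k x - c k) * v x - u x * v x) \<le> rnorm (\<lambda>x. w k x * v x - u x * v x) + \<bar>c k\<bar> * rnorm v" for k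
      proof -
        have "rnorm (\<lambda>x. (w k x - c k) * v x - u x * v x) = rnorm (\<lambda>x. (w k x * v x - u x * v x) + (- c k) * v x)"
          by (simp add: algebra_simps)
        also have "\<dots> \<le> rnorm (\<lambda>x. w k x * v x - u x * v x) + rnorm (\<lambda>x. (- c k) * v x)"
          by (intro rnorm_triangle Lq_diff C1_Lq[OF w] U Lq_cmult v_Lq)
        also have "rnorm (\<lambda>x. (- c k) * v x) = \<bar>c k\<bar> * rnorm v" using rnorm_cmult[OF v_Lq, of "- c k"] by simp
        finally show ?thesis .
      qed
      then show "\<forall>\<^sub>F k in sequentially. rnorm (\<lambda>x. (w k x - c k) * v x - u x * v x)
          \<le> rnorm (\<lambda>x. w k x * v x - u x * v x) + \<bar>c k\<bar> * rnorm v" by simp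
      have "(\<lambda>k. rnorm (\<lambda>x. w k x * v x - u x * v x) + \<bar>c k\<bar> * rnorm v) \<longlonglongrightarrow> 0 + \<bar>0\<bar> * rnorm v"
        by (intro tendsto_intros lim1 c)
      then show "(\<lambda>k. rnorm (\<lambda>x. w k x * v x - u x * v x) + \<bar>c k\<bar> * rnorm v) \<longlonglongrightarrow> 0" by simp
    qed simp
  qed
  then show thesis by (rule that)
qed

lemma H1_mean_zero_of_limit:
  assumes u: "u \<in> borel_measurable (lebesgue_on E)" and g: "g \<in> borel_measurable (lebesgue_on E)"
    and lim: "limit_of Us As (\<lambda>x. u x * v x) (\<lambda>x. T x *v g x)"
  shows "(u, g) \<in> H1_mean_zero E p v Q"
proof -
  have U: "(\<lambda>x. u x * v x) \<in> Lq" and A: "(\<lambda>x. T x *v g x) \<in> Vq" and X: "(Us k, As k) \<in> X"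
    and lim1: "(\<lambda>k. rnorm (\<lambda>x. Us k x - u x * v x)) \<longlonglongrightarrow> 0"
    and lim2: "(\<lambda>k. vnorm (\<lambda>x. As k x - T x *v g x)) \<longlonglongrightarrow> 0" for k
    using lim by (auto simp: limit_of_def)
  have "\<exists>w\<in>C1_closure E. (\<integral>x. w x * v x \<partial>lebesgue_on E) = 0 \<and>
      (\<forall>x\<in>E. Us k x = w x * v x \<and> As k x = T x *v gradient w x)" for k
    using X[of k] by (simp add: X_def)
  then obtain w where w: "\<And>k. w k \<in> C1_closure E" "\<And>k. (\<integral>x. w k x * v x \<partial>lebesgue_on E) = 0"
      "\<And>k x. x \<in> E \<Longrightarrow> Us k x = w k x * v x" "\<And>k x. x \<in> E \<Longrightarrow> As k x = T x *v gradient (w k) x"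
    by metis
  have n1: "rnorm (\<lambda>x. w k x * v x - u x * v x) = rnorm (\<lambda>x. Us k x - u x * v x)"
    and n2: "vnorm (\<lambda>x. T x *v gradient (w k) x - T x *v g x) = vnorm (\<lambda>x. As k x - T x *v g x)" for k
    unfolding vnorm_def using w(3,4) by (auto intro!: rnorm_cong)
  have lp: "u \<in> Lpv E p v" "g \<in> LQ E p Q" using u g U A by (auto simp: Lpv_iff LQ_iff)
  have "(\<lambda>k. rnorm (\<lambda>x. w k x * v x - u x * v x) + vnorm (\<lambda>x. T x *v gradient (w k) x - T x *v g x)) \<longlonglongrightarrow> 0"
    unfolding n1 n2 using tendsto_add[OF lim1 lim2] by simp
  then have "(u, g) \<in> H1 E p v Q" using H1_iff[OF lp] w(1) by blast
  \<comment> \<open>The mean is continuous for the norm, so the limit of mean-zero approximants has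
    mean zero as well.\<close>
  moreover have "(\<lambda>k. \<integral>x. w k x * v x \<partial>lebesgue_on E) \<longlonglongrightarrow> (\<integral>x. u x * v x \<partial>lebesgue_on E)"
    using lim1 unfolding n1[symmetric] by (intro integral_tendsto C1_Lq w(1) U)
  then have "(\<integral>x. u x * v x \<partial>lebesgue_on E) = 0" unfolding w(2) by (simp add: LIMSEQ_const_iff)
  ultimately show ?thesis by (simp add: H1_mean_zero_def)
qed

lemma C1_mean_zero_iff:
  assumes \<phi>: "\<phi> \<in> C1_closure E"
  shows "(\<phi>, gradient \<phi>) \<in> H1_mean_zero E p v Q \<longleftrightarrow> (\<integral>x. \<phi> x * v x \<partial>lebesgue_on E) = 0"
proof -
  have "rnorm (\<lambda>x. 0) = 0" "vnorm (\<lambda>x. 0 :: real^'n) = 0"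
    using rnorm_cmult[OF v_Lq, of 0] by (simp_all add: vnorm_def)
  then have "(\<phi>, gradient \<phi>) \<in> H1 E p v Q"
    using \<phi> by (subst H1_iff[OF C1_Lpv[OF \<phi>] C1_LQ[OF \<phi>]]) (auto intro!: exI[of _ "\<lambda>_. \<phi>"])
  then show ?thesis by (simp add: H1_mean_zero_def)
qed

section \<open>The weak form as a duality pairing\<close>

lemma real_p_measurable [measurable]: "(\<lambda>x. real_of_ereal (p x)) \<in> borel_measurable (lebesgue_on E)"
  using p_measurable by measurable

lemma weak_lhs_eq_dual:
  assumes g: "g \<in> borel_measurable (lebesgue_on E)" and h: "h \<in> borel_measurable (lebesgue_on E)"
  shows "(\<integral>x. norm (mat_sqrt (Q x) *v g x) powr (real_of_ereal (p x) - 2) * (h x \<bullet> (Q x *v g x)) \<partial>lebesgue_on E)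
    = dual (\<lambda>x. T x *v g x) (\<lambda>x. T x *v h x)"
proof -
  note [measurable] = T_mult_measurable[OF g] T_mult_measurable[OF h]
  have "(\<integral>x. norm (mat_sqrt (Q x) *v g x) powr (real_of_ereal (p x) - 2) * (h x \<bullet> (Q x *v g x)) \<partial>lebesgue_on E)
      = (\<integral>x. norm (T x *v g x) powr (real_of_ereal (p x) - 2) * ((T x *v h x) \<bullet> (T x *v g x)) \<partial>lebesgue_on E)"
    by (intro Bochner_Integration.integral_cong) (simp_all add: T_def mat_sqrt_inner Q_psd)
  also have "\<dots> = dual (\<lambda>x. T x *v g x) (\<lambda>x. T x *v h x)"
    unfolding dual_def
  proof (rule integral_cong_AE)
    show "AE x in lebesgue_on E. norm (T x *v g x) powr (real_of_ereal (p x) - 2) * ((T x *v h x) \<bullet> (T x *v g x))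
        = norm (T x *v g x) powr (q x - 2) * ((T x *v h x) \<bullet> (T x *v g x))"
      using AE_q by eventually_elim simp
  qed measurable
  finally show ?thesis .
qed

text \<open>Where \<open>v x > 0\<close>, split \<open>v powr q\<close> into
  \<open>v powr (q - 2)\<close> and \<open>v * v\<close> and distribute the factors over
  \<open>f\<close> and \<open>\<phi>\<close>; where \<open>v x = 0\<close>, both integrands vanish
  since \<open>0 powr a = 0\<close>.\<close>

lemma weak_rhs_eq_dual:
  assumes [measurable]: "f \<in> borel_measurable (lebesgue_on E)" "\<phi> \<in> borel_measurable (lebesgue_on E)"
  shows "(\<integral>x. \<bar>f x\<bar> powr (real_of_ereal (p x) - 2) * f x * \<phi> x * v x powr real_of_ereal (p x) \<partial>lebesgue_on E)
    = dual (\<lambda>x. f x * v x) (\<lambda>x. \<phi> x * v x)"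
  unfolding dual_def
proof (rule integral_cong_AE)
  show "AE x in lebesgue_on E. \<bar>f x\<bar> powr (real_of_ereal (p x) - 2) * f x * \<phi> x * v x powr real_of_ereal (p x)
      = norm (f x * v x) powr (q x - 2) * ((\<phi> x * v x) \<bullet> (f x * v x))"
    using AE_q AE_space
  proof eventually_elim
    case (elim x)
    show ?case
    proof (cases "v x = 0")
      case False
      then have v: "0 < v x" using v_nonneg[of x] elim(2) by auto
      have "v x powr q x = v x powr (q x - 2) * (v x * v x)"
        using powr_add[of "v x" "q x - 2" 2] v by (simp add: powr_numeral power2_eq_square)
      then show ?thesis unfolding elim(1) using v by (simp add: abs_mult powr_mult)
    qed simp
  qed
qed measurable

lemma weak_solution_iff:
  assumes f: "f \<in> Lpv E p v" and ug: "(u, g) \<in> H1_mean_zero E p v Q"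
  shows "weak_solution E p v Q f u g \<longleftrightarrow> solves (\<lambda>x. f x * v x) (\<lambda>x. T x *v g x)"
proof -
  have fm: "f \<in> borel_measurable (lebesgue_on E)" and gm: "g \<in> borel_measurable (lebesgue_on E)"
    using f ug by (auto simp: Lpv_iff H1_mean_zero_def H1_def LQ_iff)
  have *: "(\<integral>x. norm (mat_sqrt (Q x) *v g x) powr (real_of_ereal (p x) - 2)
             * (gradient \<phi> x \<bullet> (Q x *v g x)) \<partial>lebesgue_on E)
        = - (\<integral>x. \<bar>f x\<bar> powr (real_of_ereal (p x) - 2) * f x * \<phi> x
                  * v x powr real_of_ereal (p x) \<partial>lebesgue_on E)
      \<longleftrightarrow> dual (\<lambda>x. T x *v g x) (\<lambda>x. T x *v gradient \<phi> x) = - dual (\<lambda>x. f x * v x) (\<lambda>x. \<phi> x * v x)"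
    if \<phi>: "\<phi> \<in> C1_closure E" for \<phi>
    using weak_lhs_eq_dual[OF gm C1_closure_measurable_bounded(3)[OF open_E bounded_E \<phi>]]
      weak_rhs_eq_dual[OF fm C1_closure_measurable_bounded(1)[OF open_E bounded_E \<phi>]] by simp
  have "(\<forall>\<phi>\<in>C1_closure E. (\<integral>x. \<phi> x * v x \<partial>lebesgue_on E) = 0 \<longrightarrow>
        dual (\<lambda>x. T x *v g x) (\<lambda>x. T x *v gradient \<phi> x) = - dual (\<lambda>x. f x * v x) (\<lambda>x. \<phi> x * v x))
      \<longleftrightarrow> solves (\<lambda>x. f x * v x) (\<lambda>x. T x *v g x)" (is "?L \<longleftrightarrow> ?R")
  proof
    assume L: ?L
    show ?R
      unfolding solves_def
    proof safe
      fix \<Phi> B assume "(\<Phi>, B) \<in> X"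
      then obtain \<phi> where \<phi>: "\<phi> \<in> C1_closure E" "(\<integral>x. \<phi> x * v x \<partial>lebesgue_on E) = 0"
          "\<And>x. x \<in> E \<Longrightarrow> \<Phi> x = \<phi> x * v x" "\<And>x. x \<in> E \<Longrightarrow> B x = T x *v gradient \<phi> x"
        by (auto simp: X_def)
      have "dual (\<lambda>x. T x *v g x) B = dual (\<lambda>x. T x *v g x) (\<lambda>x. T x *v gradient \<phi> x)"
        "dual (\<lambda>x. f x * v x) \<Phi> = dual (\<lambda>x. f x * v x) (\<lambda>x. \<phi> x * v x)"
        unfolding dual_def using \<phi>(3,4) by (auto intro!: Bochner_Integration.integral_cong)
      then show "dual (\<lambda>x. T x *v g x) B = - dual (\<lambda>x. f x * v x) \<Phi>" using L \<phi>(1,2) by simp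
    qed
  next
    assume ?R
    then show ?L using XI unfolding solves_def by blast
  qed
  then show ?thesis
    unfolding weak_solution_def using ug * C1_mean_zero_iff by (metis (no_types, lifting))
qed

text \<open>The abstract solution is a pair of limit fields \<open>(U, A)\<close>. What is left is
  to recover measurable \<open>u\<close> and \<open>g\<close> with \<open>u * v = U\<close> and
  \<open>T *v g = A\<close> almost everywhere, after which norms and pairings carry over.\<close>

lemma exists_weak_solution:
  assumes poincare: "poincare_property E p v Q" and f: "f \<in> Lpv E p v"
  shows "\<exists>u g. weak_solution E p v Q f u g"
proof -
  obtain C0 where C0: "0 < C0" "\<And>U A. (U, A) \<in> X \<Longrightarrow> rnorm U \<le> C0 * vnorm A"
    using poincare unfolding poincare_iff by blast
  have F: "(\<lambda>x. f x * v x) \<in> Lq" using f by (simp add: Lpv_iff)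
  obtain Us As U A where lim: "limit_of Us As U A" and sol: "solves (\<lambda>x. f x * v x) A"
    and limU: "AE x in lebesgue_on E. (\<lambda>k. Us k x) \<longlonglongrightarrow> U x"
    and limA: "AE x in lebesgue_on E. (\<lambda>k. As k x) \<longlonglongrightarrow> A x"
    using exists_solution[OF F C0] by blast
  have U: "U \<in> Lq" and A: "A \<in> Vq" and X: "(Us k, As k) \<in> X" for k
    using lim by (auto simp: limit_of_def)
  note [measurable] = Lq_measurable[OF U] Vq_measurable[OF A]
  have form: "\<exists>w. Us k x = w * v x" "As k x \<in> range ((*v) (T x))" if "x \<in> E" for k x
    using X[of k] that by (auto simp: X_def)
  \<comment> \<open>On the zero set of \<open>v\<close> this quotient is 0 by convention. There
    every \<open>Us k\<close> vanishes, hence so does \<open>U\<close> almost everywhere, and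
    \<open>u * v = U\<close> persists.\<close>
  define u where "u x = U x / v x" for x
  have u [measurable]: "u \<in> borel_measurable (lebesgue_on E)" unfolding u_def[abs_def] by measurable
  have uv: "AE x in lebesgue_on E. u x * v x = U x"
    using limU AE_space
  proof eventually_elim
    case (elim x)
    show ?case
    proof (cases "v x = 0")
      case True
      have "Us k x = 0" for k using form(1)[of x k] elim(2) True by auto
      then have "U x = 0" using elim(1) by (simp add: LIMSEQ_const_iff)
      then show ?thesis using True by simp
    qed (simp add: u_def)
  qed
  have "AE x in lebesgue_on E. A x \<in> range ((*v) (T x))"
    using limA AE_space
  proof eventually_elim
    case (elim x)
    \<comment> \<open>Linear subspaces are closed in finite dimension, so a pointwise limit of
      vectors in the range of \<open>T x\<close> stays in it.\<close>
    have "closed (range ((*v) (T x)))"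
      by (intro closed_subspace linear_subspace_image matrix_vector_mul_linear subspace_UNIV)
    then show ?case
      by (rule closed_sequentially[OF _ _ elim(1)]) (use form(2)[of x] elim(2) in simp)
  qed
  then obtain g where g: "g \<in> borel_measurable (lebesgue_on E)"
    and Tg: "AE x in lebesgue_on E. T x *v g x = A x"
    using measurable_preimage[OF T_measurable Vq_measurable[OF A], of thesis] mat_sqrt(1)[OF Q_psd]
    by (auto simp: T_def)
  note [measurable] = T_mult_measurable[OF g]
  have "luxnorm (\<lambda>x. u x * v x) = luxnorm U" using uv by (rule luxnorm_cong_AE)
  then have uvL: "(\<lambda>x. u x * v x) \<in> Lq" using U by (simp add: Lq_iff_luxnorm)
  have "luxnorm (\<lambda>x. norm (T x *v g x)) = luxnorm (\<lambda>x. norm (A x))"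
    by (intro luxnorm_cong_AE) (use Tg in eventually_elim, simp)
  then have TgV: "(\<lambda>x. T x *v g x) \<in> Vq" using A by (simp add: Vq_def Lq_iff_luxnorm)
  have "rnorm (\<lambda>x. Us k x - u x * v x) = rnorm (\<lambda>x. Us k x - U x)" for k
    unfolding rnorm_def by (intro arg_cong[of _ _ enn2real] luxnorm_cong_AE) (use uv in eventually_elim, simp)
  moreover have "vnorm (\<lambda>x. As k x - T x *v g x) = vnorm (\<lambda>x. As k x - A x)" for k
    unfolding vnorm_def rnorm_def by (intro arg_cong[of _ _ enn2real] luxnorm_cong_AE) (use Tg in eventually_elim, simp)
  ultimately have "limit_of Us As (\<lambda>x. u x * v x) (\<lambda>x. T x *v g x)"
    using lim uvL TgV by (simp add: limit_of_def)
  then have ug: "(u, g) \<in> H1_mean_zero E p v Q" by (rule H1_mean_zero_of_limit[OF u g])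
  have "dual (\<lambda>x. T x *v g x) B = dual A B" if "B \<in> borel_measurable (lebesgue_on E)" for B
  proof -
    note [measurable] = that
    show ?thesis
      unfolding dual_def
    proof (rule integral_cong_AE)
      show "AE x in lebesgue_on E. norm (T x *v g x) powr (q x - 2) * (B x \<bullet> (T x *v g x))
          = norm (A x) powr (q x - 2) * (B x \<bullet> A x)"
        using Tg by eventually_elim simp
    qed measurable
  qed
  then have "solves (\<lambda>x. f x * v x) (\<lambda>x. T x *v g x)"
    using sol Vq_measurable[OF X_snd] unfolding solves_def by (auto split: prod.splits)
  then show ?thesis using weak_solution_iff[OF f ug] by blast
qed

text \<open>The exponent \<open>p_star\<close> depends on the solution; the maximum over its two
  possible values makes the constant independent of it.\<close>

lemma weak_solution_estimate:
  assumes C0: "0 < C0" "\<And>U A. (U, A) \<in> X \<Longrightarrow> rnorm U \<le> C0 * vnorm A"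
    and f: "f \<in> Lpv E p v" and sol: "weak_solution E p v Q f u g"
  shows "enn2real (Lpv_norm E p v u) \<le> C0 * max ((2 * C0) powr (1 / (pp - 1))) ((2 * C0) powr (1 / (pm - 1)))
    * enn2real (Lpv_norm E p v f) powr ((r_star E p v f - 1) / (p_star E p Q g - 1))"
proof -
  have ug: "(u, g) \<in> H1_mean_zero E p v Q" using sol by (simp add: weak_solution_def)
  obtain Us As where lim: "limit_of Us As (\<lambda>x. u x * v x) (\<lambda>x. T x *v g x)"
    using limit_of_H1_mean_zero[OF ug] by blast
  have F: "(\<lambda>x. f x * v x) \<in> Lq" using f by (simp add: Lpv_iff)
  have UA: "(\<lambda>x. u x * v x) \<in> Lq" "(\<lambda>x. T x *v g x) \<in> Vq" using lim by (auto simp: limit_of_def)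
  have "solves (\<lambda>x. f x * v x) (\<lambda>x. T x *v g x)" using sol weak_solution_iff[OF f ug] by blast
  note sol' = this
  have r: "r_star E p v f = (if 1 \<le> rnorm (\<lambda>x. f x * v x) then pp else pm)"
    unfolding r_star_def Lpv_norm_eq[OF F] by (simp add: p_plus_eq p_minus_eq)
  have s: "p_star E p Q g = (if vnorm (\<lambda>x. T x *v g x) < 1 then pp else pm)"
    unfolding p_star_def LQ_norm_eq[OF UA(2)] by (simp add: p_plus_eq p_minus_eq)
  have n: "enn2real (Lpv_norm E p v u) = rnorm (\<lambda>x. u x * v x)" "enn2real (Lpv_norm E p v f) = rnorm (\<lambda>x. f x * v x)"
    by (simp_all add: Lpv_norm_eq F UA)
  have "rnorm (\<lambda>x. u x * v x) \<le> C0 * (2 * C0) powr (1 / (p_star E p Q g - 1))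
      * rnorm (\<lambda>x. f x * v x) powr ((r_star E p v f - 1) / (p_star E p Q g - 1))"
    unfolding r s by (rule solution_estimate[OF F lim sol' C0])
  also have "\<dots> \<le> C0 * max ((2 * C0) powr (1 / (pp - 1))) ((2 * C0) powr (1 / (pm - 1)))
      * rnorm (\<lambda>x. f x * v x) powr ((r_star E p v f - 1) / (p_star E p Q g - 1))"
  proof (intro mult_right_mono mult_left_mono)
    show "(2 * C0) powr (1 / (p_star E p Q g - 1)) \<le> max ((2 * C0) powr (1 / (pp - 1))) ((2 * C0) powr (1 / (pm - 1)))"
      unfolding s by simp
  qed (use C0(1) in auto)
  finally show ?thesis unfolding n .
qed

lemma poincare_of_neumann:
  assumes N: "neumann_property E p v Q"
  shows "poincare_property E p v Q"
proof -
  obtain C1 where C1: "0 < C1" "\<And>f u g. f \<in> Lpv E p v \<Longrightarrow> weak_solution E p v Q f u g \<Longrightarrow>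
      enn2real (Lpv_norm E p v u) \<le> C1 * enn2real (Lpv_norm E p v f) powr ((r_star E p v f - 1) / (p_star E p Q g - 1))"
    using N unfolding neumann_property_def by blast
  have "rnorm U \<le> (2 * C1 + 1) * vnorm A" if UA: "(U, A) \<in> X" for U A
  proof (cases "rnorm U = 0")
    case True
    then show ?thesis using C1 by simp
  next
    case False
    then have t: "0 < rnorm U" using rnorm_nonneg[of U] by linarith
    \<comment> \<open>With data of norm 1 the right-hand side of the Neumann estimate is just
      \<open>C1\<close>, irrespective of \<open>r_star\<close> and \<open>p_star\<close>. The linear
      inequality for \<open>(U, A)\<close> is recovered by scaling back.\<close>
    define c where "c = 1 / rnorm U"
    have cX: "(\<lambda>x. c *\<^sub>R U x, \<lambda>x. c *\<^sub>R A x) \<in> X" by (rule X_scale[OF UA])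
    then obtain f where f: "f \<in> C1_closure E" "(\<integral>x. f x * v x \<partial>lebesgue_on E) = 0"
        "\<And>x. x \<in> E \<Longrightarrow> c *\<^sub>R U x = f x * v x" "\<And>x. x \<in> E \<Longrightarrow> c *\<^sub>R A x = T x *v gradient f x"
      unfolding X_def by blast
    have fL: "f \<in> Lpv E p v" by (rule C1_Lpv[OF f(1)])
    have "rnorm (\<lambda>x. f x * v x) = rnorm (\<lambda>x. c * U x)" using f(3) by (intro rnorm_cong) simp
    also have "\<dots> = 1" using rnorm_cmult[OF X_fst[OF UA], of c] t by (simp add: c_def)
    finally have n1: "rnorm (\<lambda>x. f x * v x) = 1" .
    obtain u g where sol: "weak_solution E p v Q f u g" using N fL unfolding neumann_property_def by blast
    have ug: "(u, g) \<in> H1_mean_zero E p v Q" using sol by (simp add: weak_solution_def)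
    obtain Us As where lim: "limit_of Us As (\<lambda>x. u x * v x) (\<lambda>x. T x *v g x)"
      using limit_of_H1_mean_zero[OF ug] by blast
    have uL: "(\<lambda>x. u x * v x) \<in> Lq" using lim by (simp add: limit_of_def)
    have "rnorm (\<lambda>x. u x * v x) \<le> C1"
      using C1(2)[OF fL sol] by (simp add: Lpv_norm_eq uL C1_Lq[OF f(1)] n1)
    moreover have "solves (\<lambda>x. f x * v x) (\<lambda>x. T x *v g x)" using sol weak_solution_iff[OF fL ug] by blast
    ultimately have "1 \<le> (2 * C1 + 1) * vnorm (\<lambda>x. T x *v gradient f x)"
      using poincare_from_estimate[OF XI[OF f(1,2)] lim _ n1] by blast
    also have "vnorm (\<lambda>x. T x *v gradient f x) = vnorm (\<lambda>x. c *\<^sub>R A x)"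
      unfolding vnorm_def using f(4) by (intro rnorm_cong) simp
    also have "\<dots> = vnorm A / rnorm U" using vnorm_scaleR[OF X_snd[OF UA], of c] t by (simp add: c_def)
    finally show ?thesis using t by (simp add: field_simps)
  qed
  then show ?thesis unfolding poincare_iff using C1(1) by (intro exI[of _ "2 * C1 + 1"]) auto
qed

lemma neumann_of_poincare:
  assumes P: "poincare_property E p v Q"
  shows "neumann_property E p v Q"
proof -
  obtain C0 where C0: "0 < C0" "\<And>U A. (U, A) \<in> X \<Longrightarrow> rnorm U \<le> C0 * vnorm A"
    using P unfolding poincare_iff by blast
  define C1 where "C1 = C0 * max ((2 * C0) powr (1 / (pp - 1))) ((2 * C0) powr (1 / (pm - 1)))"
  have "0 < C1" using C0 by (simp add: C1_def less_max_iff_disj)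
  then show ?thesis
    unfolding neumann_property_def C1_def
    using exists_weak_solution[OF P] weak_solution_estimate[OF C0] by blast
qed

end

theorem theorem1p8:
  fixes \<Omega> E :: "(real^'n) set"
    and p :: "real^'n \<Rightarrow> ereal"
    and v :: "real^'n \<Rightarrow> real"
    and Q :: "real^'n \<Rightarrow> real^'n^'n"
  assumes "open \<Omega>" and "connected \<Omega>" and "\<Omega> \<noteq> {}"
    and "open E" and "connected E" and "E \<noteq> {}" and "bounded E"
    and "closure E \<subseteq> \<Omega>"
    and "p \<in> exponents E" and "1 < p_minus E p" and "p_plus E p < \<infinity>"
    and "weight \<Omega> v" and "0 < (\<integral>x. v x \<partial>lebesgue_on E)"
    and "matrix_weight \<Omega> Q"
    and "v \<in> Lp E p" and "(\<lambda>x. sqrt (onorm ((*v) (Q x)))) \<in> Lp E p"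
  shows "poincare_property E p v Q \<longleftrightarrow> neumann_property E p v Q"
proof -
  have sub: "E \<subseteq> \<Omega>" using assms(8) closure_subset by blast
  interpret neumann_setting E p v Q
  proof
    show "\<And>x. x \<in> E \<Longrightarrow> 0 \<le> v x" using assms(12) sub by (auto simp: weight_def)
    show "\<And>x. x \<in> E \<Longrightarrow> psd (Q x)" using assms(14) sub by (auto simp: matrix_weight_def)
    show "\<And>i j. (\<lambda>x. Q x $ i $ j) \<in> borel_measurable (lebesgue_on E)"
      using assms(14) by (intro measurable_restrict_mono[OF _ sub]) (simp add: matrix_weight_def)
  qed (use assms in auto)
  show ?thesis using neumann_of_poincare poincare_of_neumann by blast
qed

end
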